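(* Let $L>N$ be positive integers, let $0<|z|<\mathbf r_{N,L}$, and let $r_{1,N,L}(z):=\max_{v\in\mathcal R_z}|v|$ and $r_{2,N,L}(z):=\max_{u\in\mathcal L_z}|u+1|$. Let $\rho\in(0,1)$ satisfy $$r_{1,N,L}(z)<\rho<1-r_{2,N,L}(z),\qquad\rho^N(1-\rho)^{L-N}>|z|^L,$$ and set $$\mathsf z:=\frac{z^L}{(-\rho)^N(1-\rho)^{L-N}}.$$ Then $|\mathsf z|<1$. For every $Y\in\mathrm{Pconf}_{N,L}$ with $y_1<0$, the operator $K^{\mathrm{en}}_{Y,\mathsf z}$ (defined using the geometric random walk with parameter $\rho$) is trace class on $\ell^2(\mathbb Z_{\le0})$, and $$\mathcal E^{\mathrm{norm}}_Y(z)=\det\bigl(I-K^{\mathrm{en}}_{Y,\mathsf z}\bigr)_{\ell^2(\mathbb Z_{\le0})}.$$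
   Context: **Configurations.** $\mathrm{Pconf}_{N,L}$ is the set of $Y=(y_i)_{i\in\mathbb Z}$ with $y_i\in\mathbb Z$, $y_{i+1}<y_i$ and $y_{i+N}=y_i-L$ for all $i\in\mathbb Z$. **Bethe roots.** $q_z(w):=w^N(w+1)^{L-N}-z^L$ and $\mathbf r_{N,L}:=(N/L)^{N/L}(1-N/L)^{1-N/L}$. For $0<|z|<\mathbf r_{N,L}$, $\mathcal L_z:=\{w:q_z(w)=0,\mathrm{Re}\,w<-N/L\}$ ($L-N$ elements) and $\mathcal R_z:=\{w:q_z(w)=0,\mathrm{Re}\,w>-N/L\}$ ($N$ elements). **Normalized energy function.** Writing $\mathcal R_z=\{v_1,\dots,v_N\}$, $$\mathcal E_Y(z):=\frac{\det[v_i^{-j}(v_i+1)^{y_j+j}]_{i,j=1}^N}{\det[v_i^{-j}]_{i,j=1}^N},\qquad\mathcal E^{\mathrm{norm}}_Y(z):=\frac{\prod_{u\in\mathcal L_z}(-u)^N\prod_{v\in\mathcal R_z}(v+1)^{L-N}}{\prod_{v\in\mathcal R_z,\,u\in\mathcal L_z}(v-u)}\,\mathcal E_Y(z).$$ **The operator.** Let $(G_k)_{k\ge0}$ be the random walk with transition probabilities $\mathbb P(G_{k+1}=b\mid G_k=a)=\frac{\rho}{1-\rho}(1-\rho)^{a-b}\mathbf 1_{b-a\in\{-1,-2,\dots\}}$ and $\tau:=\inf\{m\ge0:G_m>y_{m+1}\}$. For $|\mathsf z|<1$ and $x,y\in\mathbb Z$, $$S_{\mathsf z}(x,y):=\sum_{k=1}^\infty\mathsf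 z^k\,\mathbb P_{G_0=x}(G_{kN}=-kL+y),\qquad T_Y(x,y):=\mathbb P_{G_0=x}(G_N=-L+y-1,\ \tau<N).$$ Then $K^{\mathrm{en}}_{Y,\mathsf z}:=-\mathsf z\,\mathbf 1_{\le0}\,\Sigma\,(I+S_{\mathsf z})\,T_Y\,\mathbf 1_{\le0}$ on $\ell^2(\mathbb Z_{\le0})$, where $(\Sigma f)(x):=f(x-1)$ and $\mathbf 1_{\le0}$ is multiplication by the indicator of $\mathbb Z_{\le0}$; that is, for $x,y\in\mathbb Z_{\le0}$, $K^{\mathrm{en}}_{Y,\mathsf z}(x,y)=-\mathsf z\bigl(T_Y(x-1,y)+\sum_{x'\in\mathbb Z}S_{\mathsf z}(x-1,x')T_Y(x',y)\bigr)$. *)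

theory Defs
  imports "HOL-Probability.Probability" "Jordan_Normal_Form.Determinant"
begin

section \<open>The Hilbert space of square-summable functions on a set\<close>

text \<open>Elements of \<open>\<ell>\<^sup>2(X)\<close> are represented by functions on the whole type that vanish off \<open>X\<close>,
  and operators on \<open>\<ell>\<^sup>2(X)\<close> by functions whose values off \<open>ell2 X\<close> are irrelevant.\<close>

definition ell2 :: "'a set \<Rightarrow> ('a \<Rightarrow> complex) set" where
  "ell2 X = {f. (\<forall>x. x \<notin> X \<longrightarrow> f x = 0) \<and> (\<lambda>x. (cmod (f x))\<^sup>2) summable_on X}"

definition ell2_inner :: "'a set \<Rightarrow> ('a \<Rightarrow> complex) \<Rightarrow> ('a \<Rightarrow> complex) \<Rightarrow> complex" where
  "ell2_inner X f g = (\<Sum>\<^sub>\<infinity>x\<in>X. cnj (f x) * g x)"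

definition ell2_norm :: "'a set \<Rightarrow> ('a \<Rightarrow> complex) \<Rightarrow> real" where
  "ell2_norm X f = sqrt (\<Sum>\<^sub>\<infinity>x\<in>X. (cmod (f x))\<^sup>2)"

definition ell2_basis :: "'a \<Rightarrow> 'a \<Rightarrow> complex" where
  "ell2_basis x = (\<lambda>y. if y = x then 1 else 0)"

definition bounded_operator ::
  "'a set \<Rightarrow> (('a \<Rightarrow> complex) \<Rightarrow> 'a \<Rightarrow> complex) \<Rightarrow> bool" where
  "bounded_operator X A \<longleftrightarrow>
     (\<forall>f\<in>ell2 X. A f \<in> ell2 X) \<and>
     (\<forall>f\<in>ell2 X. \<forall>g\<in>ell2 X. \<forall>c. A (\<lambda>x. c * f x + g x) = (\<lambda>x. c * A f x + A g x)) \<and>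
     (\<exists>C. \<forall>f\<in>ell2 X. ell2_norm X (A f) \<le> C * ell2_norm X f)"

definition is_adjoint ::
  "'a set \<Rightarrow> (('a \<Rightarrow> complex) \<Rightarrow> 'a \<Rightarrow> complex) \<Rightarrow> (('a \<Rightarrow> complex) \<Rightarrow> 'a \<Rightarrow> complex) \<Rightarrow> bool" where
  "is_adjoint X A B \<longleftrightarrow> bounded_operator X B \<and>
     (\<forall>f\<in>ell2 X. \<forall>g\<in>ell2 X. ell2_inner X (A f) g = ell2_inner X f (B g))"

definition positive_operator ::
  "'a set \<Rightarrow> (('a \<Rightarrow> complex) \<Rightarrow> 'a \<Rightarrow> complex) \<Rightarrow> bool" where
  "positive_operator X P \<longleftrightarrow> bounded_operator X P \<and>
     (\<forall>f\<in>ell2 X. Im (ell2_inner X f (P f)) = 0 \<and> 0 \<le> Re (ell2_inner X f (P f)))"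

text \<open>\<open>P = |A|\<close>, that is, \<open>P\<close> is the positive square root of \<open>A\<^sup>*A\<close>.\<close>

definition is_abs_operator ::
  "'a set \<Rightarrow> (('a \<Rightarrow> complex) \<Rightarrow> 'a \<Rightarrow> complex) \<Rightarrow> (('a \<Rightarrow> complex) \<Rightarrow> 'a \<Rightarrow> complex) \<Rightarrow> bool" where
  "is_abs_operator X A P \<longleftrightarrow> positive_operator X P \<and>
     (\<exists>B. is_adjoint X A B \<and> (\<forall>f\<in>ell2 X. P (P f) = B (A f)))"

text \<open>\<open>|A|\<close> exists and is unique on \<open>ell2 X\<close> for every bounded \<open>A\<close>; the trace of a positive operator
  does not depend on the orthonormal basis, so the standard one is used.\<close>

definition trace_class ::
  "'a set \<Rightarrow> (('a \<Rightarrow> complex) \<Rightarrow> 'a \<Rightarrow> complex) \<Rightarrow> bool" where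
  "trace_class X A \<longleftrightarrow> bounded_operator X A \<and>
     (\<exists>P. is_abs_operator X A P \<and>
        (\<lambda>x. ell2_inner X (ell2_basis x) (P (ell2_basis x))) summable_on X)"

text \<open>\<open>det(I - A)\<close> on \<open>\<ell>\<^sup>2(X)\<close>, as the Fredholm series in the matrix elements
  \<open>A(x,y) = (A e\<^sub>y)(x)\<close>. The inner sum is \<open>k!\<close> times the trace of the \<open>k\<close>-th exterior power of \<open>A\<close>;
  both sums converge absolutely if \<open>A\<close> is trace class.\<close>

definition fredholm_det ::
  "'a set \<Rightarrow> (('a \<Rightarrow> complex) \<Rightarrow> 'a \<Rightarrow> complex) \<Rightarrow> complex" where
  "fredholm_det X A =
     (\<Sum>\<^sub>\<infinity>k::nat. (- 1) ^ k / fact k *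
        (\<Sum>\<^sub>\<infinity>xs\<in>{xs. length xs = k \<and> set xs \<subseteq> X}.
           Determinant.det (Matrix.mat k k (\<lambda>(i, j). A (ell2_basis (xs ! j)) (xs ! i)))))"

text \<open>If \<open>kernel_operator X K\<close> is linear on \<open>ell2 X\<close> then the sum over \<open>y\<close> converges for every
  \<open>f \<in> ell2 X\<close>: the convention that divergent sums are \<open>0\<close> is incompatible with linearity.\<close>

definition kernel_operator ::
  "'a set \<Rightarrow> ('a \<Rightarrow> 'a \<Rightarrow> complex) \<Rightarrow> ('a \<Rightarrow> complex) \<Rightarrow> 'a \<Rightarrow> complex" where
  "kernel_operator X K f = (\<lambda>x. if x \<in> X then \<Sum>\<^sub>\<infinity>y\<in>X. K x y * f y else 0)"


section \<open>Configurations, Bethe roots and the energy function\<close>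

definition Pconf :: "nat \<Rightarrow> nat \<Rightarrow> (int \<Rightarrow> int) set" where
  "Pconf N L = {Y. \<forall>i. Y (i + 1) < Y i \<and> Y (i + int N) = Y i - int L}"

definition bethe_q :: "nat \<Rightarrow> nat \<Rightarrow> complex \<Rightarrow> complex \<Rightarrow> complex" where
  "bethe_q N L z w = w ^ N * (w + 1) ^ (L - N) - z ^ L"

definition bethe_radius :: "nat \<Rightarrow> nat \<Rightarrow> real" where
  "bethe_radius N L =
     (real N / real L) powr (real N / real L) * (1 - real N / real L) powr (1 - real N / real L)"

definition left_roots :: "nat \<Rightarrow> nat \<Rightarrow> complex \<Rightarrow> complex set" where
  "left_roots N L z = {w. bethe_q N L z w = 0 \<and> Re w < - (real N / real L)}"

definition right_roots :: "nat \<Rightarrow> nat \<Rightarrow> complex \<Rightarrow> complex set" where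
  "right_roots N L z = {w. bethe_q N L z w = 0 \<and> Re w > - (real N / real L)}"

definition right_root_radius :: "nat \<Rightarrow> nat \<Rightarrow> complex \<Rightarrow> real" where
  "right_root_radius N L z = Max (cmod ` right_roots N L z)"

definition left_root_radius :: "nat \<Rightarrow> nat \<Rightarrow> complex \<Rightarrow> real" where
  "left_root_radius N L z = Max ((\<lambda>u. cmod (u + 1)) ` left_roots N L z)"

text \<open>An arbitrary enumeration \<open>v 0, \<dots>, v (N - 1)\<close> of the right roots. The energy function does not
  depend on this choice, since a permutation of the roots changes both determinants by the same
  sign.\<close>

definition right_root_enum :: "nat \<Rightarrow> nat \<Rightarrow> complex \<Rightarrow> nat \<Rightarrow> complex" where
  "right_root_enum N L z = (SOME v. bij_betw v {..<N} (right_roots N L z))"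

text \<open>Indices are shifted by one: the entry at \<open>(i, j)\<close> belongs to \<open>v\<^sub>i\<^sub>+\<^sub>1\<close> and \<open>y\<^sub>j\<^sub>+\<^sub>1\<close>.\<close>

definition energy :: "nat \<Rightarrow> nat \<Rightarrow> (int \<Rightarrow> int) \<Rightarrow> complex \<Rightarrow> complex" where
  "energy N L Y z =
     (let v = right_root_enum N L z in
        Determinant.det (Matrix.mat N N
          (\<lambda>(i, j). v i powi (- (int j + 1)) * (v i + 1) powi (Y (int j + 1) + (int j + 1)))) /
        Determinant.det (Matrix.mat N N (\<lambda>(i, j). v i powi (- (int j + 1)))))"

definition energy_norm :: "nat \<Rightarrow> nat \<Rightarrow> (int \<Rightarrow> int) \<Rightarrow> complex \<Rightarrow> complex" where
  "energy_norm N L Y z =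
     (\<Prod>u\<in>left_roots N L z. (- u) ^ N) * (\<Prod>v\<in>right_roots N L z. (v + 1) ^ (L - N)) /
     (\<Prod>v\<in>right_roots N L z. \<Prod>u\<in>left_roots N L z. v - u) * energy N L Y z"


section \<open>The geometric random walk and the operator\<close>

definition step_pmf :: "real \<Rightarrow> int pmf" where
  "step_pmf \<rho> = map_pmf (\<lambda>k. - int k - 1) (geometric_pmf \<rho>)"

lemma pmf_step_pmf:
  assumes "0 < \<rho>" "\<rho> < 1"
  shows "pmf (step_pmf \<rho>) (b - a) =
    (if b - a \<in> {..- 1} then \<rho> / (1 - \<rho>) * (1 - \<rho>) powi (a - b) else 0)"
proof (cases "b - a \<le> - 1")
  case True
  define k where "k = nat (a - b - 1)"
  have k: "b - a = - int k - 1" "a - b = int (Suc k)"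
    using True by (auto simp: k_def)
  have "pmf (step_pmf \<rho>) (- int k - 1) = pmf (geometric_pmf \<rho>) k"
    unfolding step_pmf_def by (rule pmf_map_inj') (auto simp: inj_on_def)
  also have "\<dots> = (1 - \<rho>) ^ k * \<rho>"
    using assms by simp
  also have "\<dots> = \<rho> / (1 - \<rho>) * (1 - \<rho>) powi (a - b)"
    using assms unfolding k(2) power_int_of_nat by (simp add: field_simps)
  finally show ?thesis
    using True k(1) by simp
next
  case False
  then have "b - a \<notin> set_pmf (step_pmf \<rho>)"
    by (auto simp: step_pmf_def)
  with False show ?thesis
    by (simp add: set_pmf_iff)
qed

text \<open>The sample space of the i.i.d. increments of the walk, and the walk started at \<open>x\<close>.\<close>

definition walk_measure :: "real \<Rightarrow> (nat \<Rightarrow> int) measure" where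
  "walk_measure \<rho> = Pi\<^sub>M UNIV (\<lambda>_::nat. measure_pmf (step_pmf \<rho>))"

definition walk :: "int \<Rightarrow> nat \<Rightarrow> (nat \<Rightarrow> int) \<Rightarrow> int" where
  "walk x k \<omega> = x + (\<Sum>i<k. \<omega> i)"

definition hit_time :: "(int \<Rightarrow> int) \<Rightarrow> int \<Rightarrow> (nat \<Rightarrow> int) \<Rightarrow> enat" where
  "hit_time Y x \<omega> = Inf {enat m | m. walk x m \<omega> > Y (int m + 1)}"

definition S_kernel :: "real \<Rightarrow> nat \<Rightarrow> nat \<Rightarrow> complex \<Rightarrow> int \<Rightarrow> int \<Rightarrow> complex" where
  "S_kernel \<rho> N L \<zeta> x y =
     (\<Sum>\<^sub>\<infinity>k\<in>{1::nat..}. \<zeta> ^ k * of_real (measure (walk_measure \<rho>)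
        {\<omega> \<in> space (walk_measure \<rho>). walk x (k * N) \<omega> = - (int k * int L) + y}))"

definition T_kernel :: "real \<Rightarrow> nat \<Rightarrow> nat \<Rightarrow> (int \<Rightarrow> int) \<Rightarrow> int \<Rightarrow> int \<Rightarrow> real" where
  "T_kernel \<rho> N L Y x y = measure (walk_measure \<rho>)
     {\<omega> \<in> space (walk_measure \<rho>). walk x N \<omega> = - int L + y - 1 \<and> hit_time Y x \<omega> < enat N}"

definition K_en :: "real \<Rightarrow> nat \<Rightarrow> nat \<Rightarrow> (int \<Rightarrow> int) \<Rightarrow> complex \<Rightarrow> int \<Rightarrow> int \<Rightarrow> complex" where
  "K_en \<rho> N L Y \<zeta> x y =
     - \<zeta> * (of_real (T_kernel \<rho> N L Y (x - 1) y) +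
       (\<Sum>\<^sub>\<infinity>x'. S_kernel \<rho> N L \<zeta> (x - 1) x' * of_real (T_kernel \<rho> N L Y x' y)))"

end

theory Submission
  imports Defs "HOL-Combinatorics.Multiset_Permutations" "Jordan_Normal_Form.Spectral_Radius"
    "HOL-Complex_Analysis.Complex_Analysis" "HOL-Computational_Algebra.Fundamental_Theorem_Algebra"
begin

text \<open>Let \<open>Q\<close> be the transition matrix of the walk, \<open>B = \<zeta> Q\<^sup>N\<close> followed by the shift by \<open>L\<close>, and \<open>B\<^sub>Y\<close> its
  restriction to walks that stay below \<open>Y\<close>. On the negative integers \<open>I - K = \<chi> (I - B)\<^sup>-\<^sup>1 (I - B\<^sub>Y) \<chi>\<close>.
  Up to geometric weights, an \<open>N\<close>-fold difference annihilates all but finitely many entries of each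
  row of \<open>K\<close>, so \<open>K\<close> has finite rank and its Fredholm determinant is that of the matrix of \<open>I - K\<close> on a
  finite-dimensional space of row vectors. The rows of \<open>Q\<^sup>N (I - B)\<^sup>-\<^sup>1\<close> are sums of exponentials
  \<open>(w + 1)\<^sup>y\<close> over the Bethe roots: over the right roots on one side of the diagonal and over the left
  roots on the other. Applying \<open>I - B\<^sub>Y\<close> to the exponentials of the right roots produces the entries
  \<open>v\<^sup>-\<^sup>j (v + 1)\<^bsup>y\<^sub>j + j\<^esup>\<close> times a unitriangular matrix. The determinant thus factors into the one in the
  energy function and Vandermonde determinants that give the normalization.\<close>

text \<open>The cut-off \<chi> would normally require inverting a truncated operator. It is harmless
  here because of the choice of row vectors: the row of \<open>Q\<^sup>N\<close> that starts at c <
  N lives on the negative integers, so its product with K is a sum over the whole line, where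
  \<open>(I - B)\<^sup>-\<^sup>1\<close> is a Neumann series with a closed form. The same rows are
  the kernel of N-fold summation, so a row of K with finitely many nonzero N-th differences is a
  finite combination of them.

  The bounds on \<rho> say that the circle of radius 1 - \<rho> about -1 separates the left from the
  right roots. Hence, with the geometric weight, the row built from right roots for x < c and left
  roots for x \<ge> c is summable at both ends, which singles it out among the solutions of its
  recurrence.

  The restricted walk starts at some x \<le> \<open>y\<^sub>1\<close>, below every c in use, so it
  meets exponentials of right roots only. By the Bethe equation I - B formally annihilates them;
  what I - \<open>B\<^sub>Y\<close> leaves are the upper ends of geometric sums cut at the barriers,
  and these are the entries of the energy determinant.\<close>

section \<open>Fredholm determinants of finite-rank kernels\<close>

text \<open>Fubini on the k-th power of \<open>X\<close>, in the list form that
  \<open>fredholm_det\<close> uses, by splitting off the head.\<close>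

lemma infsum_lists_prod:
  fixes F :: "nat \<Rightarrow> 'a \<Rightarrow> complex"
  assumes "\<And>j. j < k \<Longrightarrow> (\<lambda>x. norm (F j x)) summable_on X"
  shows "(\<lambda>xs. norm (\<Prod>j<k. F j (xs ! j))) summable_on {xs. length xs = k \<and> set xs \<subseteq> X} \<and>
    infsum (\<lambda>xs. \<Prod>j<k. F j (xs ! j)) {xs. length xs = k \<and> set xs \<subseteq> X} = (\<Prod>j<k. infsum (F j) X)"
  using assms
proof (induction k arbitrary: F)
  case 0
  have "{xs::'a list. length xs = 0 \<and> set xs \<subseteq> X} = {[]}" by auto
  then show ?case by simp
next
  case (Suc k)
  let ?L = "{xs. length xs = k \<and> set xs \<subseteq> X}"
  define G where "G = (\<lambda>xs. \<Prod>j<k. F (Suc j) (xs ! j))"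
  have IH: "(\<lambda>xs. norm (G xs)) summable_on ?L" "infsum G ?L = (\<Prod>j<k. infsum (F (Suc j)) X)"
    using Suc.IH[of "\<lambda>j. F (Suc j)"] Suc.prems unfolding G_def by auto
  have F0: "(\<lambda>x. norm (F 0 x)) summable_on X" using Suc.prems by auto
  have sm: "(\<lambda>p. norm (F 0 (fst p) * G (snd p))) summable_on X \<times> ?L"
    unfolding Infinite_Sum.abs_summable_on_Sigma_iff
  proof (intro conjI ballI)
    fix x show "(\<lambda>y. norm (F 0 (fst (x, y)) * G (snd (x, y)))) summable_on ?L"
      using summable_on_cmult_right[OF IH(1), of "norm (F 0 x)"] by (simp add: norm_mult)
    have "(\<lambda>x. norm (F 0 x) * infsum (\<lambda>y. norm (G y)) ?L) summable_on X"
      using summable_on_cmult_left[OF F0] by simp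
    then have "(\<lambda>x. norm (norm (F 0 x) * infsum (\<lambda>y. norm (G y)) ?L)) summable_on X"
      by (simp add: infsum_nonneg abs_mult)
    then show "(\<lambda>x. norm (\<Sum>\<^sub>\<infinity>y\<in>?L. norm (F 0 (fst (x, y)) * G (snd (x, y))))) summable_on X"
      by (simp add: norm_mult infsum_cmult_right')
  qed
  have bij: "bij_betw (\<lambda>p. fst p # snd p) (X \<times> ?L) {xs. length xs = Suc k \<and> set xs \<subseteq> X}"
    by (rule bij_betwI[of _ _ _ "\<lambda>xs. (hd xs, tl xs)"])
       (auto simp: length_Suc_conv)
  have eq: "(\<Prod>j<Suc k. F j ((fst p # snd p) ! j)) = F 0 (fst p) * G (snd p)" for p
    unfolding G_def by (subst prod.lessThan_Suc_shift) simp
  have a: "(\<lambda>xs. norm (\<Prod>j<Suc k. F j (xs ! j))) summable_on {xs. length xs = Suc k \<and> set xs \<subseteq> X}"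
    using sm unfolding summable_on_reindex_bij_betw[OF bij, symmetric] eq .
  have "infsum (\<lambda>xs. \<Prod>j<Suc k. F j (xs ! j)) {xs. length xs = Suc k \<and> set xs \<subseteq> X}
    = infsum (\<lambda>p. F 0 (fst p) * G (snd p)) (X \<times> ?L)"
    unfolding infsum_reindex_bij_betw[OF bij, symmetric] eq ..
  also have "\<dots> = infsum (\<lambda>x. infsum (\<lambda>y. F 0 x * G y) ?L) X"
    by (subst infsum_Sigma_banach[symmetric]) (use abs_summable_summable[OF sm] in auto)
  also have "\<dots> = infsum (F 0) X * infsum G ?L"
    by (simp add: infsum_cmult_right' infsum_cmult_left')
  finally show ?case using a IH(2) by (subst prod.lessThan_Suc_shift) simp
qed

lemma
  fixes f :: "'b \<Rightarrow> 'a \<Rightarrow> 'c::{topological_comm_monoid_add, t2_space}"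
  assumes "\<And>a. a \<in> A \<Longrightarrow> f a summable_on X"
  shows summable_on_finite_sum: "(\<lambda>x. \<Sum>a\<in>A. f a x) summable_on X"
    and infsum_finite_sum: "infsum (\<lambda>x. \<Sum>a\<in>A. f a x) X = (\<Sum>a\<in>A. infsum (f a) X)"
proof -
  have "(\<lambda>x. \<Sum>a\<in>A. f a x) summable_on X \<and> infsum (\<lambda>x. \<Sum>a\<in>A. f a x) X = (\<Sum>a\<in>A. infsum (f a) X)"
    using assms
  proof (induction A rule: infinite_finite_induct)
    case (insert p A)
    then show ?case by (simp add: summable_on_add infsum_add)
  qed simp_all
  then show "(\<lambda>x. \<Sum>a\<in>A. f a x) summable_on X" "infsum (\<lambda>x. \<Sum>a\<in>A. f a x) X = (\<Sum>a\<in>A. infsum (f a) X)"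
    by auto
qed

text \<open>Indexing by a set lets the principal minors of one matrix range over subsets
  \<open>S\<close> with no enumeration of their elements.\<close>

definition det_on :: "'a set \<Rightarrow> ('a \<Rightarrow> 'a \<Rightarrow> complex) \<Rightarrow> complex" where
  "det_on S M = (\<Sum>p | p permutes S. of_int (sign p) * (\<Prod>i\<in>S. M i (p i)))"

lemma det_mat_eq_det_on: "Determinant.det (Matrix.mat k k (\<lambda>(i, j). M i j)) = det_on {..<k} M"
proof -
  have "Determinant.det (Matrix.mat k k (\<lambda>(i, j). M i j)) =
    (\<Sum>p | p permutes {0..<k}. of_int (sign p) * (\<Prod>i = 0..<k. Matrix.mat k k (\<lambda>(i, j). M i j) $$ (i, p i)))"
    by (subst det_def'[of _ k]) auto
  also have "\<dots> = det_on {..<k} M"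
    unfolding det_on_def lessThan_atLeast0
    by (intro sum.cong refl arg_cong2[where f = "(*)"] prod.cong) (auto simp: permutes_in_image)
  finally show ?thesis .
qed

lemma det_on_reindex:
  assumes c: "bij_betw c A S" and "finite A"
  shows "det_on A (\<lambda>i j. M (c i) (c j)) = det_on S M"
proof -
  have inj: "inj_on c A" and S: "S = c ` A" using c by (auto simp: bij_betw_def)
  have mp: "map_permutation A c p = (\<lambda>x. if x \<in> S then c (p (inv_into A c x)) else x)" for p
    by (auto simp: map_permutation_def restrict_id_def S)
  have "det_on S M = (\<Sum>p | p permutes A. of_int (sign (map_permutation A c p)) * (\<Prod>i\<in>S. M i (map_permutation A c p i)))"
    unfolding det_on_def mp by (rule sum.reindex_bij_betw[OF bij_betw_permutations[OF c], symmetric])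
  also have "\<dots> = det_on A (\<lambda>i j. M (c i) (c j))"
    unfolding det_on_def
  proof (intro sum.cong refl arg_cong2[where f = "(*)"])
    fix p assume p: "p \<in> {p. p permutes A}"
    show "of_int (sign (map_permutation A c p)) = (of_int (sign p) :: complex)"
      using sign_map_permutation[OF inj] p \<open>finite A\<close> by auto
    have "(\<Prod>i\<in>S. M i (map_permutation A c p i)) = (\<Prod>i\<in>A. M (c i) (map_permutation A c p (c i)))"
      by (rule prod.reindex_bij_betw[OF c, symmetric])
    also have "\<dots> = (\<Prod>i\<in>A. M (c i) (c (p i)))"
      using p by (intro prod.cong refl) (simp add: map_permutation_apply[OF inj])
    finally show "(\<Prod>i\<in>S. M i (map_permutation A c p i)) = (\<Prod>i\<in>A. M (c i) (c (p i)))" .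
  qed
  finally show ?thesis ..
qed

text \<open>Multiply out each product over \<open>A\<close> and let \<open>S\<close> collect the
  factors taken from \<open>M\<close>. The remaining Kronecker deltas force \<open>p\<close> to fix
  \<open>A - S\<close>, so \<open>p\<close> permutes \<open>S\<close>.\<close>

lemma det_on_one_minus:
  assumes fin: "finite A"
  shows "det_on A (\<lambda>i j. (if i = j then 1 else 0) - M i j) = (\<Sum>S\<in>Pow A. (-1) ^ card S * det_on S M)"
proof -
  have "det_on A (\<lambda>i j. (if i = j then 1 else 0) - M i j) =
    (\<Sum>p | p permutes A. \<Sum>S\<in>Pow A. of_int (sign p) * ((-1) ^ card S * (\<Prod>i\<in>S. M i (p i)) * (\<Prod>i\<in>A - S. if i = p i then 1 else 0)))"
    unfolding det_on_def prod_diff_conv_sum[OF fin] by (simp add: sum_distrib_left)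
  also have "\<dots> = (\<Sum>S\<in>Pow A. \<Sum>p | p permutes A. of_int (sign p) * ((-1) ^ card S * (\<Prod>i\<in>S. M i (p i)) * (\<Prod>i\<in>A - S. if i = p i then 1 else 0)))"
    by (rule sum.swap)
  also have "\<dots> = (\<Sum>S\<in>Pow A. (-1) ^ card S * det_on S M)"
  proof (intro sum.cong refl)
    fix S assume S: "S \<in> Pow A"
    have "(\<Sum>p | p permutes A. of_int (sign p) * ((-1) ^ card S * (\<Prod>i\<in>S. M i (p i)) * (\<Prod>i\<in>A - S. if i = p i then 1 else 0)))
      = (\<Sum>p | p permutes S. of_int (sign p) * ((-1) ^ card S * (\<Prod>i\<in>S. M i (p i))))"
    proof (rule sum.mono_neutral_cong_right)
      show "finite {p. p permutes A}" using fin by (rule finite_permutations)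
      show "{p. p permutes S} \<subseteq> {p. p permutes A}" using S permutes_subset by blast
      show "\<forall>p\<in>{p. p permutes A} - {p. p permutes S}. of_int (sign p) * ((-1) ^ card S * (\<Prod>i\<in>S. M i (p i)) * (\<Prod>i\<in>A - S. if i = p i then 1 else 0)) = 0"
      proof
        fix p assume "p \<in> {p. p permutes A} - {p. p permutes S}"
        then have "\<exists>i\<in>A - S. i \<noteq> p i"
          using permutes_superset[of p A S] by (metis Diff_iff mem_Collect_eq)
        then have "(\<Prod>i\<in>A - S. if i = p i then 1 else 0) = (0::complex)"
          using fin by (intro prod_zero) auto
        then show "of_int (sign p) * ((-1) ^ card S * (\<Prod>i\<in>S. M i (p i)) * (\<Prod>i\<in>A - S. if i = p i then 1 else 0)) = 0"
          by simp
      qed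
      fix p assume "p \<in> {p. p permutes S}"
      then have "(\<Prod>i\<in>A - S. if i = p i then 1 else 0) = (1::complex)"
        by (intro prod.neutral) (auto simp: permutes_not_in)
      then show "of_int (sign p) * ((-1) ^ card S * (\<Prod>i\<in>S. M i (p i)) * (\<Prod>i\<in>A - S. if i = p i then 1 else 0)) =
        of_int (sign p) * ((-1) ^ card S * (\<Prod>i\<in>S. M i (p i)))" by simp
    qed
    also have "\<dots> = (-1) ^ card S * det_on S M"
      unfolding det_on_def by (simp add: sum_distrib_left mult_ac)
    finally show "(\<Sum>p | p permutes A. of_int (sign p) * ((-1) ^ card S * (\<Prod>i\<in>S. M i (p i)) * (\<Prod>i\<in>A - S. if i = p i then 1 else 0))) = (-1) ^ card S * det_on S M" .
  qed
  finally show ?thesis .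
qed

text \<open>A list with a repetition gives two equal rows, and each k-subset has k! listings with
  the same minor. This factor cancels the factorial in the Fredholm series.\<close>

lemma det_on_lists:
  assumes fin: "finite A"
  shows "(\<Sum>cs | length cs = k \<and> set cs \<subseteq> A. det_on {..<k} (\<lambda>i j. M (cs ! i) (cs ! j)))
    = fact k * (\<Sum>S | S \<subseteq> A \<and> card S = k. det_on S M)"
proof -
  let ?g = "\<lambda>cs. det_on {..<k} (\<lambda>i j. M (cs ! i) (cs ! j))"
  have fl: "finite {cs. length cs = k \<and> set cs \<subseteq> A}"
    using finite_lists_length_eq[OF fin, of k] by (simp add: conj_commute)
  have nd: "?g cs = 0" if dist: "length cs = k" "\<not> distinct cs" for cs
  proof -
    obtain i j where ij: "i < k" "j < k" "i \<noteq> j" "cs ! i = cs ! j"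
      using dist unfolding distinct_conv_nth by blast
    have "Determinant.det (Matrix.mat k k (\<lambda>(i, j). M (cs ! i) (cs ! j))) = 0"
      by (rule det_identical_rows[of _ k i j]) (use ij in \<open>auto intro!: eq_vecI\<close>)
    then show ?thesis by (simp add: det_mat_eq_det_on)
  qed
  have "sum ?g {cs. length cs = k \<and> set cs \<subseteq> A} = sum ?g {cs. length cs = k \<and> set cs \<subseteq> A \<and> distinct cs}"
    by (rule sum.mono_neutral_right) (use fl nd in auto)
  also have "{cs. length cs = k \<and> set cs \<subseteq> A \<and> distinct cs} = (\<Union>S\<in>{S. S \<subseteq> A \<and> card S = k}. permutations_of_set S)"
    by (auto simp: permutations_of_set_def distinct_card)
  also have "sum ?g \<dots> = (\<Sum>S | S \<subseteq> A \<and> card S = k. sum ?g (permutations_of_set S))"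
    by (rule sum.UNION_disjoint) (use fin in \<open>auto dest: permutations_of_setD(1)\<close>)
  also have "\<dots> = (\<Sum>S | S \<subseteq> A \<and> card S = k. fact k * det_on S M)"
  proof (intro sum.cong refl)
    fix S assume S: "S \<in> {S. S \<subseteq> A \<and> card S = k}"
    then have fS: "finite S" using fin finite_subset by auto
    have "sum ?g (permutations_of_set S) = (\<Sum>cs\<in>permutations_of_set S. det_on S M)"
    proof (intro sum.cong refl)
      fix cs assume "cs \<in> permutations_of_set S"
      then have cs: "set cs = S" "distinct cs" "length cs = k"
        using S by (auto simp: permutations_of_set_def distinct_card[symmetric])
      then have "bij_betw ((!) cs) {..<k} S"
        using bij_betw_nth[OF cs(2)] by auto
      then show "?g cs = det_on S M" by (rule det_on_reindex) simp
    qed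
    also have "\<dots> = fact k * det_on S M" using fS S by simp
    finally show "sum ?g (permutations_of_set S) = fact k * det_on S M" .
  qed
  finally show ?thesis by (simp add: sum_distrib_left)
qed

lemma fredholm_series_finite:
  assumes fin: "finite A"
  shows "(\<Sum>\<^sub>\<infinity>k::nat. (- 1) ^ k / fact k *
      (\<Sum>cs | length cs = k \<and> set cs \<subseteq> A. det_on {..<k} (\<lambda>i j. M (cs ! i) (cs ! j))))
    = det_on A (\<lambda>i j. (if i = j then 1 else 0) - M i j)"
proof -
  have "(\<Sum>\<^sub>\<infinity>k::nat. (- 1) ^ k / fact k *
      (\<Sum>cs | length cs = k \<and> set cs \<subseteq> A. det_on {..<k} (\<lambda>i j. M (cs ! i) (cs ! j))))
    = (\<Sum>\<^sub>\<infinity>k::nat. (- 1) ^ k * (\<Sum>S | S \<subseteq> A \<and> card S = k. det_on S M))"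
    by (simp add: det_on_lists[OF fin])
  also have "\<dots> = (\<Sum>\<^sub>\<infinity>k\<in>{..card A}. (- 1) ^ k * (\<Sum>S | S \<subseteq> A \<and> card S = k. det_on S M))"
  proof (rule infsum_cong_neutral)
    fix k assume "k \<in> UNIV - {..card A}"
    then have "{S. S \<subseteq> A \<and> card S = k} = {}" using card_mono[OF fin] by force
    then show "(- 1) ^ k * (\<Sum>S | S \<subseteq> A \<and> card S = k. det_on S M) = 0" by (simp only: sum.empty mult_zero_right)
  qed auto
  also have "\<dots> = (\<Sum>k\<le>card A. \<Sum>S | S \<in> Pow A \<and> card S = k. (- 1) ^ card S * det_on S M)"
    by (simp add: sum_distrib_left)
  also have "\<dots> = (\<Sum>S\<in>Pow A. (- 1) ^ card S * det_on S M)"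
    by (rule sum.group) (use fin in \<open>auto intro: card_mono\<close>)
  finally show ?thesis using det_on_one_minus[OF fin] by simp
qed

text \<open>K factors through an \<open>r\<close>-dimensional space, and det(I - f g) = det(I - g
  f). In the series, each term of the Leibniz expansion is a product of functions of one coordinate
  each, so its sum over all lists is a product of entries of g f.\<close>

lemma fredholm_det_finite_rank:
  fixes K :: "'a \<Rightarrow> 'a \<Rightarrow> complex" and f g :: "nat \<Rightarrow> 'a \<Rightarrow> complex"
  assumes K: "\<And>x y. x \<in> X \<Longrightarrow> y \<in> X \<Longrightarrow> K x y = (\<Sum>j<r. f j x * g j y)"
    and sm: "\<And>i j. i < r \<Longrightarrow> j < r \<Longrightarrow> (\<lambda>x. norm (g i x * f j x)) summable_on X"
  shows "fredholm_det X (kernel_operator X K) =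
    Determinant.det (Matrix.mat r r (\<lambda>(i, j). (if i = j then 1 else 0) - (\<Sum>\<^sub>\<infinity>x\<in>X. g i x * f j x)))"
proof -
  define M where "M = (\<lambda>i j. \<Sum>\<^sub>\<infinity>x\<in>X. g i x * f j x)"
  have ko: "kernel_operator X K (ell2_basis y) x = K x y" if "x \<in> X" "y \<in> X" for x y
  proof -
    have "(\<Sum>\<^sub>\<infinity>t\<in>X. K x t * ell2_basis y t) = (\<Sum>\<^sub>\<infinity>t\<in>{y}. K x t * ell2_basis y t)"
      by (rule infsum_cong_neutral) (use that in \<open>auto simp: ell2_basis_def\<close>)
    then show ?thesis using that by (simp add: kernel_operator_def ell2_basis_def)
  qed
  have inner: "(\<Sum>\<^sub>\<infinity>xs\<in>{xs. length xs = k \<and> set xs \<subseteq> X}.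
      Determinant.det (Matrix.mat k k (\<lambda>(i, j). kernel_operator X K (ell2_basis (xs ! j)) (xs ! i))))
    = (\<Sum>cs | length cs = k \<and> set cs \<subseteq> {..<r}. det_on {..<k} (\<lambda>i j. M (cs ! i) (cs ! j)))" for k
  proof -
    let ?L = "{xs. length xs = k \<and> set xs \<subseteq> X}"
    let ?R = "{cs. length cs = k \<and> set cs \<subseteq> {..<r}}"
    let ?P = "{p. p permutes {..<k}}"
    define F where "F = (\<lambda>p cs j x. f (cs ! j) x * g (cs ! (p j)) x)"
    have ex: "Determinant.det (Matrix.mat k k (\<lambda>(i, j). kernel_operator X K (ell2_basis (xs ! j)) (xs ! i)))
      = (\<Sum>p\<in>?P. \<Sum>cs\<in>?R. of_int (sign p) * (\<Prod>j<k. F p cs j (xs ! j)))" if xs: "xs \<in> ?L" for xs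
    proof -
      have "Determinant.det (Matrix.mat k k (\<lambda>(i, j). kernel_operator X K (ell2_basis (xs ! j)) (xs ! i)))
        = Determinant.det (Matrix.mat k k (\<lambda>(i, j). K (xs ! i) (xs ! j)))"
        by (intro arg_cong[where f = Determinant.det] cong_mat refl)
           (use xs in \<open>auto intro!: ko simp: subset_iff\<close>)
      also have "\<dots> = (\<Sum>p\<in>?P. of_int (sign p) * (\<Prod>i<k. K (xs ! i) (xs ! p i)))"
        by (simp add: det_mat_eq_det_on det_on_def)
      \<comment> \<open>Passing to inverse permutations gathers all that depends on
        \<open>xs ! j\<close>: the factor \<open>f\<close> with index \<open>cs ! j\<close> and the
        factor \<open>g\<close> with index \<open>cs ! p j\<close>.\<close>
      also have "\<dots> = (\<Sum>p\<in>?P. of_int (sign (inv_into UNIV p)) * (\<Prod>i<k. K (xs ! i) (xs ! inv_into UNIV p i)))"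
        by (rule sum_permutations_inverse)
      also have "\<dots> = (\<Sum>p\<in>?P. \<Sum>cs\<in>?R. of_int (sign p) * (\<Prod>j<k. F p cs j (xs ! j)))"
      proof (intro sum.cong refl)
        fix p assume "p \<in> ?P"
        then have p: "p permutes {..<k}" by simp
        have pin: "p j < k \<longleftrightarrow> j < k" for j using permutes_in_image[OF p, of j] by simp
        have ipin: "inv_into UNIV p j < k \<longleftrightarrow> j < k" for j using permutes_in_image[OF permutes_inv[OF p], of j] by simp
        have "(\<Prod>i<k. K (xs ! i) (xs ! inv_into UNIV p i)) = (\<Prod>i<k. \<Sum>c<r. f c (xs ! i) * g c (xs ! inv_into UNIV p i))"
          by (intro prod.cong refl K) (use xs ipin in \<open>auto simp: subset_iff\<close>)
        also have "\<dots> = (\<Sum>c\<in>PiE {..<k} (\<lambda>_. {..<r}). \<Prod>i<k. f (c i) (xs ! i) * g (c i) (xs ! inv_into UNIV p i))"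
          by (rule prod_sum_PiE) auto
        also have "\<dots> = (\<Sum>cs\<in>?R. \<Prod>i<k. f (cs ! i) (xs ! i) * g (cs ! i) (xs ! inv_into UNIV p i))"
        proof (rule sum.reindex_bij_witness[where i = "\<lambda>cs. \<lambda>i\<in>{..<k}. cs ! i" and j = "\<lambda>c. map c [0..<k]"])
          fix c assume c: "c \<in> PiE {..<k} (\<lambda>_. {..<r})"
          show "(\<lambda>i\<in>{..<k}. map c [0..<k] ! i) = c"
            using PiE_arb[OF c] by (intro ext) (auto simp: restrict_def)
          show "map c [0..<k] \<in> ?R" using PiE_mem[OF c] by (simp add: image_subset_iff)
          show "(\<Prod>i<k. f (map c [0..<k] ! i) (xs ! i) * g (map c [0..<k] ! i) (xs ! inv_into UNIV p i)) =
            (\<Prod>i<k. f (c i) (xs ! i) * g (c i) (xs ! inv_into UNIV p i))"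
            by (rule prod.cong) auto
        next
          fix cs assume cs: "cs \<in> ?R"
          show "map (\<lambda>i\<in>{..<k}. cs ! i) [0..<k] = cs"
            by (rule nth_equalityI) (use cs in simp_all)
          show "(\<lambda>i\<in>{..<k}. cs ! i) \<in> PiE {..<k} (\<lambda>_. {..<r})"
            using cs by (simp add: restrict_PiE_iff subset_iff)
        qed
        also have "\<dots> = (\<Sum>cs\<in>?R. \<Prod>j<k. F p cs j (xs ! j))"
        proof (intro sum.cong refl)
          fix cs
          have "(\<Prod>i<k. g (cs ! i) (xs ! inv_into UNIV p i)) = (\<Prod>i<k. g (cs ! p i) (xs ! i))"
            by (subst prod.permute[OF p]) (simp add: o_def permutes_inverses[OF p])
          then show "(\<Prod>i<k. f (cs ! i) (xs ! i) * g (cs ! i) (xs ! inv_into UNIV p i)) = (\<Prod>j<k. F p cs j (xs ! j))"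
            unfolding F_def by (simp add: prod.distrib)
        qed
        finally show "of_int (sign (inv_into UNIV p)) * (\<Prod>i<k. K (xs ! i) (xs ! inv_into UNIV p i)) =
            (\<Sum>cs\<in>?R. of_int (sign p) * (\<Prod>j<k. F p cs j (xs ! j)))"
          using sign_inverse[OF permutes_imp_permutation[OF finite_lessThan p]] by (simp add: sum_distrib_left)
      qed
      finally show ?thesis .
    qed
    have Fs: "(\<lambda>x. norm (F p cs j x)) summable_on X" if "p \<in> ?P" "cs \<in> ?R" "j < k" for p cs j
    proof -
      have "p j < k" using that permutes_in_image[of p "{..<k}" j] by simp
      then have "cs ! j < r" "cs ! p j < r" using that by (auto simp: subset_iff)
      then show ?thesis using sm unfolding F_def by (simp add: mult.commute)
    qed
    have Fi: "infsum (F p cs j) X = M (cs ! p j) (cs ! j)" for p cs j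
      unfolding F_def M_def by (simp add: mult.commute)
    have prod: "(\<lambda>xs. \<Prod>j<k. F p cs j (xs ! j)) summable_on ?L"
      "infsum (\<lambda>xs. \<Prod>j<k. F p cs j (xs ! j)) ?L = (\<Prod>j<k. M (cs ! p j) (cs ! j))"
      if "p \<in> ?P" "cs \<in> ?R" for p cs
      using infsum_lists_prod[of k "F p cs" X] Fs[OF that] by (auto simp: Fi intro: abs_summable_summable)
    have "(\<Sum>\<^sub>\<infinity>xs\<in>?L. Determinant.det (Matrix.mat k k (\<lambda>(i, j). kernel_operator X K (ell2_basis (xs ! j)) (xs ! i))))
      = (\<Sum>\<^sub>\<infinity>xs\<in>?L. \<Sum>p\<in>?P. \<Sum>cs\<in>?R. of_int (sign p) * (\<Prod>j<k. F p cs j (xs ! j)))"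
      by (rule infsum_cong) (rule ex)
    also have "\<dots> = (\<Sum>p\<in>?P. \<Sum>\<^sub>\<infinity>xs\<in>?L. \<Sum>cs\<in>?R. of_int (sign p) * (\<Prod>j<k. F p cs j (xs ! j)))"
      by (intro infsum_finite_sum summable_on_finite_sum summable_on_cmult_right prod)
    also have "\<dots> = (\<Sum>p\<in>?P. \<Sum>cs\<in>?R. \<Sum>\<^sub>\<infinity>xs\<in>?L. of_int (sign p) * (\<Prod>j<k. F p cs j (xs ! j)))"
      by (intro sum.cong refl infsum_finite_sum summable_on_cmult_right prod)
    also have "\<dots> = (\<Sum>p\<in>?P. \<Sum>cs\<in>?R. of_int (sign p) * (\<Prod>j<k. M (cs ! p j) (cs ! j)))"
      by (intro sum.cong refl) (simp add: infsum_cmult_right' prod)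
    also have "\<dots> = (\<Sum>cs\<in>?R. \<Sum>p\<in>?P. of_int (sign p) * (\<Prod>j<k. M (cs ! p j) (cs ! j)))"
      by (rule sum.swap)
    also have "\<dots> = (\<Sum>cs\<in>?R. det_on {..<k} (\<lambda>i j. M (cs ! i) (cs ! j)))"
    proof (intro sum.cong refl)
      fix cs
      have "(\<Sum>p\<in>?P. of_int (sign p) * (\<Prod>j<k. M (cs ! p j) (cs ! j)))
        = (\<Sum>p\<in>?P. of_int (sign (inv_into UNIV p)) * (\<Prod>j<k. M (cs ! inv_into UNIV p j) (cs ! j)))"
        by (rule sum_permutations_inverse)
      also have "\<dots> = (\<Sum>p\<in>?P. of_int (sign p) * (\<Prod>j<k. M (cs ! j) (cs ! p j)))"
      proof (intro sum.cong refl arg_cong2[where f = "(*)"])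
        fix p assume "p \<in> ?P"
        then have p: "p permutes {..<k}" by simp
        show "of_int (sign (inv_into UNIV p)) = (of_int (sign p) :: complex)"
          using p by (simp add: sign_inverse permutes_imp_permutation[OF finite_lessThan p])
        show "(\<Prod>j<k. M (cs ! inv_into UNIV p j) (cs ! j)) = (\<Prod>j<k. M (cs ! j) (cs ! p j))"
          by (subst prod.permute[OF p]) (simp add: o_def permutes_inverses[OF p])
      qed
      finally show "(\<Sum>p\<in>?P. of_int (sign p) * (\<Prod>j<k. M (cs ! p j) (cs ! j))) = det_on {..<k} (\<lambda>i j. M (cs ! i) (cs ! j))"
        unfolding det_on_def .
    qed
    finally show ?thesis .
  qed
  have "fredholm_det X (kernel_operator X K) = det_on {..<r} (\<lambda>i j. (if i = j then 1 else 0) - M i j)"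
    unfolding fredholm_det_def inner by (rule fredholm_series_finite) simp
  also have "\<dots> = Determinant.det (Matrix.mat r r (\<lambda>(i, j). (if i = j then 1 else 0) - M i j))"
    by (rule det_mat_eq_det_on[symmetric])
  finally show ?thesis unfolding M_def .
qed

section \<open>Finite-rank operators are trace class\<close>

lemma ell2_vanish: "f \<in> ell2 X \<Longrightarrow> x \<notin> X \<Longrightarrow> f x = 0"
  by (simp add: ell2_def)

lemma ell2_mult_summable:
  assumes "f \<in> ell2 X" "g \<in> ell2 X"
  shows "(\<lambda>x. norm (f x * g x)) summable_on X"
proof -
  have sq: "norm (w * w) = (cmod w)\<^sup>2" for w :: complex
    by (simp add: norm_mult power2_eq_square)
  have "(\<lambda>x. norm (f x * f x)) summable_on X" "(\<lambda>x. norm (g x * g x)) summable_on X"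
    using assms unfolding ell2_def sq by simp_all
  then show ?thesis by (rule Infinite_Sum.abs_summable_product)
qed

lemma ell2_inner_summable:
  assumes "f \<in> ell2 X" "g \<in> ell2 X"
  shows "(\<lambda>x. cnj (f x) * g x) summable_on X"
proof (rule Infinite_Sum.abs_summable_summable)
  show "(\<lambda>x. norm (cnj (f x) * g x)) summable_on X"
    using ell2_mult_summable[OF assms] by (simp add: norm_mult)
qed

lemma cmod_lincomb_sq_le: "(cmod (c * a + b))\<^sup>2 \<le> 2 * (cmod c)\<^sup>2 * (cmod a)\<^sup>2 + 2 * (cmod b)\<^sup>2"
proof -
  have "(cmod (c * a + b))\<^sup>2 \<le> (cmod (c * a) + cmod b)\<^sup>2"
    by (intro power_mono norm_triangle_ineq) auto
  also have "\<dots> \<le> 2 * (cmod (c * a))\<^sup>2 + 2 * (cmod b)\<^sup>2"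
    using zero_le_power2[of "cmod (c * a) - cmod b"] by (simp add: power2_eq_square algebra_simps)
  finally show ?thesis by (simp add: norm_mult power_mult_distrib)
qed

lemma ell2_lincomb:
  assumes "f \<in> ell2 X" "g \<in> ell2 X"
  shows "(\<lambda>x. c * f x + g x) \<in> ell2 X"
proof -
  have "(\<lambda>x. 2 * (cmod c)\<^sup>2 * (cmod (f x))\<^sup>2 + 2 * (cmod (g x))\<^sup>2) summable_on X"
    using assms by (intro summable_on_add summable_on_cmult_right) (auto simp: ell2_def)
  then have "(\<lambda>x. (cmod (c * f x + g x))\<^sup>2) summable_on X"
  proof (rule summable_on_comparison_test)
    fix x
    show "(cmod (c * f x + g x))\<^sup>2 \<le> 2 * (cmod c)\<^sup>2 * (cmod (f x))\<^sup>2 + 2 * (cmod (g x))\<^sup>2"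
      by (rule cmod_lincomb_sq_le)
  qed simp
  then show ?thesis using assms by (simp add: ell2_def)
qed

lemma ell2_zero: "(\<lambda>x. 0) \<in> ell2 X"
  by (simp add: ell2_def)

lemma ell2_scale: "f \<in> ell2 X \<Longrightarrow> (\<lambda>x. c * f x) \<in> ell2 X"
  using ell2_lincomb[OF _ ell2_zero, of f X c] by simp

lemma ell2_sum:
  assumes "\<And>j. j \<in> J \<Longrightarrow> F j \<in> ell2 X"
  shows "(\<lambda>x. \<Sum>j\<in>J. c j * F j x) \<in> ell2 X"
  using assms
proof (induction J rule: infinite_finite_induct)
  case (insert p J)
  then show ?case using ell2_lincomb[of "F p" X "\<lambda>x. \<Sum>j\<in>J. c j * F j x" "c p"] by simp
qed (simp_all add: ell2_zero)

lemma ell2_inner_lincomb: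
  assumes "f \<in> ell2 X" "g \<in> ell2 X" "h \<in> ell2 X"
  shows "ell2_inner X f (\<lambda>x. c * g x + h x) = c * ell2_inner X f g + ell2_inner X f h"
proof -
  have "ell2_inner X f (\<lambda>x. c * g x + h x) = infsum (\<lambda>x. c * (cnj (f x) * g x) + cnj (f x) * h x) X"
    unfolding ell2_inner_def by (simp add: algebra_simps)
  also have "\<dots> = infsum (\<lambda>x. c * (cnj (f x) * g x)) X + infsum (\<lambda>x. cnj (f x) * h x) X"
    using assms by (intro infsum_add summable_on_cmult_right ell2_inner_summable)
  finally show ?thesis unfolding ell2_inner_def by (simp add: infsum_cmult_right')
qed

lemma ell2_inner_cnj: "cnj (ell2_inner X f g) = ell2_inner X g f"
  unfolding ell2_inner_def infsum_cnj[symmetric] by (simp add: mult.commute)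

lemma ell2_inner_zero [simp]: "ell2_inner X f (\<lambda>x. 0) = 0" "ell2_inner X (\<lambda>x. 0) f = 0"
  unfolding ell2_inner_def by simp_all

lemma ell2_inner_scale: "ell2_inner X f (\<lambda>x. c * g x) = c * ell2_inner X f g"
proof -
  have "cnj (f x) * (c * g x) = c * (cnj (f x) * g x)" for x by simp
  then show ?thesis unfolding ell2_inner_def by (simp only: infsum_cmult_right')
qed

lemma ell2_inner_sum:
  assumes "f \<in> ell2 X" "\<And>j. j \<in> J \<Longrightarrow> F j \<in> ell2 X"
  shows "ell2_inner X f (\<lambda>x. \<Sum>j\<in>J. c j * F j x) = (\<Sum>j\<in>J. c j * ell2_inner X f (F j))"
  using assms
proof (induction J rule: infinite_finite_induct)
  case (insert p J)
  have "ell2_inner X f (\<lambda>x. c p * F p x + (\<Sum>j\<in>J. c j * F j x)) =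
      c p * ell2_inner X f (F p) + ell2_inner X f (\<lambda>x. \<Sum>j\<in>J. c j * F j x)"
    by (intro ell2_inner_lincomb[where g = "F p" and h = "\<lambda>x. \<Sum>j\<in>J. c j * F j x"] ell2_sum[where c = c and F = F] insert.prems) simp_all
  moreover have "ell2_inner X f (\<lambda>x. \<Sum>j\<in>J. c j * F j x) = (\<Sum>j\<in>J. c j * ell2_inner X f (F j))"
    using insert.prems by (intro insert.IH) simp_all
  ultimately show ?case by (simp only: sum.insert[OF insert.hyps])
qed simp_all

lemma ell2_inner_sum_left:
  assumes "f \<in> ell2 X" "\<And>j. j \<in> J \<Longrightarrow> F j \<in> ell2 X"
  shows "ell2_inner X (\<lambda>x. \<Sum>j\<in>J. c j * F j x) f = (\<Sum>j\<in>J. cnj (c j) * ell2_inner X (F j) f)"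
proof -
  have "ell2_inner X (\<lambda>x. \<Sum>j\<in>J. c j * F j x) f = cnj (ell2_inner X f (\<lambda>x. \<Sum>j\<in>J. c j * F j x))"
    by (simp only: ell2_inner_cnj)
  also have "\<dots> = cnj (\<Sum>j\<in>J. c j * ell2_inner X f (F j))"
    by (simp only: ell2_inner_sum[where c = c, OF assms])
  finally show ?thesis by (simp only: cnj_sum complex_cnj_mult ell2_inner_cnj)
qed

lemma ell2_inner_scale_left: "ell2_inner X (\<lambda>x. c * f x) g = cnj c * ell2_inner X f g"
proof -
  have "cnj (ell2_inner X g (\<lambda>x. c * f x)) = cnj (c * ell2_inner X g f)"
    by (simp only: ell2_inner_scale)
  then show ?thesis by (simp only: complex_cnj_mult ell2_inner_cnj)
qed

lemma ell2_inner_self: "ell2_inner X f f = of_real (\<Sum>\<^sub>\<infinity>x\<in>X. (cmod (f x))\<^sup>2)"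
proof -
  have "ell2_inner X f f = (\<Sum>\<^sub>\<infinity>x\<in>X. of_real ((cmod (f x))\<^sup>2))"
    unfolding ell2_inner_def by (intro infsum_cong) (simp add: complex_norm_square mult.commute del: of_real_power)
  also have "\<dots> = of_real (\<Sum>\<^sub>\<infinity>x\<in>X. (cmod (f x))\<^sup>2)"
  proof (rule infsum_bounded_linear_strong[OF _ bounded_linear_of_real])
    \<comment> \<open>Outside \<open>ell2 X\<close> both sums have the default value 0, so
      summability is carried over as an equivalence.\<close>
    show "(\<lambda>x. complex_of_real ((cmod (f x))\<^sup>2)) summable_on X \<longleftrightarrow> (\<lambda>x. (cmod (f x))\<^sup>2) summable_on X"
      using summable_on_Re[of "\<lambda>x. complex_of_real ((cmod (f x))\<^sup>2)" X]
        summable_on_of_real[of "\<lambda>x. (cmod (f x))\<^sup>2" X, where ?'a = complex]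
      by (auto simp del: of_real_power)
  qed
  finally show ?thesis .
qed

lemma ell2_norm_sq: "(ell2_norm X f)\<^sup>2 = (\<Sum>\<^sub>\<infinity>x\<in>X. (cmod (f x))\<^sup>2)"
  unfolding ell2_norm_def by (simp add: infsum_nonneg)

lemma ell2_inner_self': "ell2_inner X f f = of_real ((ell2_norm X f)\<^sup>2)"
  by (simp add: ell2_inner_self ell2_norm_sq)

lemma ell2_norm_nonneg: "0 \<le> ell2_norm X f"
  unfolding ell2_norm_def by (simp add: infsum_nonneg)

lemma ell2_norm_zero_imp:
  assumes "f \<in> ell2 X" "ell2_norm X f = 0"
  shows "f = (\<lambda>x. 0)"
proof
  fix x
  show "f x = 0"
  proof (cases "x \<in> X")
    case True
    have "(\<Sum>\<^sub>\<infinity>x\<in>X. (cmod (f x))\<^sup>2) = 0" using assms(2) ell2_norm_sq[of X f] by simp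
    then have "(cmod (f x))\<^sup>2 = 0"
      using assms(1) True by (intro nonneg_infsum_le_0D[of "\<lambda>x. (cmod (f x))\<^sup>2" X x]) (auto simp: ell2_def)
    then show ?thesis by simp
  qed (use assms in \<open>simp add: ell2_vanish\<close>)
qed

lemma ell2_norm_lincomb_le:
  assumes "f \<in> ell2 X" "g \<in> ell2 X"
  shows "(ell2_norm X (\<lambda>x. c * f x + g x))\<^sup>2 \<le> 2 * (cmod c)\<^sup>2 * (ell2_norm X f)\<^sup>2 + 2 * (ell2_norm X g)\<^sup>2"
proof -
  have "(ell2_norm X (\<lambda>x. c * f x + g x))\<^sup>2 \<le> (\<Sum>\<^sub>\<infinity>x\<in>X. 2 * (cmod c)\<^sup>2 * (cmod (f x))\<^sup>2 + 2 * (cmod (g x))\<^sup>2)"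
    unfolding ell2_norm_sq
  proof (rule infsum_mono)
    show "(\<lambda>x. (cmod (c * f x + g x))\<^sup>2) summable_on X"
      using ell2_lincomb[OF assms] by (simp add: ell2_def)
    show "(\<lambda>x. 2 * (cmod c)\<^sup>2 * (cmod (f x))\<^sup>2 + 2 * (cmod (g x))\<^sup>2) summable_on X"
      using assms by (intro summable_on_add summable_on_cmult_right) (auto simp: ell2_def)
    fix x
    show "(cmod (c * f x + g x))\<^sup>2 \<le> 2 * (cmod c)\<^sup>2 * (cmod (f x))\<^sup>2 + 2 * (cmod (g x))\<^sup>2"
      by (rule cmod_lincomb_sq_le)
  qed
  also have "\<dots> = 2 * (cmod c)\<^sup>2 * (ell2_norm X f)\<^sup>2 + 2 * (ell2_norm X g)\<^sup>2"
    using assms unfolding ell2_norm_sq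
    by (subst infsum_add) (auto intro!: summable_on_cmult_right simp: ell2_def infsum_cmult_right')
  finally show ?thesis .
qed

lemma ell2_Cauchy_Schwarz:
  assumes f: "f \<in> ell2 X" and g: "g \<in> ell2 X"
  shows "(cmod (ell2_inner X f g))\<^sup>2 \<le> (ell2_norm X f)\<^sup>2 * (ell2_norm X g)\<^sup>2"
proof (cases "ell2_norm X f = 0")
  case True
  then show ?thesis using ell2_norm_zero_imp[OF f] by simp
next
  case False
  define s where "s = (ell2_norm X f)\<^sup>2"
  have s: "s > 0" using False by (simp add: s_def)
  define w where "w = ell2_inner X f g"
  define h where "h = (\<lambda>x. (- w / of_real s) * f x + g x)"
  have h: "h \<in> ell2 X" unfolding h_def by (rule ell2_lincomb[OF f g])
  have fh: "ell2_inner X f h = 0"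
    using s unfolding h_def by (subst ell2_inner_lincomb[OF f f g]) (simp add: ell2_inner_self' w_def[symmetric] s_def[symmetric])
  have gh: "ell2_inner X g h = of_real ((ell2_norm X g)\<^sup>2 - (cmod w)\<^sup>2 / s)"
    unfolding h_def
    by (subst ell2_inner_lincomb[OF g f g])
       (simp add: ell2_inner_self' ell2_inner_cnj[of X f g, symmetric] w_def[symmetric] complex_norm_square[symmetric] mult.commute)
  have "ell2_inner X h h = (- w / of_real s) * ell2_inner X h f + ell2_inner X h g"
    unfolding h_def by (rule ell2_inner_lincomb[OF h[unfolded h_def] f g])
  also have "\<dots> = cnj (ell2_inner X g h)"
    using fh ell2_inner_cnj[of X f h] by (simp add: ell2_inner_cnj)
  finally have "ell2_inner X h h = of_real ((ell2_norm X g)\<^sup>2 - (cmod w)\<^sup>2 / s)"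
    unfolding gh by simp
  then have "(ell2_norm X h)\<^sup>2 = (ell2_norm X g)\<^sup>2 - (cmod w)\<^sup>2 / s"
    unfolding ell2_inner_self' of_real_eq_iff .
  then have "(cmod w)\<^sup>2 / s \<le> (ell2_norm X g)\<^sup>2" using zero_le_power2[of "ell2_norm X h"] by linarith
  then show ?thesis using s by (simp add: field_simps w_def s_def)
qed

section \<open>Finite-rank operators and their singular value decomposition\<close>

definition finite_rank_op ::
  "'a set \<Rightarrow> 'b set \<Rightarrow> ('b \<Rightarrow> 'a \<Rightarrow> complex) \<Rightarrow> ('b \<Rightarrow> 'a \<Rightarrow> complex) \<Rightarrow> ('a \<Rightarrow> complex) \<Rightarrow> 'a \<Rightarrow> complex" where
  "finite_rank_op X J F G h = (\<lambda>x. \<Sum>j\<in>J. ell2_inner X (G j) h * F j x)"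

lemma finite_rank_op_in_ell2:
  assumes "\<And>j. j \<in> J \<Longrightarrow> F j \<in> ell2 X"
  shows "finite_rank_op X J F G h \<in> ell2 X"
  unfolding finite_rank_op_def
  by (rule ell2_sum[where c = "\<lambda>j. ell2_inner X (G j) h" and F = F, OF assms])

lemma finite_rank_op_bounded:
  assumes F: "\<And>j. j \<in> J \<Longrightarrow> F j \<in> ell2 X" and G: "\<And>j. j \<in> J \<Longrightarrow> G j \<in> ell2 X"
  shows "bounded_operator X (finite_rank_op X J F G)"
  unfolding bounded_operator_def
proof (intro conjI ballI allI)
  fix f g c assume fg: "f \<in> ell2 X" "g \<in> ell2 X"
  have "ell2_inner X (G j) (\<lambda>x. c * f x + g x) = c * ell2_inner X (G j) f + ell2_inner X (G j) g" if "j \<in> J" for j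
    using G[OF that] fg by (rule ell2_inner_lincomb)
  then show "finite_rank_op X J F G (\<lambda>x. c * f x + g x) = (\<lambda>x. c * finite_rank_op X J F G f x + finite_rank_op X J F G g x)"
    by (simp add: finite_rank_op_def algebra_simps sum.distrib sum_distrib_left)
next
  have "\<exists>C\<ge>0. \<forall>f\<in>ell2 X. (ell2_norm X (finite_rank_op X J F G f))\<^sup>2 \<le> C * (ell2_norm X f)\<^sup>2"
    using F G
  proof (induction J rule: infinite_finite_induct)
    case (insert p J)
    then obtain C where C: "C \<ge> 0" "\<And>f. f \<in> ell2 X \<Longrightarrow> (ell2_norm X (finite_rank_op X J F G f))\<^sup>2 \<le> C * (ell2_norm X f)\<^sup>2"
      by auto
    show ?case
    proof (intro exI conjI ballI)
      fix f assume f: "f \<in> ell2 X"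
      have "(ell2_norm X (finite_rank_op X (insert p J) F G f))\<^sup>2
        \<le> 2 * (cmod (ell2_inner X (G p) f))\<^sup>2 * (ell2_norm X (F p))\<^sup>2 + 2 * (ell2_norm X (finite_rank_op X J F G f))\<^sup>2"
        using ell2_norm_lincomb_le[of "F p" X "finite_rank_op X J F G f" "ell2_inner X (G p) f"]
          insert finite_rank_op_in_ell2[of J F X G f] by (simp add: finite_rank_op_def)
      also have "\<dots> \<le> 2 * ((ell2_norm X (G p))\<^sup>2 * (ell2_norm X f)\<^sup>2) * (ell2_norm X (F p))\<^sup>2 + 2 * (C * (ell2_norm X f)\<^sup>2)"
        using C(2)[OF f] ell2_Cauchy_Schwarz[of "G p" X f] insert.prems f
        by (intro add_mono mult_right_mono mult_left_mono) auto
      finally show "(ell2_norm X (finite_rank_op X (insert p J) F G f))\<^sup>2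
        \<le> (2 * (ell2_norm X (G p))\<^sup>2 * (ell2_norm X (F p))\<^sup>2 + 2 * C) * (ell2_norm X f)\<^sup>2"
        by (simp add: algebra_simps)
    qed (use C in auto)
  qed (auto simp: finite_rank_op_def ell2_norm_def)
  then obtain C where C: "C \<ge> 0" "\<And>f. f \<in> ell2 X \<Longrightarrow> (ell2_norm X (finite_rank_op X J F G f))\<^sup>2 \<le> C * (ell2_norm X f)\<^sup>2"
    by auto
  show "\<exists>C. \<forall>f\<in>ell2 X. ell2_norm X (finite_rank_op X J F G f) \<le> C * ell2_norm X f"
  proof (intro exI ballI)
    fix f assume f: "f \<in> ell2 X"
    have "(ell2_norm X (finite_rank_op X J F G f))\<^sup>2 \<le> (sqrt C * ell2_norm X f)\<^sup>2"
      using C f by (simp add: power_mult_distrib)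
    then show "ell2_norm X (finite_rank_op X J F G f) \<le> sqrt C * ell2_norm X f"
      by (rule power2_le_imp_le) (simp add: C ell2_norm_nonneg)
  qed
qed (rule finite_rank_op_in_ell2[OF F])

lemma finite_rank_op_inner:
  assumes F: "\<And>j. j \<in> J \<Longrightarrow> F j \<in> ell2 X" and G: "\<And>j. j \<in> J \<Longrightarrow> G j \<in> ell2 X"
    and "f \<in> ell2 X" "g \<in> ell2 X"
  shows "ell2_inner X (finite_rank_op X J F G f) g = ell2_inner X f (finite_rank_op X J G F g)"
  unfolding finite_rank_op_def
  using ell2_inner_sum_left[where c = "\<lambda>j. ell2_inner X (G j) f", OF assms(4) F]
    ell2_inner_sum[where c = "\<lambda>j. ell2_inner X (F j) g", OF assms(3) G]
  by (simp add: ell2_inner_cnj mult.commute)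

lemma finite_rank_op_adjoint:
  assumes "\<And>j. j \<in> J \<Longrightarrow> F j \<in> ell2 X" and "\<And>j. j \<in> J \<Longrightarrow> G j \<in> ell2 X"
  shows "is_adjoint X (finite_rank_op X J F G) (finite_rank_op X J G F)"
  unfolding is_adjoint_def
proof (intro conjI ballI)
  show "bounded_operator X (finite_rank_op X J G F)"
    by (rule finite_rank_op_bounded[OF assms(2,1)])
  show "ell2_inner X (finite_rank_op X J F G f) g = ell2_inner X f (finite_rank_op X J G F g)"
    if "f \<in> ell2 X" "g \<in> ell2 X" for f g
    by (rule finite_rank_op_inner[OF assms that])
qed

text \<open>A complex matrix has an eigenvalue. The index set is arbitrary because the induction
  below deletes elements of \<open>J\<close>.\<close>

lemma finite_set_eigenvector:
  fixes M :: "'b \<Rightarrow> 'b \<Rightarrow> complex"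
  assumes "finite J" "J \<noteq> {}"
  shows "\<exists>c l. (\<exists>p\<in>J. c p \<noteq> 0) \<and> (\<forall>i\<in>J. (\<Sum>j\<in>J. M i j * c j) = l * c i)"
proof -
  define n where "n = card J"
  obtain b where b: "bij_betw b {0..<n} J"
    using ex_bij_betw_nat_finite[OF assms(1)] unfolding n_def by blast
  define A where "A = Matrix.mat n n (\<lambda>(i, j). M (b i) (b j))"
  have A: "A \<in> carrier_mat n n" by (simp add: A_def)
  have "n \<noteq> 0" using assms by (simp add: n_def)
  then have "spectrum A \<noteq> {}" using A by (intro spectrum_non_empty) auto
  then obtain l v where v: "eigenvector A v l"
    by (auto simp: spectrum_def eigenvalue_def)
  then have vd: "v \<in> carrier_vec n" "v \<noteq> 0\<^sub>v n" "A *\<^sub>v v = l \<cdot>\<^sub>v v"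
    using A by (auto simp: eigenvector_def)
  define a where "a = inv_into {0..<n} b"
  have ab: "a (b i) = i" if "i < n" for i
    unfolding a_def using b that by (simp add: bij_betw_def)
  have "\<exists>p\<in>J. v $ a p \<noteq> 0"
  proof -
    obtain i where "i < n" "v $ i \<noteq> 0"
      using vd(1,2) by (metis carrier_vecD eq_vecI index_zero_vec(1) index_zero_vec(2))
    then show ?thesis using ab b by (metis atLeast0LessThan bij_betwE lessThan_iff)
  qed
  moreover have "(\<Sum>j\<in>J. M i j * v $ a j) = l * v $ a i" if i: "i \<in> J" for i
  proof -
    obtain k where k: "k < n" "i = b k" using b i by (auto simp: bij_betw_def)
    have "(A *\<^sub>v v) $ k = (\<Sum>j = 0..<n. M i (b j) * v $ j)"
      using k vd(1) A by (simp add: A_def scalar_prod_def)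
    also have "\<dots> = (\<Sum>j = 0..<n. M i (b j) * v $ a (b j))"
      by (rule sum.cong) (auto simp: ab)
    also have "\<dots> = (\<Sum>j\<in>J. M i j * v $ a j)" by (rule sum.reindex_bij_betw[OF b])
    finally show ?thesis using k vd by (simp add: ab)
  qed
  ultimately show ?thesis by (intro exI[of _ "\<lambda>j. v $ a j"] exI[of _ l]) blast
qed


text \<open>The relation among the \<open>G j\<close> expresses the functional of \<open>G p\<close>
  by the others, and its vector \<open>F p\<close> is distributed over the remaining terms. The
  conjugates appear because \<open>ell2_inner\<close> is antilinear in its first argument.\<close>

lemma finite_rank_op_drop:
  assumes J: "finite J" "p \<in> J" and F: "\<And>j. j \<in> J \<Longrightarrow> F j \<in> ell2 X" and G: "\<And>j. j \<in> J \<Longrightarrow> G j \<in> ell2 X"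
    and c: "c p \<noteq> 0" "\<And>x. (\<Sum>j\<in>J. c j * G j x) = 0" and h: "h \<in> ell2 X"
  shows "finite_rank_op X J F G h =
    finite_rank_op X (J - {p}) (\<lambda>j x. - cnj (c j / c p) * F p x + F j x) G h"
proof -
  have "(\<Sum>j\<in>J. cnj (c j) * ell2_inner X (G j) h) = ell2_inner X (\<lambda>x. \<Sum>j\<in>J. c j * G j x) h"
    by (rule ell2_inner_sum_left[OF h G, symmetric])
  also have "\<dots> = 0" by (simp add: c(2))
  finally have "cnj (c p) * ell2_inner X (G p) h + (\<Sum>j\<in>J - {p}. cnj (c j) * ell2_inner X (G j) h) = 0"
    using J by (simp add: sum.remove)
  then have "cnj (c p) * ell2_inner X (G p) h = - (\<Sum>j\<in>J - {p}. cnj (c j) * ell2_inner X (G j) h)"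
    by (simp add: add_eq_0_iff2)
  then have "ell2_inner X (G p) h = - (\<Sum>j\<in>J - {p}. cnj (c j) * ell2_inner X (G j) h) / cnj (c p)"
    using c(1) by (simp add: field_simps)
  also have "\<dots> = (\<Sum>j\<in>J - {p}. ell2_inner X (G j) h * - cnj (c j / c p))"
    by (simp add: sum_divide_distrib sum_negf mult.commute)
  finally have "ell2_inner X (G p) h = (\<Sum>j\<in>J - {p}. ell2_inner X (G j) h * - cnj (c j / c p))" .
  then have "ell2_inner X (G p) h * F p x + (\<Sum>j\<in>J - {p}. ell2_inner X (G j) h * F j x) =
    (\<Sum>j\<in>J - {p}. ell2_inner X (G j) h * (- cnj (c j / c p) * F p x + F j x))" for x
    by (simp only: sum_distrib_right distrib_left sum.distrib mult.assoc)
  then show ?thesis using J by (auto simp: finite_rank_op_def sum.remove[OF J])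
qed

text \<open>The induction removes one term at a time: an eigenvector \<open>u = \<Sum>\<^sub>j c\<^sub>j G\<^sub>j\<close> of \<open>A\<^sup>*A\<close> is split off, and the
  projected functions \<open>G\<^sub>j - \<langle>u, G\<^sub>j\<rangle> u\<close> are linearly dependent, with the same coefficients \<open>c\<^sub>j\<close>.\<close>

lemma finite_rank_op_svd:
  fixes F G :: "'b \<Rightarrow> 'a \<Rightarrow> complex"
  assumes "finite J" and "\<And>j. j \<in> J \<Longrightarrow> F j \<in> ell2 X" and "\<And>j. j \<in> J \<Longrightarrow> G j \<in> ell2 X"
  shows "\<exists>(n::nat) e s. (\<forall>k<n. e k \<in> ell2 X \<and> s k \<in> ell2 X) \<and>
     (\<forall>i<n. \<forall>k<n. ell2_inner X (e i) (e k) = (if i = k then 1 else 0)) \<and>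
     (\<forall>i<n. \<forall>k<n. i \<noteq> k \<longrightarrow> ell2_inner X (s i) (s k) = 0) \<and>
     (\<forall>h\<in>ell2 X. finite_rank_op X J F G h = finite_rank_op X {..<n} s e h) \<and>
     (\<forall>w\<in>ell2 X. (\<forall>j\<in>J. ell2_inner X (G j) w = 0) \<longrightarrow> (\<forall>k<n. ell2_inner X (e k) w = 0))"
  using assms
proof (induction "card J" arbitrary: J F G)
  case 0
  then have "J = {}" by simp
  then show ?case by (intro exI[of _ 0]) (simp add: finite_rank_op_def)
next
  case (Suc m)
  note J = \<open>finite J\<close> and F = Suc.prems(2) and G = Suc.prems(3)
  have ne: "J \<noteq> {}" using Suc.hyps(2) by auto
  define S where "S = (\<lambda>i j. ell2_inner X (F i) (F j))"
  define R where "R = (\<lambda>i j. ell2_inner X (G i) (G j))"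
  obtain c l p where c: "p \<in> J" "c p \<noteq> 0"
    "\<And>i. i \<in> J \<Longrightarrow> (\<Sum>j\<in>J. (\<Sum>k\<in>J. S i k * R k j) * c j) = l * c i"
    using finite_set_eigenvector[OF J ne, of "\<lambda>i j. \<Sum>k\<in>J. S i k * R k j"] by blast
  define w where "w = (\<lambda>x. \<Sum>j\<in>J. c j * G j x)"
  have w: "w \<in> ell2 X" unfolding w_def by (rule ell2_sum[OF G])
  have card: "m = card (J - {p})" using Suc.hyps(2) c(1) J by simp
  show ?case
  proof (cases "ell2_norm X w = 0")
    case True
    then have w0: "(\<Sum>j\<in>J. c j * G j x) = 0" for x
      using ell2_norm_zero_imp[OF w] unfolding w_def by meson
    let ?F = "\<lambda>j x. - cnj (c j / c p) * F p x + F j x"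
    have drop: "finite_rank_op X J F G h = finite_rank_op X (J - {p}) ?F G h" if "h \<in> ell2 X" for h
      by (rule finite_rank_op_drop[OF J c(1) F G c(2) w0 that])
    have "\<exists>(n::nat) e s. (\<forall>k<n. e k \<in> ell2 X \<and> s k \<in> ell2 X) \<and>
     (\<forall>i<n. \<forall>k<n. ell2_inner X (e i) (e k) = (if i = k then 1 else 0)) \<and>
     (\<forall>i<n. \<forall>k<n. i \<noteq> k \<longrightarrow> ell2_inner X (s i) (s k) = 0) \<and>
     (\<forall>h\<in>ell2 X. finite_rank_op X (J - {p}) ?F G h = finite_rank_op X {..<n} s e h) \<and>
     (\<forall>w\<in>ell2 X. (\<forall>j\<in>J - {p}. ell2_inner X (G j) w = 0) \<longrightarrow> (\<forall>k<n. ell2_inner X (e k) w = 0))"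
    proof (rule Suc.hyps(1)[OF card])
      show "?F j \<in> ell2 X" if "j \<in> J - {p}" for j
        by (rule ell2_lincomb) (use F c(1) that in auto)
    qed (use J G in auto)
    then obtain n :: nat and e s where n:
      "\<forall>k<n. e k \<in> ell2 X \<and> s k \<in> ell2 X"
      "\<forall>i<n. \<forall>k<n. ell2_inner X (e i) (e k) = (if i = k then 1 else 0)"
      "\<forall>i<n. \<forall>k<n. i \<noteq> k \<longrightarrow> ell2_inner X (s i) (s k) = 0"
      "\<forall>h\<in>ell2 X. finite_rank_op X (J - {p}) ?F G h = finite_rank_op X {..<n} s e h"
      "\<forall>w\<in>ell2 X. (\<forall>j\<in>J - {p}. ell2_inner X (G j) w = 0) \<longrightarrow> (\<forall>k<n. ell2_inner X (e k) w = 0)"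
      by (elim exE conjE) (rule that)
    have "\<forall>h\<in>ell2 X. finite_rank_op X J F G h = finite_rank_op X {..<n} s e h"
    proof
      fix h assume h: "h \<in> ell2 X"
      show "finite_rank_op X J F G h = finite_rank_op X {..<n} s e h"
        unfolding drop[OF h] by (rule bspec[OF n(4) h])
    qed
    moreover have "\<forall>w\<in>ell2 X. (\<forall>j\<in>J. ell2_inner X (G j) w = 0) \<longrightarrow> (\<forall>k<n. ell2_inner X (e k) w = 0)"
      using n(5) by blast
    ultimately show ?thesis using n(1-3) by (intro exI[of _ n] exI[of _ e] exI[of _ s] conjI)
  next
    case False
    define u where "u = (\<lambda>x. 1 / of_real (ell2_norm X w) * w x)"
    define c' where "c' = (\<lambda>j. 1 / of_real (ell2_norm X w) * c j)"
    have u: "u \<in> ell2 X" unfolding u_def by (rule ell2_scale[OF w])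
    have u_sum: "u = (\<lambda>x. \<Sum>j\<in>J. c' j * G j x)"
      unfolding u_def w_def c'_def by (simp add: sum_distrib_left mult.assoc)
    have uu: "ell2_inner X u u = 1"
    proof -
      have "ell2_inner X u u = cnj (1 / of_real (ell2_norm X w)) * (1 / of_real (ell2_norm X w) * ell2_inner X w w)"
        unfolding u_def by (simp only: ell2_inner_scale ell2_inner_scale_left mult.left_commute)
      then show ?thesis using False by (simp add: ell2_inner_self' power2_eq_square)
    qed
    have c'p: "c' p \<noteq> 0" using c(2) False by (simp add: c'_def)
    let ?A = "finite_rank_op X J F G"
    have Gu: "ell2_inner X (G i) u = (\<Sum>j\<in>J. R i j * c' j)" if "i \<in> J" for i
    proof -
      have "ell2_inner X (G i) u = (\<Sum>j\<in>J. c' j * ell2_inner X (G i) (G j))"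
        unfolding u_sum using G[OF that] G by (rule ell2_inner_sum)
      then show ?thesis by (simp add: R_def mult.commute)
    qed
    have FAu: "ell2_inner X (F i) (?A u) = l * c' i" if i: "i \<in> J" for i
    proof -
      have "ell2_inner X (F i) (?A u) = (\<Sum>k\<in>J. ell2_inner X (G k) u * ell2_inner X (F i) (F k))"
        unfolding finite_rank_op_def using F[OF i] F by (rule ell2_inner_sum)
      also have "\<dots> = (\<Sum>k\<in>J. (\<Sum>j\<in>J. R k j * c' j) * S i k)"
        by (simp add: S_def Gu)
      also have "\<dots> = (\<Sum>j\<in>J. \<Sum>k\<in>J. S i k * R k j * c' j)"
        by (simp add: sum_distrib_left sum_distrib_right mult_ac, rule sum.swap)
      also have "\<dots> = 1 / of_real (ell2_norm X w) * (\<Sum>j\<in>J. (\<Sum>k\<in>J. S i k * R k j) * c j)"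
        by (simp add: sum_distrib_left sum_distrib_right c'_def mult_ac)
      also have "\<dots> = l * c' i" using c(3)[OF i] by (simp add: c'_def)
      finally show ?thesis .
    qed
    have Au: "?A u \<in> ell2 X" by (rule finite_rank_op_in_ell2[OF F])
    have AAu: "ell2_inner X (?A h) (?A u) = l * ell2_inner X h u" if h: "h \<in> ell2 X" for h
    proof -
      have "ell2_inner X (?A h) (?A u) = (\<Sum>j\<in>J. cnj (ell2_inner X (G j) h) * ell2_inner X (F j) (?A u))"
        unfolding finite_rank_op_def[of X J F G h] using Au F by (rule ell2_inner_sum_left)
      also have "\<dots> = (\<Sum>j\<in>J. cnj (ell2_inner X (G j) h) * (l * c' j))"
        by (simp add: FAu)
      also have "\<dots> = l * (\<Sum>j\<in>J. c' j * ell2_inner X h (G j))"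
        by (simp add: ell2_inner_cnj sum_distrib_left mult_ac)
      also have "(\<Sum>j\<in>J. c' j * ell2_inner X h (G j)) = ell2_inner X h u"
        unfolding u_sum by (rule ell2_inner_sum[OF h G, symmetric])
      finally show ?thesis .
    qed
    define G' where "G' = (\<lambda>j x. - ell2_inner X u (G j) * u x + G j x)"
    have G': "G' j \<in> ell2 X" if "j \<in> J" for j
      unfolding G'_def by (rule ell2_lincomb[OF u G[OF that]])
    have dep: "(\<Sum>j\<in>J. c' j * G' j x) = 0" for x
    proof -
      have "(\<Sum>j\<in>J. c' j * ell2_inner X u (G j)) = ell2_inner X u u"
        by (subst (2) u_sum) (rule ell2_inner_sum[OF u G, symmetric])
      then have 1: "(\<Sum>j\<in>J. c' j * ell2_inner X u (G j)) = 1" using uu by simp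
      have "(\<Sum>j\<in>J. c' j * G' j x) = - (\<Sum>j\<in>J. c' j * ell2_inner X u (G j)) * u x + (\<Sum>j\<in>J. c' j * G j x)"
        by (simp add: G'_def sum.distrib sum_subtractf sum_distrib_left sum_negf algebra_simps)
      also have "(\<Sum>j\<in>J. c' j * G j x) = u x" by (subst u_sum) (rule refl)
      finally have "(\<Sum>j\<in>J. c' j * G' j x) = - (\<Sum>j\<in>J. c' j * ell2_inner X u (G j)) * u x + u x" .
      also have "\<dots> = 0" unfolding 1 by simp
      finally show ?thesis .
    qed
    have G'h: "ell2_inner X (G' j) h = ell2_inner X (G j) h - ell2_inner X (G j) u * ell2_inner X u h"
      if "j \<in> J" "h \<in> ell2 X" for j h
    proof -
      have "ell2_inner X h (G' j) = - ell2_inner X u (G j) * ell2_inner X h u + ell2_inner X h (G j)"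
        unfolding G'_def by (rule ell2_inner_lincomb[OF that(2) u G[OF that(1)]])
      then have "cnj (ell2_inner X h (G' j)) = cnj (- ell2_inner X u (G j) * ell2_inner X h u + ell2_inner X h (G j))"
        by simp
      then show ?thesis by (simp add: ell2_inner_cnj)
    qed
    let ?F = "\<lambda>j x. - cnj (c' j / c' p) * F p x + F j x"
    have A': "finite_rank_op X J F G' h = finite_rank_op X (J - {p}) ?F G' h" if "h \<in> ell2 X" for h
      by (rule finite_rank_op_drop[OF J c(1) F G' c'p dep that])
    have "\<exists>(n::nat) e s. (\<forall>k<n. e k \<in> ell2 X \<and> s k \<in> ell2 X) \<and>
     (\<forall>i<n. \<forall>k<n. ell2_inner X (e i) (e k) = (if i = k then 1 else 0)) \<and>
     (\<forall>i<n. \<forall>k<n. i \<noteq> k \<longrightarrow> ell2_inner X (s i) (s k) = 0) \<and>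
     (\<forall>h\<in>ell2 X. finite_rank_op X (J - {p}) ?F G' h = finite_rank_op X {..<n} s e h) \<and>
     (\<forall>w\<in>ell2 X. (\<forall>j\<in>J - {p}. ell2_inner X (G' j) w = 0) \<longrightarrow> (\<forall>k<n. ell2_inner X (e k) w = 0))"
    proof (rule Suc.hyps(1)[OF card])
      show "?F j \<in> ell2 X" if "j \<in> J - {p}" for j
        by (rule ell2_lincomb) (use F c(1) that in auto)
    qed (use J G' in auto)
    then obtain n :: nat and e s where ex:
      "\<forall>k<n. e k \<in> ell2 X \<and> s k \<in> ell2 X"
      "\<forall>i<n. \<forall>k<n. ell2_inner X (e i) (e k) = (if i = k then 1 else 0)"
      "\<forall>i<n. \<forall>k<n. i \<noteq> k \<longrightarrow> ell2_inner X (s i) (s k) = 0"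
      "\<forall>h\<in>ell2 X. finite_rank_op X (J - {p}) ?F G' h = finite_rank_op X {..<n} s e h"
      "\<forall>w\<in>ell2 X. (\<forall>j\<in>J - {p}. ell2_inner X (G' j) w = 0) \<longrightarrow> (\<forall>k<n. ell2_inner X (e k) w = 0)"
      by (elim exE conjE) (rule that)
    have n: "\<And>k. k < n \<Longrightarrow> e k \<in> ell2 X" "\<And>k. k < n \<Longrightarrow> s k \<in> ell2 X"
      "\<And>i k. i < n \<Longrightarrow> k < n \<Longrightarrow> ell2_inner X (e i) (e k) = (if i = k then 1 else 0)"
      "\<And>i k. i < n \<Longrightarrow> k < n \<Longrightarrow> i \<noteq> k \<Longrightarrow> ell2_inner X (s i) (s k) = 0"
      using ex(1-3) by simp_all
    have n5: "finite_rank_op X (J - {p}) ?F G' h = finite_rank_op X {..<n} s e h" if "h \<in> ell2 X" for h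
      by (rule bspec[OF ex(4) that])
    have n6: "ell2_inner X (e k) w = 0"
      if w: "w \<in> ell2 X" and 0: "\<And>j. j \<in> J - {p} \<Longrightarrow> ell2_inner X (G' j) w = 0" and k: "k < n" for w k
      using bspec[OF ex(5) w] 0 k by blast
    \<comment> \<open>\<open>u\<close> is orthogonal to every \<open>G' j\<close>. The last clause
      of the induction hypothesis, which says that each \<open>e k\<close> lies in the span of the
      \<open>G' j\<close>, makes \<open>u\<close> orthogonal to the \<open>e k\<close> as
      well.\<close>
    have eu: "ell2_inner X (e k) u = 0" if "k < n" for k
      by (rule n6[OF u _ that]) (simp add: G'h u uu)
    have ue: "ell2_inner X u (e k) = 0" if "k < n" for k
      using eu[OF that] ell2_inner_cnj[of X "e k" u] by simp
    have split: "?A h x = finite_rank_op X {..<n} s e h x + ell2_inner X u h * ?A u x" if h: "h \<in> ell2 X" for h x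
    proof -
      have "finite_rank_op X {..<n} s e h x = finite_rank_op X J F G' h x"
        using n5[OF h] A'[OF h] by simp
      also have "\<dots> = (\<Sum>j\<in>J. (ell2_inner X (G j) h - ell2_inner X (G j) u * ell2_inner X u h) * F j x)"
        unfolding finite_rank_op_def by (rule sum.cong) (simp_all add: G'h h)
      also have "\<dots> = ?A h x - ell2_inner X u h * ?A u x"
        unfolding finite_rank_op_def by (simp add: left_diff_distrib right_diff_distrib sum_subtractf sum_distrib_left mult_ac)
      finally show ?thesis by simp
    qed
    have sk: "s k = ?A (e k)" if k: "k < n" for k
    proof
      fix x
      have "finite_rank_op X {..<n} s e (e k) x = (\<Sum>i<n. if i = k then s i x else 0)"
        unfolding finite_rank_op_def by (rule sum.cong) (use n(3) k in auto)
      then show "s k x = ?A (e k) x" using split[OF n(1)[OF k], of x] k by (simp add: ue)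
    qed
    \<comment> \<open>The eigenvector property is what keeps the images orthogonal: the inner
      product of \<open>A (e k)\<close> and \<open>A u\<close> is \<open>l\<close> times that of
      \<open>e k\<close> and \<open>u\<close>.\<close>
    have sAu: "ell2_inner X (s k) (?A u) = 0" if "k < n" for k
      using AAu[OF n(1)[OF that]] by (simp add: sk that eu)
    have Aus: "ell2_inner X (?A u) (s k) = 0" if "k < n" for k
      using sAu[OF that] ell2_inner_cnj[of X "s k" "?A u"] by simp
    let ?e = "e(n := u)" and ?s = "s(n := ?A u)"
    show ?thesis
    proof (intro exI conjI allI impI ballI)
      fix k assume "k < Suc n"
      then show "?e k \<in> ell2 X" "?s k \<in> ell2 X" using n(1,2) u Au by (auto simp: less_Suc_eq)
    next
      fix i k assume ik: "i < Suc n" "k < Suc n"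
      then show "ell2_inner X (?e i) (?e k) = (if i = k then 1 else 0)"
        using n(3)[of i k] eu ue uu by (auto simp: less_Suc_eq)
      show "ell2_inner X (?s i) (?s k) = 0" if "i \<noteq> k"
        using n(4)[of i k] ik that sAu Aus by (auto simp: less_Suc_eq)
    next
      fix h assume h: "h \<in> ell2 X"
      show "?A h = finite_rank_op X {..<Suc n} ?s ?e h"
      proof
        fix x
        have "finite_rank_op X {..<Suc n} ?s ?e h x = finite_rank_op X {..<n} s e h x + ell2_inner X u h * ?A u x"
          unfolding finite_rank_op_def[of X "{..<Suc n}"] finite_rank_op_def[of X "{..<n}"] by simp
        then show "?A h x = finite_rank_op X {..<Suc n} ?s ?e h x" using split[OF h] by simp
      qed
    next
      fix v k assume v: "v \<in> ell2 X" and Gv: "\<forall>j\<in>J. ell2_inner X (G j) v = 0" and k: "k < Suc n"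
      have "ell2_inner X u v = (\<Sum>j\<in>J. cnj (c' j) * ell2_inner X (G j) v)"
        unfolding u_sum using v G by (rule ell2_inner_sum_left)
      then have uv: "ell2_inner X u v = 0" using Gv by simp
      show "ell2_inner X (?e k) v = 0"
      proof (cases "k = n")
        case False
        then have "ell2_inner X (e k) v = 0"
          using k by (intro n6[OF v]) (simp_all add: G'h v uv Gv)
        then show ?thesis using False by simp
      qed (simp add: uv)
    qed
  qed
qed

lemma trace_class_cong:
  assumes eq: "\<And>f. f \<in> ell2 X \<Longrightarrow> A f = A' f" and tc: "trace_class X A'"
  shows "trace_class X A"
proof -
  have lin: "(\<lambda>x. c * f x + g x) \<in> ell2 X" if "f \<in> ell2 X" "g \<in> ell2 X" for f g c
    using that by (rule ell2_lincomb)
  from tc obtain P where b: "bounded_operator X A'" and P: "is_abs_operator X A' P"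
    "(\<lambda>x. ell2_inner X (ell2_basis x) (P (ell2_basis x))) summable_on X"
    unfolding trace_class_def by blast
  have "bounded_operator X A"
    unfolding bounded_operator_def
  proof (intro conjI ballI allI)
    fix f g c assume fg: "f \<in> ell2 X" "g \<in> ell2 X"
    then show "A (\<lambda>x. c * f x + g x) = (\<lambda>x. c * A f x + A g x)"
      using b unfolding bounded_operator_def eq[OF lin[OF fg]] eq[OF fg(1)] eq[OF fg(2)] by blast
  next
    fix f assume f: "f \<in> ell2 X"
    then show "A f \<in> ell2 X" using b unfolding bounded_operator_def eq[OF f] by blast
  next
    obtain C where "\<forall>f\<in>ell2 X. ell2_norm X (A' f) \<le> C * ell2_norm X f"
      using b unfolding bounded_operator_def by blast
    then show "\<exists>C. \<forall>f\<in>ell2 X. ell2_norm X (A f) \<le> C * ell2_norm X f"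
      by (intro exI[of _ C]) (simp add: eq)
  qed
  moreover obtain B where B: "is_adjoint X A' B" "\<And>f. f \<in> ell2 X \<Longrightarrow> P (P f) = B (A' f)"
    using P(1) unfolding is_abs_operator_def by blast
  then have "is_adjoint X A B" "\<And>f. f \<in> ell2 X \<Longrightarrow> P (P f) = B (A f)"
    unfolding is_adjoint_def by (simp_all add: eq)
  then have "is_abs_operator X A P" using P(1) unfolding is_abs_operator_def by blast
  ultimately show ?thesis using P(2) unfolding trace_class_def by blast
qed

text \<open>The decomposition exhibits the absolute value: \<open>A\<^sup>*A\<close> acts on the
  orthonormal \<open>e k\<close> as multiplication by the squared norm of \<open>s k\<close>, so its
  root \<open>P\<close> multiplies \<open>e k\<close> by the norm of \<open>s k\<close>. The
  diagonal entries of \<open>P\<close> are finite combinations of the squares of the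
  \<open>e k\<close>, hence summable.\<close>

lemma trace_class_finite_rank:
  assumes "finite J" and F: "\<And>j. j \<in> J \<Longrightarrow> F j \<in> ell2 X" and G: "\<And>j. j \<in> J \<Longrightarrow> G j \<in> ell2 X"
  shows "trace_class X (finite_rank_op X J F G)"
proof -
  have "\<exists>(n::nat) e s. (\<forall>k<n. e k \<in> ell2 X \<and> s k \<in> ell2 X) \<and>
     (\<forall>i<n. \<forall>k<n. ell2_inner X (e i) (e k) = (if i = k then 1 else 0)) \<and>
     (\<forall>i<n. \<forall>k<n. i \<noteq> k \<longrightarrow> ell2_inner X (s i) (s k) = 0) \<and>
     (\<forall>h\<in>ell2 X. finite_rank_op X J F G h = finite_rank_op X {..<n} s e h) \<and>
     (\<forall>w\<in>ell2 X. (\<forall>j\<in>J. ell2_inner X (G j) w = 0) \<longrightarrow> (\<forall>k<n. ell2_inner X (e k) w = 0))"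
    by (rule finite_rank_op_svd[OF assms])
  then obtain n :: nat and e s where ex:
      "\<forall>k<n. e k \<in> ell2 X \<and> s k \<in> ell2 X"
      "\<forall>i<n. \<forall>k<n. ell2_inner X (e i) (e k) = (if i = k then 1 else 0)"
      "\<forall>i<n. \<forall>k<n. i \<noteq> k \<longrightarrow> ell2_inner X (s i) (s k) = 0"
      "\<forall>h\<in>ell2 X. finite_rank_op X J F G h = finite_rank_op X {..<n} s e h"
    by (elim exE conjE) (rule that)
  have n: "\<And>k. k < n \<Longrightarrow> e k \<in> ell2 X" "\<And>k. k < n \<Longrightarrow> s k \<in> ell2 X"
      "\<And>i k. i < n \<Longrightarrow> k < n \<Longrightarrow> ell2_inner X (e i) (e k) = (if i = k then 1 else 0)"
      "\<And>i k. i < n \<Longrightarrow> k < n \<Longrightarrow> i \<noteq> k \<Longrightarrow> ell2_inner X (s i) (s k) = 0"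
    using ex(1-3) by simp_all
  have n5: "finite_rank_op X J F G h = finite_rank_op X {..<n} s e h" if "h \<in> ell2 X" for h
    by (rule bspec[OF ex(4) that])
  have e: "\<And>k. k \<in> {..<n} \<Longrightarrow> e k \<in> ell2 X" and s: "\<And>k. k \<in> {..<n} \<Longrightarrow> s k \<in> ell2 X"
    using n by auto
  define p where "p = (\<lambda>k x. of_real (ell2_norm X (s k)) * e k x)"
  have p: "\<And>k. k \<in> {..<n} \<Longrightarrow> p k \<in> ell2 X" unfolding p_def by (rule ell2_scale[OF e])
  define A where "A = finite_rank_op X {..<n} s e"
  define B where "B = finite_rank_op X {..<n} e s"
  define P where "P = finite_rank_op X {..<n} p e"
  have Pf: "P f = (\<lambda>x. \<Sum>k<n. (of_real (ell2_norm X (s k)) * ell2_inner X (e k) f) * e k x)" for f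
    unfolding P_def finite_rank_op_def p_def by (simp add: mult_ac)
  have eP: "ell2_inner X (e k) (P f) = of_real (ell2_norm X (s k)) * ell2_inner X (e k) f" if "k < n" for k f
  proof -
    have "ell2_inner X (e k) (P f) = (\<Sum>i<n. (of_real (ell2_norm X (s i)) * ell2_inner X (e i) f) * ell2_inner X (e k) (e i))"
      unfolding Pf using n(1)[OF that] e by (rule ell2_inner_sum)
    also have "\<dots> = (\<Sum>i<n. if i = k then of_real (ell2_norm X (s i)) * ell2_inner X (e i) f else 0)"
      by (rule sum.cong) (use n(3)[OF that] in auto)
    finally show ?thesis using that by simp
  qed
  have fP: "ell2_inner X f (P f) = of_real (\<Sum>k<n. ell2_norm X (s k) * (cmod (ell2_inner X (e k) f))\<^sup>2)" if f: "f \<in> ell2 X" for f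
  proof -
    have "ell2_inner X f (P f) = (\<Sum>i<n. (of_real (ell2_norm X (s i)) * ell2_inner X (e i) f) * ell2_inner X f (e i))"
      unfolding Pf using f e by (rule ell2_inner_sum)
    also have "\<dots> = (\<Sum>i<n. of_real (ell2_norm X (s i) * (cmod (ell2_inner X (e i) f))\<^sup>2))"
      by (intro sum.cong refl) (simp add: ell2_inner_cnj[of X "e _" f, symmetric] complex_norm_square mult.assoc del: of_real_power)
    finally show ?thesis by simp
  qed
  have "positive_operator X P"
    unfolding positive_operator_def
  proof (intro conjI ballI)
    show "bounded_operator X P" unfolding P_def by (rule finite_rank_op_bounded[OF p e])
    fix f assume "f \<in> ell2 X"
    from fP[OF this] show "Im (ell2_inner X f (P f)) = 0" "0 \<le> Re (ell2_inner X f (P f))"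
      by (simp_all add: sum_nonneg ell2_norm_nonneg)
  qed
  moreover have "is_adjoint X A B" unfolding A_def B_def by (rule finite_rank_op_adjoint[OF s e])
  moreover have "P (P f) = B (A f)" if "f \<in> ell2 X" for f
  proof
    fix x
    have sA: "ell2_inner X (s k) (A f) = ell2_inner X (e k) f * of_real ((ell2_norm X (s k))\<^sup>2)" if k: "k < n" for k
    proof -
      have "ell2_inner X (s k) (A f) = (\<Sum>i<n. ell2_inner X (e i) f * ell2_inner X (s k) (s i))"
        unfolding A_def finite_rank_op_def using n(2)[OF k] s by (rule ell2_inner_sum)
      also have "\<dots> = (\<Sum>i<n. if i = k then ell2_inner X (e i) f * of_real ((ell2_norm X (s i))\<^sup>2) else 0)"
        by (rule sum.cong) (use n(4)[OF k] in \<open>auto simp: ell2_inner_self'\<close>)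
      finally show ?thesis using k by simp
    qed
    show "P (P f) x = B (A f) x"
      unfolding Pf[of "P f"] B_def finite_rank_op_def
      by (rule sum.cong) (simp_all add: eP sA power2_eq_square)
  qed
  ultimately have abs: "is_abs_operator X A P" unfolding is_abs_operator_def by blast
  have "(\<lambda>x. ell2_inner X (ell2_basis x) (P (ell2_basis x))) summable_on X"
  proof -
    have eb: "ell2_inner X (ell2_basis x) f = f x" "ell2_inner X f (ell2_basis x) = cnj (f x)" if "x \<in> X" for x f
    proof -
      have "ell2_inner X (ell2_basis x) f = infsum (\<lambda>y. cnj (ell2_basis x y) * f y) {x}"
        unfolding ell2_inner_def by (rule infsum_cong_neutral) (use that in \<open>auto simp: ell2_basis_def\<close>)
      then show 1: "ell2_inner X (ell2_basis x) f = f x" by (simp add: ell2_basis_def)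
      show "ell2_inner X f (ell2_basis x) = cnj (f x)"
        using 1 ell2_inner_cnj[of X "ell2_basis x" f] by simp
    qed
    have "(\<lambda>x. \<Sum>k<n. of_real (ell2_norm X (s k)) * (cnj (e k x) * e k x)) summable_on X"
      by (intro summable_on_finite_sum summable_on_cmult_right ell2_inner_summable e)
    also have "?this \<longleftrightarrow> ?thesis"
      by (rule summable_on_cong) (simp add: eb Pf mult_ac)
    finally show ?thesis .
  qed
  moreover have "bounded_operator X A" unfolding A_def by (rule finite_rank_op_bounded[OF s e])
  ultimately have "trace_class X A" unfolding trace_class_def using abs by blast
  then show ?thesis by (rule trace_class_cong[rotated]) (simp add: A_def n5)
qed

section \<open>Path counts and the random walk\<close>

text \<open>\<open>paths C n x y\<close> counts the sequences \<open>x = t\<^sub>0 > t\<^sub>1 > \<dots> > t\<^sub>n = y\<close> with \<open>t\<^sub>m \<in> C m\<close> for \<open>m < n\<close>. Since the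
  weight of a path of geometric steps depends only on \<open>n\<close> and \<open>x - y\<close>, these counts determine all
  probabilities of the walk.\<close>

primrec paths :: "(nat \<Rightarrow> int set) \<Rightarrow> nat \<Rightarrow> int \<Rightarrow> int \<Rightarrow> nat" where
  "paths C 0 x y = (if x = y then 1 else 0)"
| "paths C (Suc n) x y = (\<Sum>t\<in>{y<..x} \<inter> C n. paths C n x t)"

abbreviation free_paths :: "nat \<Rightarrow> int \<Rightarrow> int \<Rightarrow> nat" where
  "free_paths \<equiv> paths (\<lambda>_. UNIV)"

lemma paths_eq_0: "x < y + int n \<Longrightarrow> paths C n x y = 0"
proof (induction n arbitrary: y)
  case (Suc n)
  have "paths C n x t = 0" if "t \<in> {y<..x} \<inter> C n" for t
    using that Suc.prems by (intro Suc.IH) auto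
  then show ?case by (simp del: Int_iff)
qed simp

text \<open>The definition splits off the last step, as the difference equations need; the Markov
  property of the walk splits off the first.\<close>

lemma paths_first_step:
  "paths C (Suc n) x y = (if x \<in> C 0 then \<Sum>t\<in>{y..<x}. paths (\<lambda>m. C (Suc m)) n t y else 0)"
proof (induction n arbitrary: y)
  case 0
  have "(\<Sum>t\<in>{y<..x} \<inter> C 0. if x = t then 1 else 0) = (if x \<in> {y<..x} \<inter> C 0 then 1 else (0::nat))"
    by (subst sum.delta') auto
  moreover have "(\<Sum>t\<in>{y..<x}. if t = y then 1 else 0) = (if y \<in> {y..<x} then 1 else (0::nat))"
    by (subst sum.delta) auto
  ultimately show ?case by auto
next
  case (Suc n)
  let ?C = "\<lambda>m. C (Suc m)"
  have "paths C (Suc (Suc n)) x y = (\<Sum>t\<in>{y<..x} \<inter> C (Suc n). if x \<in> C 0 then \<Sum>s\<in>{t..<x}. paths ?C n s t else 0)"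
    unfolding paths.simps(2)[of C "Suc n"] Suc.IH ..
  also have "\<dots> = (\<Sum>t\<in>{y<..x} \<inter> C (Suc n). if x \<in> C 0 then \<Sum>s\<in>{y..<x}. paths ?C n s t else 0)"
    by (intro sum.cong refl if_cong sum.mono_neutral_left) (auto intro!: paths_eq_0)
  also have "\<dots> = (if x \<in> C 0 then \<Sum>s\<in>{y..<x}. \<Sum>t\<in>{y<..x} \<inter> C (Suc n). paths ?C n s t else 0)"
    by (simp, intro impI, rule sum.swap)
  also have "\<dots> = (if x \<in> C 0 then \<Sum>s\<in>{y..<x}. \<Sum>t\<in>{y<..s} \<inter> C (Suc n). paths ?C n s t else 0)"
    by (intro sum.cong refl if_cong sum.mono_neutral_right) (auto intro!: paths_eq_0)
  finally show ?case by simp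
qed

text \<open>Lowering the endpoint from \<open>y\<close> to \<open>y - 1\<close> admits exactly one
  new predecessor, \<open>y\<close> itself. All difference equations below come from this.\<close>

lemma paths_diff:
  "paths C (Suc n) x (y - 1) = paths C (Suc n) x y + (if y \<in> C n then paths C n x y else 0)"
proof (cases "y \<le> x")
  case True
  then have "{y - 1<..x} = insert y {y<..x}" by auto
  then show ?thesis by (auto simp: Int_insert_left)
next
  case False
  then have "{y - 1<..x} = {}" "{y<..x} = {}" by auto
  then show ?thesis using False paths_eq_0[of x y n C] by simp
qed

lemma free_paths_add:
  "free_paths (m + n) x y = (\<Sum>t\<in>{y..x}. free_paths m x t * free_paths n t y)"
proof (induction n arbitrary: y)
  case 0
  have "(\<Sum>t\<in>{y..x}. free_paths m x t * (if t = y then 1 else 0)) = (\<Sum>t\<in>{y..x}. if t = y then free_paths m x t else 0)"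
    by (intro sum.cong) auto
  also have "\<dots> = (if y \<in> {y..x} then free_paths m x y else 0)" by (subst sum.delta) auto
  also have "\<dots> = free_paths m x y" using paths_eq_0[of x y m] by auto
  finally show ?case by simp
next
  case (Suc n)
  have "free_paths (m + Suc n) x y = (\<Sum>s\<in>{y<..x}. \<Sum>t\<in>{s..x}. free_paths m x t * free_paths n t s)"
    by (simp add: Suc.IH)
  also have "\<dots> = (\<Sum>s\<in>{y<..x}. \<Sum>t\<in>{y..x}. free_paths m x t * free_paths n t s)"
    by (intro sum.cong refl sum.mono_neutral_left) (auto intro!: disjI2 paths_eq_0)
  also have "\<dots> = (\<Sum>t\<in>{y..x}. \<Sum>s\<in>{y<..x}. free_paths m x t * free_paths n t s)"
    by (rule sum.swap)
  also have "\<dots> = (\<Sum>t\<in>{y..x}. \<Sum>s\<in>{y<..t}. free_paths m x t * free_paths n t s)"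
    by (intro sum.cong refl sum.mono_neutral_right) (auto intro!: paths_eq_0)
  finally show ?case by (simp add: sum_distrib_left)
qed

section \<open>The law of the walk in terms of path counts\<close>

lemma sets_walk_measure: "sets (walk_measure \<rho>) = sets (Pi\<^sub>M UNIV (\<lambda>_::nat. count_space UNIV))"
  unfolding walk_measure_def by (rule sets_PiM_cong) auto

lemma prob_space_walk_measure: "prob_space (walk_measure \<rho>)"
  unfolding walk_measure_def by (intro prob_space_PiM prob_space_measure_pmf)

lemma walk_measurable [measurable]: "walk x n \<in> measurable (walk_measure \<rho>) (count_space UNIV)"
proof (induction n)
  case 0
  then show ?case by (simp add: walk_def[abs_def])
next
  case (Suc n)
  have c: "(\<lambda>\<omega>. \<omega> n) \<in> measurable (walk_measure \<rho>) (count_space UNIV)"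
    unfolding measurable_cong_sets[OF sets_walk_measure refl] by measurable
  have "(\<lambda>\<omega>. walk x n \<omega> + \<omega> n) \<in> measurable (walk_measure \<rho>) (count_space UNIV)"
    by (rule measurable_compose_countable[where f = "\<lambda>i \<omega>. i + \<omega> n" and g = "walk x n", OF _ Suc])
       (rule measurable_compose[OF c], simp)
  then show ?case by (simp add: walk_def[abs_def] add.assoc)
qed

lemma walk_measure_first_step:
  assumes A: "A \<in> sets (walk_measure \<rho>)"
  shows "measure (walk_measure \<rho>) A =
    measure_pmf.expectation (step_pmf \<rho>) (\<lambda>s. measure (walk_measure \<rho>) {\<omega> \<in> space (walk_measure \<rho>). case_nat s \<omega> \<in> A})"
proof -
  interpret W: prob_space "walk_measure \<rho>" by (rule prob_space_walk_measure)
  interpret sequence_space "measure_pmf (step_pmf \<rho>)"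
    by unfold_locales
  have W: "walk_measure \<rho> = S" by (simp add: walk_measure_def)
  let ?f = "\<lambda>(s, \<omega>). case_nat s \<omega> :: nat \<Rightarrow> int"
  have f: "?f \<in> measurable (measure_pmf (step_pmf \<rho>) \<Otimes>\<^sub>M walk_measure \<rho>) (walk_measure \<rho>)"
    unfolding W by measurable
  have "emeasure (walk_measure \<rho>) A = emeasure (distr (measure_pmf (step_pmf \<rho>) \<Otimes>\<^sub>M walk_measure \<rho>) (walk_measure \<rho>) ?f) A"
    unfolding W PiM_iter ..
  also have "\<dots> = emeasure (measure_pmf (step_pmf \<rho>) \<Otimes>\<^sub>M walk_measure \<rho>) (?f -` A \<inter> space (measure_pmf (step_pmf \<rho>) \<Otimes>\<^sub>M walk_measure \<rho>))"
    by (rule emeasure_distr[OF f A])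
  also have "\<dots> = (\<integral>\<^sup>+s. emeasure (walk_measure \<rho>) (Pair s -` (?f -` A \<inter> space (measure_pmf (step_pmf \<rho>) \<Otimes>\<^sub>M walk_measure \<rho>))) \<partial>step_pmf \<rho>)"
    by (rule W.emeasure_pair_measure_alt) (rule measurable_sets[OF f A])
  also have "\<dots> = (\<integral>\<^sup>+s. ennreal (measure (walk_measure \<rho>) {\<omega> \<in> space (walk_measure \<rho>). case_nat s \<omega> \<in> A}) \<partial>step_pmf \<rho>)"
  proof (rule nn_integral_cong)
    fix s
    have "Pair s -` (?f -` A \<inter> space (measure_pmf (step_pmf \<rho>) \<Otimes>\<^sub>M walk_measure \<rho>)) = {\<omega> \<in> space (walk_measure \<rho>). case_nat s \<omega> \<in> A}"
      by (auto simp: space_pair_measure)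
    then show "emeasure (walk_measure \<rho>) (Pair s -` (?f -` A \<inter> space (measure_pmf (step_pmf \<rho>) \<Otimes>\<^sub>M walk_measure \<rho>))) =
      ennreal (measure (walk_measure \<rho>) {\<omega> \<in> space (walk_measure \<rho>). case_nat s \<omega> \<in> A})"
      by (simp add: W.emeasure_eq_measure)
  qed
  also have "\<dots> = ennreal (measure_pmf.expectation (step_pmf \<rho>) (\<lambda>s. measure (walk_measure \<rho>) {\<omega> \<in> space (walk_measure \<rho>). case_nat s \<omega> \<in> A}))"
    by (intro nn_integral_eq_integral measure_pmf.integrable_const_bound[where B = 1]) auto
  finally show ?thesis
    by (simp add: W.emeasure_eq_measure integral_nonneg_AE)
qed

lemma walk_case_nat: "walk x (Suc m) (case_nat s \<omega>) = walk (x + s) m \<omega>"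
  unfolding walk_def by (subst sum.lessThan_Suc_shift) simp

lemma walk_events [measurable]:
  "{\<omega> \<in> space (walk_measure \<rho>). walk x n \<omega> = y \<and> (\<forall>m<n. walk x m \<omega> \<in> C m)} \<in> sets (walk_measure \<rho>)"
  by measurable

lemma walk_measure_paths:
  assumes \<rho>: "0 < \<rho>" "\<rho> < 1"
  shows "measure (walk_measure \<rho>) {\<omega> \<in> space (walk_measure \<rho>). walk x n \<omega> = y \<and> (\<forall>m<n. walk x m \<omega> \<in> C m)}
    = (\<rho> / (1 - \<rho>)) ^ n * (1 - \<rho>) powi (x - y) * real (paths C n x y)"
proof (induction n arbitrary: x C)
  case 0
  interpret W: prob_space "walk_measure \<rho>" by (rule prob_space_walk_measure)
  show ?case using W.prob_space by (auto simp: walk_def)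
next
  case (Suc n)
  let ?W = "walk_measure \<rho>" and ?C = "\<lambda>m. C (Suc m)"
  define c where "c = \<rho> / (1 - \<rho>)"
  define a where "a = 1 - \<rho>"
  have a: "a \<noteq> 0" using \<rho> by (simp add: a_def)
  have "measure ?W {\<omega> \<in> space ?W. walk x (Suc n) \<omega> = y \<and> (\<forall>m<Suc n. walk x m \<omega> \<in> C m)}
    = measure_pmf.expectation (step_pmf \<rho>) (\<lambda>s. measure ?W {\<omega> \<in> space ?W. case_nat s \<omega> \<in>
      {\<omega> \<in> space ?W. walk x (Suc n) \<omega> = y \<and> (\<forall>m<Suc n. walk x m \<omega> \<in> C m)}})"
    by (rule walk_measure_first_step) measurable
  also have "\<dots> = measure_pmf.expectation (step_pmf \<rho>) (\<lambda>s. if x \<in> C 0 then c ^ n * a powi (x + s - y) * real (paths ?C n (x + s) y) else 0)"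
  proof (rule Bochner_Integration.integral_cong[OF refl])
    fix s
    have "{\<omega> \<in> space ?W. case_nat s \<omega> \<in> {\<omega> \<in> space ?W. walk x (Suc n) \<omega> = y \<and> (\<forall>m<Suc n. walk x m \<omega> \<in> C m)}}
      = (if x \<in> C 0 then {\<omega> \<in> space ?W. walk (x + s) n \<omega> = y \<and> (\<forall>m<n. walk (x + s) m \<omega> \<in> ?C m)} else {})"
      by (auto simp: walk_case_nat All_less_Suc2 walk_measure_def space_PiM) (auto simp: walk_def)
    then show "measure ?W {\<omega> \<in> space ?W. case_nat s \<omega> \<in> {\<omega> \<in> space ?W. walk x (Suc n) \<omega> = y \<and> (\<forall>m<Suc n. walk x m \<omega> \<in> C m)}}
      = (if x \<in> C 0 then c ^ n * a powi (x + s - y) * real (paths ?C n (x + s) y) else 0)"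
      using Suc.IH[of "x + s" ?C] by (simp add: c_def a_def)
  qed
  also have "\<dots> = (\<Sum>s\<in>{y - x..-1}. pmf (step_pmf \<rho>) s *\<^sub>R (if x \<in> C 0 then c ^ n * a powi (x + s - y) * real (paths ?C n (x + s) y) else 0))"
  proof (rule integral_measure_pmf)
    fix s assume s: "s \<in> set_pmf (step_pmf \<rho>)" "(if x \<in> C 0 then c ^ n * a powi (x + s - y) * real (paths ?C n (x + s) y) else 0) \<noteq> 0"
    from s(1) have "s \<le> - 1" by (auto simp: step_pmf_def)
    moreover have "\<not> x + s < y + int n" using s(2) paths_eq_0[of "x + s" y n ?C] by (auto split: if_splits)
    then have "y - x \<le> s" by linarith
    ultimately show "s \<in> {y - x..-1}" by simp
  qed simp
  also have "\<dots> = (\<Sum>s\<in>{y - x..-1}. if x \<in> C 0 then c ^ Suc n * a powi (x - y) * real (paths ?C n (x + s) y) else 0)"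
  proof (intro sum.cong refl)
    fix s assume s: "s \<in> {y - x..-1}"
    have "pmf (step_pmf \<rho>) (s - 0) = c * a powi (0 - s)"
      unfolding pmf_step_pmf[OF \<rho>] c_def a_def using s by simp
    moreover have "a powi (x + s - y) * a powi (- s) = a powi (x - y)"
      using a by (simp add: power_int_add[symmetric])
    ultimately show "pmf (step_pmf \<rho>) s *\<^sub>R (if x \<in> C 0 then c ^ n * a powi (x + s - y) * real (paths ?C n (x + s) y) else 0)
      = (if x \<in> C 0 then c ^ Suc n * a powi (x - y) * real (paths ?C n (x + s) y) else 0)"
      by (simp add: mult_ac)
  qed
  also have "\<dots> = (\<Sum>t\<in>{y..<x}. if x \<in> C 0 then c ^ Suc n * a powi (x - y) * real (paths ?C n t y) else 0)"
    by (rule sum.reindex_bij_witness[where i = "\<lambda>t. t - x" and j = "\<lambda>s. x + s"]) auto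
  also have "\<dots> = c ^ Suc n * a powi (x - y) * real (paths C (Suc n) x y)"
    unfolding paths_first_step by (simp add: sum_distrib_left)
  finally show ?case by (simp add: c_def a_def)
qed

lemma walk_measure_free_paths:
  assumes "0 < \<rho>" "\<rho> < 1"
  shows "measure (walk_measure \<rho>) {\<omega> \<in> space (walk_measure \<rho>). walk x n \<omega> = y}
    = (\<rho> / (1 - \<rho>)) ^ n * (1 - \<rho>) powi (x - y) * real (free_paths n x y)"
  using walk_measure_paths[OF assms, of x n y "\<lambda>_. UNIV"] by simp

lemma hit_time_less: "hit_time Y x \<omega> < enat N \<longleftrightarrow> (\<exists>m<N. walk x m \<omega> > Y (int m + 1))"
  unfolding hit_time_def Inf_less_iff by auto

lemma T_kernel_eq_paths:
  assumes \<rho>: "0 < \<rho>" "\<rho> < 1"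
  shows "T_kernel \<rho> N L Y x y = (\<rho> / (1 - \<rho>)) ^ N * (1 - \<rho>) powi (x - (y - 1 - int L)) *
    (real (free_paths N x (y - 1 - int L)) - real (paths (\<lambda>m. {..Y (int m + 1)}) N x (y - 1 - int L)))"
proof -
  interpret W: prob_space "walk_measure \<rho>" by (rule prob_space_walk_measure)
  let ?W = "walk_measure \<rho>" and ?b = "y - 1 - int L"
  let ?A = "{\<omega> \<in> space ?W. walk x N \<omega> = ?b \<and> (\<forall>m<N. walk x m \<omega> \<in> UNIV)}"
  let ?B = "{\<omega> \<in> space ?W. walk x N \<omega> = ?b \<and> (\<forall>m<N. walk x m \<omega> \<in> {..Y (int m + 1)})}"
  have "{\<omega> \<in> space ?W. walk x N \<omega> = - int L + y - 1 \<and> hit_time Y x \<omega> < enat N} = ?A - ?B"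
    unfolding hit_time_less by (auto simp: not_less)
  then have "T_kernel \<rho> N L Y x y = measure ?W ?A - measure ?W ?B"
    unfolding T_kernel_def
    using W.finite_measure_Diff[of ?A ?B] walk_events[of \<rho> x N ?b "\<lambda>_. UNIV"]
      walk_events[of \<rho> x N ?b "\<lambda>m. {..Y (int m + 1)}"] by auto
  also have "\<dots> = (\<rho> / (1 - \<rho>)) ^ N * (1 - \<rho>) powi (x - ?b) *
    (real (free_paths N x ?b) - real (paths (\<lambda>m. {..Y (int m + 1)}) N x ?b))"
    unfolding walk_measure_paths[OF \<rho>] by (simp add: algebra_simps)
  finally show ?thesis .
qed

section \<open>Bethe roots\<close>

text \<open>With this sign one difference in the endpoint takes \<open>free_paths (Suc n) x\<close>
  to \<open>free_paths n x\<close>.\<close>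

definition bdiff :: "(int \<Rightarrow> 'a::ab_group_add) \<Rightarrow> int \<Rightarrow> 'a" where
  "bdiff h y = h (y - 1) - h y"

lemma bdiff_funpow_Suc: "(bdiff ^^ Suc k) h y = (bdiff ^^ k) h (y - 1) - (bdiff ^^ k) h y"
  by (simp only: funpow.simps(2) o_apply bdiff_def[of "(bdiff ^^ k) h" y])

lemma bdiff_funpow_cong:
  assumes "\<And>t. y - int k \<le> t \<Longrightarrow> t \<le> y \<Longrightarrow> h t = h' t"
  shows "(bdiff ^^ k) h y = (bdiff ^^ k) h' y"
  using assms
proof (induction k arbitrary: y)
  case (Suc k)
  have "(bdiff ^^ k) h (y - 1) = (bdiff ^^ k) h' (y - 1)" by (rule Suc.IH) (use Suc.prems in auto)
  moreover have "(bdiff ^^ k) h y = (bdiff ^^ k) h' y" by (rule Suc.IH) (use Suc.prems in auto)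
  ultimately show ?case by (simp only: bdiff_funpow_Suc)
qed simp

lemma bdiff_funpow_lincomb:
  fixes h g :: "int \<Rightarrow> 'a::comm_ring_1"
  shows "(bdiff ^^ k) (\<lambda>y. c * h y + g y) y = c * (bdiff ^^ k) h y + (bdiff ^^ k) g y"
  by (induction k arbitrary: y) (simp_all add: bdiff_funpow_Suc algebra_simps del: funpow.simps(2))

lemma bdiff_funpow_zero [simp]: "(bdiff ^^ k) (\<lambda>y. 0) y = (0::'a::comm_ring_1)"
proof (induction k arbitrary: y)
  case (Suc k)
  show ?case by (simp only: bdiff_funpow_Suc Suc.IH diff_self)
qed simp

lemma bdiff_funpow_sum:
  fixes h :: "'b \<Rightarrow> int \<Rightarrow> 'a::comm_ring_1"
  shows "(bdiff ^^ k) (\<lambda>y. \<Sum>j\<in>J. c j * h j y) y = (\<Sum>j\<in>J. c j * (bdiff ^^ k) (h j) y)"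
proof (induction J rule: infinite_finite_induct)
  case (insert p J)
  have "(bdiff ^^ k) (\<lambda>y. c p * h p y + (\<Sum>j\<in>J. c j * h j y)) y =
    c p * (bdiff ^^ k) (h p) y + (bdiff ^^ k) (\<lambda>y. \<Sum>j\<in>J. c j * h j y) y"
    by (rule bdiff_funpow_lincomb)
  then show ?case using insert by simp
qed simp_all

lemma bdiff_funpow_powi:
  fixes b :: "'a::field"
  assumes "b \<noteq> 0"
  shows "(bdiff ^^ k) (\<lambda>y. b powi y) y = (inverse b - 1) ^ k * b powi y"
  using assms
  by (induction k arbitrary: y) (simp_all add: bdiff_funpow_Suc power_int_diff field_simps del: funpow.simps(2))

section \<open>The roots are simple and avoid the critical line\<close>

locale bethe =
  fixes N L :: nat and z :: complex
  assumes N0: "0 < N" and NL: "N < L" and z0: "0 < cmod z" and zr: "cmod z < bethe_radius N L"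
begin

definition bethe_roots :: "complex set" where
  "bethe_roots = {w. bethe_q N L z w = 0}"

lemma bethe_rootsD:
  assumes "w \<in> bethe_roots"
  shows "w ^ N * (w + 1) ^ (L - N) = z ^ L" "w \<noteq> 0" "w + 1 \<noteq> 0"
proof -
  show *: "w ^ N * (w + 1) ^ (L - N) = z ^ L"
    using assms by (simp add: bethe_roots_def bethe_q_def)
  have "z ^ L \<noteq> 0" using z0 by simp
  then show "w \<noteq> 0" "w + 1 \<noteq> 0" using * N0 NL by (auto simp: power_0_left)
qed

lemma bethe_radius_power: "bethe_radius N L ^ L = (real N / real L) ^ N * (1 - real N / real L) ^ (L - N)"
proof -
  let ?p = "real N / real L"
  have p: "0 < ?p" "0 < 1 - ?p" using N0 NL by auto
  have L: "real L * ?p = real N" "real L * (1 - ?p) = real (L - N)" using NL by (auto simp: field_simps)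
  have pw: "(x powr t) ^ L = x powr (real L * t)" if "0 < x" for x t :: real
    using that by (simp add: powr_power mult.commute)
  have "(?p powr ?p) ^ L = ?p ^ N" "((1 - ?p) powr (1 - ?p)) ^ L = (1 - ?p) ^ (L - N)"
    using pw[OF p(1), of ?p] pw[OF p(2), of "1 - ?p"] powr_realpow[OF p(1), of N] powr_realpow[OF p(2), of "L - N"]
    unfolding L by simp_all
  then show ?thesis by (simp add: bethe_radius_def power_mult_distrib)
qed

text \<open>On the line both |w| \<ge> N/L and |w + 1| \<ge> 1 - N/L, so the modulus of
  \<open>w ^ N * (w + 1) ^ (L - N)\<close> is at least the L-th power of
  \<open>bethe_radius N L\<close>, which exceeds that of \<open>z ^ L\<close>.\<close>

lemma bethe_roots_off_line:
  assumes "w \<in> bethe_roots"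
  shows "Re w \<noteq> - (real N / real L)"
proof
  let ?p = "real N / real L"
  assume re: "Re w = - ?p"
  have p: "0 < ?p" "0 < 1 - ?p" using N0 NL by auto
  have "?p \<le> cmod w" using abs_Re_le_cmod[of w] re p by simp
  moreover have "1 - ?p \<le> cmod (w + 1)" using abs_Re_le_cmod[of "w + 1"] re p by simp
  ultimately have "?p ^ N * (1 - ?p) ^ (L - N) \<le> cmod w ^ N * cmod (w + 1) ^ (L - N)"
    using p by (intro mult_mono power_mono) auto
  also have "\<dots> = cmod z ^ L"
    using arg_cong[OF bethe_rootsD(1)[OF assms], of cmod] by (simp add: norm_mult norm_power)
  also have "\<dots> < bethe_radius N L ^ L" using zr N0 NL by (intro power_strict_mono) auto
  finally show False unfolding bethe_radius_power by simp
qed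

definition bethe_poly :: "complex Polynomial.poly" where
  "bethe_poly = [:0, 1:] ^ N * [:1, 1:] ^ (L - N) - [:z ^ L:]"

lemma poly_bethe: "Polynomial.poly bethe_poly w = bethe_q N L z w"
  by (simp add: bethe_poly_def bethe_q_def add.commute)

lemma degree_bethe: "Polynomial.degree bethe_poly = L" "lead_coeff bethe_poly = 1"
proof -
  let ?f = "[:0, 1:] ^ N * [:1, 1:] ^ (L - N) :: complex Polynomial.poly"
  have d: "Polynomial.degree ?f = L" using NL by (simp add: degree_mult_eq degree_power_eq)
  have l: "lead_coeff ?f = 1" by (simp add: lead_coeff_mult lead_coeff_power)
  have lt: "Polynomial.degree (- [:z ^ L:]) < Polynomial.degree ?f" using d N0 NL by simp
  have eq: "bethe_poly = - [:z ^ L:] + ?f" unfolding bethe_poly_def by (simp only: uminus_add_conv_diff)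
  show "Polynomial.degree bethe_poly = L" unfolding eq using degree_add_eq_right[OF lt] d by simp
  show "lead_coeff bethe_poly = 1" unfolding eq using lead_coeff_add_le[of "- [:z ^ L:]" ?f] degree_add_eq_right[OF lt] lt d l
    by (simp add: coeff_eq_0 del: minus_pCons)
qed

text \<open>The derivative is \<open>w ^ (N - 1) * (w + 1) ^ (L - N - 1) * (L * w + N)\<close>. Its
  zeros 0 and -1 are not roots, and the zero -N/L lies on the excluded line.\<close>

lemma rsquarefree_bethe: "rsquarefree bethe_poly"
  unfolding rsquarefree_roots
proof (intro allI notI)
  fix w assume a: "Polynomial.poly bethe_poly w = 0 \<and> Polynomial.poly (pderiv bethe_poly) w = 0"
  then have w: "w \<in> bethe_roots" by (simp add: bethe_roots_def poly_bethe)
  obtain n m where nm: "N = Suc n" "L - N = Suc m" using N0 NL by (metis Suc_pred zero_less_diff)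
  have bp: "bethe_poly = [:0, 1:] ^ Suc n * [:1, 1:] ^ Suc m - [:z ^ L:]"
    unfolding bethe_poly_def nm[symmetric] ..
  define P R :: "complex Polynomial.poly" where "P = [:0, 1:]" and "R = [:1, 1:]"
  have PR: "pderiv P = 1" "pderiv R = 1" "Polynomial.poly P w = w" "Polynomial.poly R w = w + 1"
    by (simp_all add: P_def R_def pderiv_pCons add.commute)
  have "Polynomial.poly (pderiv bethe_poly) w = w ^ n * (w + 1) ^ m * (of_nat (Suc n + Suc m) * w + of_nat (Suc n))"
    unfolding bp P_def[symmetric] R_def[symmetric] pderiv_diff pderiv_mult pderiv_power_Suc PR
    by (simp add: PR pderiv_pCons algebra_simps)
  then have "of_nat (Suc n + Suc m) * w + of_nat (Suc n) = 0"
    using a bethe_rootsD(2,3)[OF w] by (simp only: mult_eq_0_iff power_eq_0_iff) simp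
  moreover have "Suc n + Suc m = L" using nm NL by linarith
  ultimately have "of_nat L * w + of_nat N = 0" using nm(1) by (simp only:)
  then have "Re (of_nat L * w + of_nat N) = 0" by (simp only: zero_complex.sel)
  then have "real L * Re w + real N = 0" by simp
  then have "Re w = - (real N / real L)" using NL by (simp add: field_simps)
  then show False using bethe_roots_off_line[OF w] by simp
qed

lemma finite_bethe_roots [simp]: "finite bethe_roots"
proof -
  have "bethe_poly \<noteq> 0" using degree_bethe(2) by auto
  then show ?thesis using poly_roots_finite[of bethe_poly] by (simp add: bethe_roots_def poly_bethe)
qed

lemma bethe_poly_factor: "bethe_poly = (\<Prod>w\<in>bethe_roots. [:- w, 1:])"
  using complex_poly_decompose_rsquarefree[OF rsquarefree_bethe]
  using degree_bethe(2) by (simp only: smult_1_left bethe_roots_def poly_bethe)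

lemma card_bethe_roots: "card bethe_roots = L"
proof -
  have "Polynomial.degree (\<Prod>w\<in>bethe_roots. [:- w, 1:]) = (\<Sum>w\<in>bethe_roots. Polynomial.degree [:- w, 1:])"
    by (rule degree_prod_eq_sum_degree) auto
  then show ?thesis using degree_bethe(1) by (simp add: bethe_poly_factor[symmetric])
qed

lemma bethe_q_factor: "bethe_q N L z x = (\<Prod>w\<in>bethe_roots. x - w)"
  unfolding poly_bethe[symmetric] bethe_poly_factor poly_prod by simp

abbreviation "lefts \<equiv> left_roots N L z"
abbreviation "rights \<equiv> right_roots N L z"

lemma roots_partition: "bethe_roots = lefts \<union> rights" "lefts \<inter> rights = {}"
  using bethe_roots_off_line by (auto simp: bethe_roots_def left_roots_def right_roots_def linorder_neq_iff)

lemma finite_lefts [simp]: "finite lefts" and finite_rights [simp]: "finite rights"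
  using finite_bethe_roots unfolding roots_partition(1) by simp_all

text \<open>The derivative of \<open>bethe_q\<close> at a root \<open>w\<close>, in a product form
  that is visibly nonzero.\<close>

definition dq :: "complex \<Rightarrow> complex" where
  "dq w = (\<Prod>x\<in>bethe_roots - {w}. w - x)"

lemma dq_nonzero: "dq w \<noteq> 0"
  by (simp add: dq_def)

lemma lagrange:
  assumes p: "Polynomial.degree p < L"
  shows "p = (\<Sum>w\<in>bethe_roots. Polynomial.smult (Polynomial.poly p w / dq w) (\<Prod>x\<in>bethe_roots - {w}. [:- x, 1:]))"
proof -
  let ?P = "\<Sum>w\<in>bethe_roots. Polynomial.smult (Polynomial.poly p w / dq w) (\<Prod>x\<in>bethe_roots - {w}. [:- x, 1:])"
  show ?thesis
  proof (rule poly_eqI_degree[of bethe_roots])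
    fix v assume v: "v \<in> bethe_roots"
    have "Polynomial.poly ?P v = (\<Sum>w\<in>bethe_roots. Polynomial.poly p w / dq w * (\<Prod>x\<in>bethe_roots - {w}. v - x))"
      by (simp add: poly_sum poly_prod)
    also have "\<dots> = (\<Sum>w\<in>bethe_roots. if w = v then Polynomial.poly p v else 0)"
    proof (intro sum.cong refl)
      fix w assume "w \<in> bethe_roots"
      show "Polynomial.poly p w / dq w * (\<Prod>x\<in>bethe_roots - {w}. v - x) = (if w = v then Polynomial.poly p v else 0)"
      proof (cases "w = v")
        case True
        then show ?thesis using dq_nonzero[of v] by (simp add: dq_def)
      next
        case False
        then have "(\<Prod>x\<in>bethe_roots - {w}. v - x) = 0" using v by (intro prod_zero) auto
        then show ?thesis using False by simp
      qed
    qed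
    also have "\<dots> = Polynomial.poly p v" using v by simp
    finally show "Polynomial.poly p v = Polynomial.poly ?P v" by simp
  next
    show "Polynomial.degree p < card bethe_roots" using p by (simp add: card_bethe_roots)
    have "Polynomial.degree ?P \<le> L - 1"
    proof (rule degree_sum_le)
      fix w assume "w \<in> bethe_roots"
      then have "card (bethe_roots - {w}) = L - 1" by (simp add: card_bethe_roots)
      then have "Polynomial.degree (\<Prod>x\<in>bethe_roots - {w}. [:- x, 1:]) = L - 1"
        by (subst degree_prod_eq_sum_degree) auto
      then show "Polynomial.degree (Polynomial.smult (Polynomial.poly p w / dq w) (\<Prod>x\<in>bethe_roots - {w}. [:- x, 1:])) \<le> L - 1"
        using degree_smult_le order.trans by metis
    qed simp
    then show "Polynomial.degree ?P < card bethe_roots" using N0 NL by (simp add: card_bethe_roots)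
  qed
qed

text \<open>Compare the coefficients of degree L - 1 in the Lagrange interpolation of
  \<open>p\<close>.\<close>

lemma euler_sum:
  assumes p: "Polynomial.degree p < L"
  shows "(\<Sum>w\<in>bethe_roots. Polynomial.poly p w / dq w) = Polynomial.coeff p (L - 1)"
proof -
  have c: "Polynomial.coeff (\<Prod>x\<in>bethe_roots - {w}. [:- x, 1:]) (L - 1) = 1" if "w \<in> bethe_roots" for w
  proof -
    have "card (bethe_roots - {w}) = L - 1" using that by (simp add: card_bethe_roots)
    then have "Polynomial.degree (\<Prod>x\<in>bethe_roots - {w}. [:- x, 1:]) = L - 1"
      by (subst degree_prod_eq_sum_degree) auto
    moreover have "lead_coeff (\<Prod>x\<in>bethe_roots - {w}. [:- x, 1:]) = 1"
      by (simp add: lead_coeff_prod)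
    ultimately show ?thesis by simp
  qed
  have "Polynomial.coeff p (L - 1) = (\<Sum>w\<in>bethe_roots. Polynomial.poly p w / dq w * Polynomial.coeff (\<Prod>x\<in>bethe_roots - {w}. [:- x, 1:]) (L - 1))"
    by (subst lagrange[OF p]) (simp add: coeff_sum)
  also have "\<dots> = (\<Sum>w\<in>bethe_roots. Polynomial.poly p w / dq w)"
    by (intro sum.cong refl) (simp only: c mult_1_right)
  finally show ?thesis ..
qed

lemma euler_sum_power:
  assumes "n < L"
  shows "(\<Sum>w\<in>bethe_roots. (w + 1) ^ (L - 1 - n) / dq w) = (if n = 0 then 1 else 0)"
proof -
  let ?p = "[:1, 1:] ^ (L - 1 - n) :: complex Polynomial.poly"
  have d: "Polynomial.degree ?p = L - 1 - n" by (simp add: degree_power_eq)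
  have "Polynomial.coeff ?p (L - 1) = (if n = 0 then 1 else 0)"
  proof (cases "n = 0")
    case True
    have "lead_coeff ?p = 1" by (simp add: lead_coeff_power)
    then show ?thesis using d True by simp
  next
    case False
    then show ?thesis using d assms by (simp add: coeff_eq_0)
  qed
  moreover have "Polynomial.degree ?p < L" using d assms by simp
  ultimately show ?thesis using euler_sum[of ?p] by (simp add: add.commute)
qed

text \<open>Evaluate the Lagrange interpolation of the constant 1 at -1, where
  \<open>bethe_q\<close> has the value \<open>- (z ^ L)\<close>.\<close>

lemma euler_sum_inverse: "(\<Sum>w\<in>bethe_roots. inverse (w + 1) / dq w) = inverse (z ^ L)"
proof -
  have q: "bethe_q N L z (- 1) = - (z ^ L)" using NL by (simp add: bethe_q_def)
  have "Polynomial.poly (\<Sum>w\<in>bethe_roots. Polynomial.smult (Polynomial.poly 1 w / dq w) (\<Prod>x\<in>bethe_roots - {w}. [:- x, 1:])) (- 1) = 1"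
    using lagrange[of 1] N0 NL by simp
  then have "1 = (\<Sum>w\<in>bethe_roots. 1 / dq w * (\<Prod>x\<in>bethe_roots - {w}. - x - 1))"
    by (simp add: poly_sum poly_prod)
  also have "\<dots> = (\<Sum>w\<in>bethe_roots. 1 / dq w * (\<Prod>x\<in>bethe_roots - {w}. - 1 - x))"
    by (intro sum.cong refl arg_cong2[where f = "(*)"] prod.cong) simp
  also have "\<dots> = (\<Sum>w\<in>bethe_roots. z ^ L * (inverse (w + 1) / dq w))"
  proof (intro sum.cong refl)
    fix w assume w: "w \<in> bethe_roots"
    have "bethe_q N L z (- 1) = (- 1 - w) * (\<Prod>x\<in>bethe_roots - {w}. - 1 - x)"
      unfolding bethe_q_factor using w by (simp add: prod.remove)
    then have "(w + 1) * (\<Prod>x\<in>bethe_roots - {w}. - 1 - x) = z ^ L" unfolding q by (simp add: algebra_simps)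
    then have "(\<Prod>x\<in>bethe_roots - {w}. - 1 - x) = z ^ L * inverse (w + 1)"
      using bethe_rootsD(3)[OF w] by (simp add: field_simps)
    then show "1 / dq w * (\<Prod>x\<in>bethe_roots - {w}. - 1 - x) = z ^ L * (inverse (w + 1) / dq w)" by simp
  qed
  also have "\<dots> = z ^ L * (\<Sum>w\<in>bethe_roots. inverse (w + 1) / dq w)" by (simp add: sum_distrib_left)
  finally show ?thesis using z0 by (simp add: field_simps)
qed

section \<open>The Green function of the unweighted recurrence\<close>

definition epsz :: complex where "epsz = (- 1) ^ N * z ^ L"

text \<open>For a set \<open>A\<close> of roots, the sum over \<open>A\<close> of the residues of
  \<open>(- 1) ^ N * (w + 1) powi (int L - 1 - n) / bethe_q N L z w\<close>.\<close>

definition root_fun :: "complex set \<Rightarrow> int \<Rightarrow> complex" where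
  "root_fun A n = (- 1) ^ N * (\<Sum>w\<in>A. 1 / dq w * (w + 1) powi (int L - 1 - n))"

text \<open>The \<open>n\<close>-th Fourier coefficient of \<open>(- 1)\<^sup>N (w + 1)\<^sup>L / bethe_q w\<close> on a circle about \<open>- 1\<close> that
  separates the left from the right roots.\<close>

definition green :: "int \<Rightarrow> complex" where
  "green n = (if n \<le> int L - 1 then root_fun lefts n else - root_fun rights n)"

text \<open>The sum of all residues is zero. Besides the roots there is no pole for 1 \<le> n \<le>
  L - 1, a residue at infinity for n = 0, and a simple pole at -1 for n = L.\<close>

lemma root_fun_diff:
  shows "1 \<le> n \<Longrightarrow> n \<le> int L - 1 \<Longrightarrow> root_fun lefts n + root_fun rights n = 0"
    and "root_fun lefts 0 + root_fun rights 0 = (- 1) ^ N"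
    and "root_fun lefts (int L) + root_fun rights (int L) = (- 1) ^ N / z ^ L"
proof -
  have s: "root_fun lefts n + root_fun rights n = (- 1) ^ N * (\<Sum>w\<in>bethe_roots. (w + 1) powi (int L - 1 - n) / dq w)" for n
    unfolding root_fun_def roots_partition(1)
    by (subst sum.union_disjoint) (simp_all add: roots_partition(2) distrib_left)
  have p: "(w + 1) powi (int L - 1 - int m) = (w + 1) ^ (L - 1 - m)" if "m < L" for m and w :: complex
  proof -
    have "int L - 1 - int m = int (L - 1 - m)" using that by linarith
    then show ?thesis by (simp only: power_int_of_nat)
  qed
  show "root_fun lefts n + root_fun rights n = 0" if "1 \<le> n" "n \<le> int L - 1"
  proof -
    obtain m where m: "n = int m" using \<open>1 \<le> n\<close> by (metis nonneg_int_cases order_trans zero_le_one)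
    then have "m < L" "m \<noteq> 0" using that by auto
    then show ?thesis unfolding s m p[OF \<open>m < L\<close>] euler_sum_power[OF \<open>m < L\<close>] by simp
  qed
  show "root_fun lefts 0 + root_fun rights 0 = (- 1) ^ N"
    using s[of 0] p[of 0] euler_sum_power[of 0] NL by simp
  show "root_fun lefts (int L) + root_fun rights (int L) = (- 1) ^ N / z ^ L"
    unfolding s using euler_sum_inverse by (simp add: divide_inverse power_int_minus)
qed

lemma green_left: "n \<le> int L - 1 \<Longrightarrow> green n = root_fun lefts n"
  by (simp add: green_def)

text \<open>Both formulas for \<open>green\<close> hold for 1 \<le> n \<le> L - 1. Since N < L, this
  overlap lets a single formula cover each window of N + 1 points in the recurrence.\<close>

lemma green_right: "1 \<le> n \<Longrightarrow> green n = - root_fun rights n"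
  using root_fun_diff(1)[of n] by (auto simp: green_def eq_neg_iff_add_eq_0)

text \<open>For a root w the Bethe equation gives
  \<open>(inverse (w + 1) - 1) ^ N = epsz / (w + 1) ^ L\<close>, so N differences act on its
  exponential as a shift by L. The constant \<open>epsz\<close> is \<zeta> with the weights of the N
  steps and of the shift put in; see \<open>\<zeta>_epsz\<close>.\<close>

lemma root_fun_recurrence:
  assumes "A \<subseteq> bethe_roots"
  shows "(bdiff ^^ N) (\<lambda>y. root_fun A (c - y)) y = epsz * root_fun A (c - (y - int L))"
proof -
  have pw: "(w + 1) powi (int L - 1 - (c - y)) = (w + 1) powi (int L - 1 - c) * (w + 1) powi y" if "w \<in> A" for w y
  proof -
    have "w + 1 \<noteq> 0" using bethe_rootsD(3) assms that by blast
    then show ?thesis by (simp add: power_int_add[symmetric] algebra_simps)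
  qed
  have "(bdiff ^^ N) (\<lambda>y. root_fun A (c - y)) y =
    (bdiff ^^ N) (\<lambda>y. \<Sum>w\<in>A. ((- 1) ^ N * (1 / dq w * (w + 1) powi (int L - 1 - c))) * (w + 1) powi y) y"
    by (rule bdiff_funpow_cong) (simp add: root_fun_def pw sum_distrib_left mult.assoc)
  also have "\<dots> = (\<Sum>w\<in>A. ((- 1) ^ N * (1 / dq w * (w + 1) powi (int L - 1 - c))) * (bdiff ^^ N) (\<lambda>y. (w + 1) powi y) y)"
    by (rule bdiff_funpow_sum)
  also have "\<dots> = (\<Sum>w\<in>A. ((- 1) ^ N * (1 / dq w * (w + 1) powi (int L - 1 - c))) * (epsz * (w + 1) powi (y - int L)))"
  proof (intro sum.cong refl arg_cong2[where f = "(*)"])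
    fix w assume "w \<in> A"
    then have w: "w \<in> bethe_roots" using assms by blast
    note D = bethe_rootsD[OF w]
    have i: "inverse (w + 1) - 1 = - (w / (w + 1))" using D(3) by (simp add: field_simps)
    have "(inverse (w + 1) - 1) ^ N = (- 1) ^ N * w ^ N / (w + 1) ^ N"
      by (simp only: i power_minus[of "w / (w + 1)"] power_divide times_divide_eq_right)
    also have "\<dots> = epsz / (w + 1) ^ L"
      unfolding epsz_def D(1)[symmetric] using D(3) NL by (simp add: field_simps power_add[symmetric])
    finally have "(inverse (w + 1) - 1) ^ N = epsz / (w + 1) ^ L" .
    then show "(bdiff ^^ N) (\<lambda>y. (w + 1) powi y) y = epsz * (w + 1) powi (y - int L)"
      using D(3) by (simp add: bdiff_funpow_powi power_int_diff)
  qed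
  also have "\<dots> = epsz * root_fun A (c - (y - int L))"
    unfolding root_fun_def sum_distrib_left by (intro sum.cong refl) (simp only: pw mult_ac)
  finally show ?thesis .
qed

text \<open>For y \<noteq> c one of the two formulas covers both sides, which then agree. At y = c
  the left side is covered by the left roots, but the value on the right has index L, the first one
  beyond their range. The mismatch there is the residue at -1, and it produces the 1.\<close>

lemma green_recurrence:
  "(bdiff ^^ N) (\<lambda>y. green (c - y)) y = epsz * green (c - (y - int L)) + (if y = c then 1 else 0)"
proof -
  have sub: "lefts \<subseteq> bethe_roots" "rights \<subseteq> bethe_roots" using roots_partition by auto
  consider "y < c" | "c < y" | "y = c" by linarith
  then show ?thesis
  proof cases
    case 1
    have "(bdiff ^^ N) (\<lambda>y. green (c - y)) y = (bdiff ^^ N) (\<lambda>y. (- 1) * root_fun rights (c - y) + 0) y"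
      by (rule bdiff_funpow_cong) (use 1 in \<open>simp add: green_right\<close>)
    also have "\<dots> = - (epsz * root_fun rights (c - (y - int L)))"
      by (subst bdiff_funpow_lincomb) (simp add: root_fun_recurrence[OF sub(2)])
    finally show ?thesis using 1 by (simp add: green_right)
  next
    case 2
    have "(bdiff ^^ N) (\<lambda>y. green (c - y)) y = (bdiff ^^ N) (\<lambda>y. root_fun lefts (c - y)) y"
      by (rule bdiff_funpow_cong) (use 2 NL in \<open>simp add: green_left\<close>)
    also have "\<dots> = epsz * root_fun lefts (c - (y - int L))"
      by (rule root_fun_recurrence[OF sub(1)])
    finally show ?thesis using 2 by (simp add: green_left)
  next
    case 3
    have "(bdiff ^^ N) (\<lambda>y. green (c - y)) y = (bdiff ^^ N) (\<lambda>y. root_fun lefts (c - y)) y"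
      by (rule bdiff_funpow_cong) (use 3 NL in \<open>simp add: green_left\<close>)
    also have "\<dots> = epsz * root_fun lefts (int L)"
      using 3 by (simp add: root_fun_recurrence[OF sub(1)])
    also have "root_fun lefts (int L) = green (int L) + (- 1) ^ N / z ^ L"
      using root_fun_diff(3) by (simp add: green_def eq_diff_eq)
    also have "epsz * (green (int L) + (- 1) ^ N / z ^ L) = epsz * green (int L) + epsz * ((- 1) ^ N / z ^ L)"
      by (rule distrib_left)
    also have "epsz * ((- 1) ^ N / z ^ L) = 1"
      using z0 by (simp add: epsz_def power_mult_distrib[symmetric])
    finally show ?thesis using 3 by simp
  qed
qed

end

section \<open>Consequences of the choice of \<rho>\<close>

locale bethe_walk = bethe +
  fixes \<rho> :: real and \<zeta> :: complex
  assumes \<rho>0: "0 < \<rho>" and \<rho>1: "\<rho> < 1"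
    and right_lt: "right_root_radius N L z < \<rho>" and left_lt: "\<rho> < 1 - left_root_radius N L z"
    and radius: "\<rho> ^ N * (1 - \<rho>) ^ (L - N) > cmod z ^ L"
    and \<zeta>_eq: "\<zeta> = z ^ L / of_real ((- \<rho>) ^ N * (1 - \<rho>) ^ (L - N))"
begin

lemma cmod_\<zeta>: "cmod \<zeta> < 1"
proof -
  have "cmod (of_real ((- \<rho>) ^ N * (1 - \<rho>) ^ (L - N))) = \<rho> ^ N * (1 - \<rho>) ^ (L - N)"
    using \<rho>0 \<rho>1 by (simp only: norm_of_real abs_mult power_abs) simp
  moreover have "0 < \<rho> ^ N * (1 - \<rho>) ^ (L - N)" using \<rho>0 \<rho>1 by simp
  ultimately show ?thesis using radius unfolding \<zeta>_eq by (simp only: norm_divide norm_power divide_less_eq_1_pos)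
qed

lemma right_root_less:
  assumes "v \<in> rights"
  shows "cmod v < \<rho>"
proof -
  have "cmod v \<le> Max (cmod ` rights)" by (rule Max_ge) (use assms in auto)
  then show ?thesis using right_lt unfolding right_root_radius_def by linarith
qed

lemma left_root_less:
  assumes "u \<in> lefts"
  shows "cmod (u + 1) < 1 - \<rho>"
proof -
  have "cmod (u + 1) \<le> Max ((\<lambda>u. cmod (u + 1)) ` lefts)" by (rule Max_ge) (use assms in auto)
  then show ?thesis using left_lt unfolding left_root_radius_def by linarith
qed

text \<open>Together with \<open>left_root_less\<close>: the circle of radius 1 - \<rho> about -1
  separates the left from the right roots.\<close>

lemma right_root_greater: "v \<in> rights \<Longrightarrow> 1 - \<rho> < cmod (v + 1)"
  using right_root_less[of v] norm_triangle_ineq4[of "v + 1" v] by simp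

lemma left_root_greater: "u \<in> lefts \<Longrightarrow> \<rho> < cmod u"
  using left_root_less[of u] norm_triangle_ineq4[of "u + 1" u] by simp

text \<open>Rouche's theorem on the circle of radius \<rho> about 0, comparing
  \<open>bethe_q\<close> with \<open>w ^ N * (w + 1) ^ (L - N)\<close>: there |w + 1| \<ge> 1 -
  \<rho>, so the bound \<open>radius\<close> applies. The latter has a zero of order N at 0 inside
  the circle and its other zero, -1, outside. The right roots are the roots inside, and they are
  simple, so Rouche's weighted count is their number.\<close>

lemma card_rights: "card rights = N"
proof -
  let ?f = "\<lambda>w::complex. w ^ N * (w + 1) ^ (L - N)" and ?g = "\<lambda>w::complex. - (z ^ L)"
  let ?\<gamma> = "circlepath 0 \<rho>"
  have zfg: "{p \<in> UNIV. ?f p + ?g p = 0} = bethe_roots"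
    by (auto simp: bethe_roots_def bethe_q_def)
  have zf: "{p \<in> UNIV. ?f p = 0} = {0, - 1}"
    using N0 NL by (auto simp: add_eq_0_iff2)
  have inside: "winding_number ?\<gamma> p = 1" if "cmod p < \<rho>" for p
    using that by (intro winding_number_circlepath) simp
  have outside: "winding_number ?\<gamma> p = 0" if "\<rho> < cmod p" for p
    by (rule winding_number_zero_outside[of _ "cball 0 \<rho>"]) (use that \<rho>0 in auto)
  have "(\<Sum>p\<in>{p \<in> UNIV. ?f p + ?g p = 0}. winding_number ?\<gamma> p * zorder (\<lambda>p. ?f p + ?g p) p)
    = (\<Sum>p\<in>{p \<in> UNIV. ?f p = 0}. winding_number ?\<gamma> p * zorder ?f p)"
  proof (rule Rouche_theorem)
    show "finite {p \<in> UNIV. ?f p + ?g p = 0}" unfolding zfg by simp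
    show "finite {p \<in> UNIV. ?f p = 0}" unfolding zf by simp
    show "\<forall>w\<in>path_image ?\<gamma>. cmod (?g w) < cmod (?f w)"
    proof
      fix w assume "w \<in> path_image ?\<gamma>"
      then have w: "cmod w = \<rho>" using \<rho>0 by simp
      have "1 - \<rho> \<le> cmod (w + 1)" using norm_triangle_ineq4[of "w + 1" w] w by simp
      then have "\<rho> ^ N * (1 - \<rho>) ^ (L - N) \<le> cmod (?f w)"
        using \<rho>0 \<rho>1 w by (auto simp: norm_mult norm_power intro!: mult_left_mono power_mono)
      then show "cmod (?g w) < cmod (?f w)" using radius by (simp add: norm_power)
    qed
  qed (auto intro!: holomorphic_intros)
  then have eq: "(\<Sum>p\<in>bethe_roots. winding_number ?\<gamma> p * zorder (\<lambda>p. ?f p + ?g p) p)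
    = (\<Sum>p\<in>{0, - 1}. winding_number ?\<gamma> p * zorder ?f p)"
    unfolding zfg zf .
  have z1: "zorder (\<lambda>p. ?f p + ?g p) w = 1" if w: "w \<in> bethe_roots" for w
  proof (rule simple_zeroI[of UNIV])
    show "(\<lambda>p. \<Prod>x\<in>bethe_roots - {w}. p - x) holomorphic_on UNIV" by (intro holomorphic_intros)
    show "(\<Prod>x\<in>bethe_roots - {w}. w - x) \<noteq> 0" by simp
    show "?f p + ?g p = (\<Prod>x\<in>bethe_roots - {w}. p - x) * (p - w)" for p
      using bethe_q_factor[of p] prod.remove[OF finite_bethe_roots w, of "\<lambda>x. p - x"]
      by (simp add: bethe_q_def mult.commute)
  qed auto
  have zN: "zorder ?f 0 = int N"
  proof (rule zorder_eqI[of UNIV _ "\<lambda>w. (w + 1) ^ (L - N)"])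
    show "(\<lambda>w::complex. (w + 1) ^ (L - N)) holomorphic_on UNIV" by (intro holomorphic_intros)
  qed auto
  have "(\<Sum>p\<in>bethe_roots. winding_number ?\<gamma> p * zorder (\<lambda>p. ?f p + ?g p) p)
    = (\<Sum>p\<in>bethe_roots. if p \<in> rights then 1 else 0)"
  proof (intro sum.cong refl)
    fix p assume p: "p \<in> bethe_roots"
    show "winding_number ?\<gamma> p * zorder (\<lambda>p. ?f p + ?g p) p = (if p \<in> rights then 1 else 0)"
      using z1[OF p] inside[OF right_root_less[of p]] outside[OF left_root_greater[of p]] p
        roots_partition by auto
  qed
  also have "\<dots> = of_nat (card rights)"
    using roots_partition by (simp add: sum.If_cases Int_absorb1)
  finally have "(of_nat (card rights) :: complex) = of_nat N"
    unfolding eq using inside[of 0] outside[of "- 1"] zN \<rho>0 \<rho>1 by simp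
  then show ?thesis by simp
qed

end

section \<open>Row vectors of the resolvent\<close>

lemma infsum_swap_dominated:
  fixes A :: "'a \<Rightarrow> 'b \<Rightarrow> complex"
  assumes A: "\<And>x. x \<in> X \<Longrightarrow> (\<lambda>y. norm (A x y)) summable_on Y"
    "\<And>x. x \<in> X \<Longrightarrow> (\<Sum>\<^sub>\<infinity>y\<in>Y. norm (A x y)) \<le> w x"
    and w: "w summable_on X"
  shows "(\<Sum>\<^sub>\<infinity>x\<in>X. \<Sum>\<^sub>\<infinity>y\<in>Y. A x y) = (\<Sum>\<^sub>\<infinity>y\<in>Y. \<Sum>\<^sub>\<infinity>x\<in>X. A x y)"
    and "y \<in> Y \<Longrightarrow> (\<lambda>x. A x y) summable_on X"
    and "(\<lambda>y. \<Sum>\<^sub>\<infinity>x\<in>X. A x y) summable_on Y"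
proof -
  have "(\<lambda>p. norm (case p of (x, y) \<Rightarrow> A x y)) summable_on X \<times> Y"
    unfolding Infinite_Sum.abs_summable_on_Sigma_iff
  proof (intro conjI ballI)
    show "(\<lambda>y. norm (case (x, y) of (x, y) \<Rightarrow> A x y)) summable_on Y" if "x \<in> X" for x
      using A(1)[OF that] by simp
    have "(\<lambda>x. \<Sum>\<^sub>\<infinity>y\<in>Y. norm (A x y)) summable_on X"
      by (rule summable_on_comparison_test[OF w]) (auto simp: A(2) infsum_nonneg)
    then show "(\<lambda>x. norm (\<Sum>\<^sub>\<infinity>y\<in>Y. norm (case (x, y) of (x, y) \<Rightarrow> A x y))) summable_on X"
      by (simp add: infsum_nonneg)
  qed
  then have s: "(\<lambda>(x, y). A x y) summable_on X \<times> Y"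
    by (rule Infinite_Sum.abs_summable_summable)
  show "(\<Sum>\<^sub>\<infinity>x\<in>X. \<Sum>\<^sub>\<infinity>y\<in>Y. A x y) = (\<Sum>\<^sub>\<infinity>y\<in>Y. \<Sum>\<^sub>\<infinity>x\<in>X. A x y)"
    by (rule infsum_swap_banach[OF s])
  have s': "(\<lambda>(y, x). A x y) summable_on Y \<times> X"
    using s summable_on_swap[of "\<lambda>(x, y). A x y" X Y] by (simp add: case_prod_unfold)
  show "(\<lambda>x. A x y) summable_on X" if "y \<in> Y"
    using summable_on_SigmaD1[OF s' that] .
  show "(\<lambda>y. \<Sum>\<^sub>\<infinity>x\<in>X. A x y) summable_on Y"
    by (rule summable_on_Sigma_banach[OF s'])
qed

lemma summable_on_powi_atLeast:
  fixes b :: complex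
  assumes "b \<noteq> 0" "cmod b < 1"
  shows "(\<lambda>x. cmod (b powi x)) summable_on {m..}"
proof -
  have "bij_betw (\<lambda>k. m + int k) UNIV {m..}"
    by (rule bij_betwI[of _ _ _ "\<lambda>x. nat (x - m)"]) auto
  moreover have "(\<lambda>k. cmod (b powi (m + int k))) summable_on UNIV"
  proof (rule summable_nonneg_imp_summable_on)
    have "summable (\<lambda>k. cmod (b powi m) * cmod b ^ k)"
      using assms by (intro summable_mult summable_geometric) simp
    then show "summable (\<lambda>k. cmod (b powi (m + int k)))"
      using assms by (simp add: power_int_add norm_mult norm_power)
  qed simp
  ultimately show ?thesis by (subst summable_on_reindex_bij_betw[symmetric])
qed

lemma summable_on_powi_atMost:
  fixes b :: complex
  assumes "1 < cmod b"
  shows "(\<lambda>x. cmod (b powi x)) summable_on {..m}"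
proof -
  have b: "b \<noteq> 0" using assms by auto
  have "bij_betw uminus {- m..} {..m}"
    by (rule bij_betwI[of _ _ _ uminus]) auto
  moreover have "(\<lambda>x. cmod (b powi (- x))) summable_on {- m..}"
    using summable_on_powi_atLeast[of "inverse b" "- m"] assms b
    by (simp add: power_int_minus power_int_inverse norm_inverse inverse_less_1_iff)
  ultimately show ?thesis by (subst summable_on_reindex_bij_betw[symmetric])
qed

section \<open>Inversion and uniqueness for the difference operator\<close>

lemma free_paths_shift: "free_paths n (x + s) (y + s) = free_paths n x y"
proof (induction n arbitrary: y)
  case (Suc n)
  have "free_paths (Suc n) (x + s) (y + s) = (\<Sum>t\<in>{y<..x}. free_paths n (x + s) (t + s))"
    unfolding paths.simps Int_UNIV_right
    by (rule sum.reindex_bij_witness[where i = "\<lambda>t. t + s" and j = "\<lambda>t. t - s"]) auto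
  then show ?case by (simp add: Suc.IH)
qed simp

lemma bdiff_free_paths:
  "k \<le> n \<Longrightarrow> (bdiff ^^ k) (\<lambda>y. of_nat (free_paths n x y) :: complex) y = of_nat (free_paths (n - k) x y)"
proof (induction k arbitrary: y)
  case (Suc k)
  then have k: "n - k = Suc (n - Suc k)" by simp
  have "(bdiff ^^ Suc k) (\<lambda>y. of_nat (free_paths n x y)) y =
    (of_nat (free_paths (n - k) x (y - 1)) - of_nat (free_paths (n - k) x y) :: complex)"
    unfolding bdiff_funpow_Suc using Suc by simp
  also have "\<dots> = of_nat (free_paths (n - Suc k) x y)"
    unfolding k paths_diff by simp
  finally show ?case .
qed simp

text \<open>Summing \<open>n\<close> times from infinity inverts \<open>bdiff ^^ n\<close>.\<close>

lemma sum_bdiff_free_paths: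
  fixes h :: "int \<Rightarrow> complex"
  assumes "\<And>y. m \<le> y \<Longrightarrow> h y = 0"
  shows "h y = (\<Sum>c\<in>{y..<m + int n}. (bdiff ^^ n) h c * of_nat (free_paths n c y))"
  using assms
proof (induction n arbitrary: h m y)
  case 0
  have "(\<Sum>c\<in>{y..<m}. h c * (if c = y then 1 else 0)) = (\<Sum>c\<in>{y..<m}. if c = y then h c else 0)"
    by (rule sum.cong) auto
  also have "\<dots> = (if y \<in> {y..<m} then h y else 0)" by (subst sum.delta) auto
  also have "\<dots> = h y" using 0 by auto
  finally have "(\<Sum>c\<in>{y..<m}. h c * (if c = y then 1 else 0)) = h y" .
  moreover have "of_nat (free_paths 0 c y) = (if c = y then 1 else 0 :: complex)" for c by simp
  ultimately show ?case by (simp only: of_nat_0 add_0_right funpow.simps(1) id_apply)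
next
  case (Suc n)
  have IH: "bdiff h t = (\<Sum>c\<in>{t..<m + 1 + int n}. (bdiff ^^ n) (bdiff h) c * of_nat (free_paths n c t))" for t
    by (rule Suc.IH) (simp add: bdiff_def Suc.prems)
  have tel: "(\<Sum>t\<in>{y<..m}. bdiff h t) = h y"
  proof (cases "y < m")
    case True
    have "(\<Sum>t\<in>{y<..y + int j}. bdiff h t) = h y - h (y + int j)" for j
    proof (induction j)
      case (Suc j)
      have "{y<..y + int (Suc j)} = insert (y + int (Suc j)) {y<..y + int j}" by auto
      then show ?case using Suc by (simp add: bdiff_def algebra_simps)
    qed simp
    from this[of "nat (m - y)"] show ?thesis using True Suc.prems[of m] by simp
  next
    case False
    then show ?thesis using Suc.prems[of y] by simp
  qed
  have "h y = (\<Sum>t\<in>{y<..m}. bdiff h t)" by (rule tel[symmetric])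
  also have "\<dots> = (\<Sum>t\<in>{y<..m}. \<Sum>c\<in>{t..<m + 1 + int n}. (bdiff ^^ n) (bdiff h) c * of_nat (free_paths n c t))"
    by (intro sum.cong refl) (rule IH)
  also have "\<dots> = (\<Sum>t\<in>{y<..m}. \<Sum>c\<in>{y..<m + 1 + int n}. (bdiff ^^ n) (bdiff h) c * of_nat (free_paths n c t))"
    by (intro sum.cong refl sum.mono_neutral_left) (auto intro!: paths_eq_0)
  also have "\<dots> = (\<Sum>c\<in>{y..<m + 1 + int n}. \<Sum>t\<in>{y<..m}. (bdiff ^^ n) (bdiff h) c * of_nat (free_paths n c t))"
    by (rule sum.swap)
  also have "\<dots> = (\<Sum>c\<in>{y..<m + 1 + int n}. \<Sum>t\<in>{y<..c}. (bdiff ^^ n) (bdiff h) c * of_nat (free_paths n c t))"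
  proof (rule sum.cong[OF refl])
    fix c assume c: "c \<in> {y..<m + 1 + int n}"
    have "(\<Sum>t\<in>{y<..m}. (bdiff ^^ n) (bdiff h) c * of_nat (free_paths n c t))
      = (\<Sum>t\<in>{y<..max m c}. (bdiff ^^ n) (bdiff h) c * of_nat (free_paths n c t))"
      by (intro sum.mono_neutral_left) (use c in \<open>auto intro!: paths_eq_0\<close>)
    also have "\<dots> = (\<Sum>t\<in>{y<..c}. (bdiff ^^ n) (bdiff h) c * of_nat (free_paths n c t))"
      by (intro sum.mono_neutral_right) (auto intro!: paths_eq_0)
    finally show "(\<Sum>t\<in>{y<..m}. (bdiff ^^ n) (bdiff h) c * of_nat (free_paths n c t))
      = (\<Sum>t\<in>{y<..c}. (bdiff ^^ n) (bdiff h) c * of_nat (free_paths n c t))" .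
  qed
  also have "\<dots> = (\<Sum>c\<in>{y..<m + int (Suc n)}. (bdiff ^^ Suc n) h c * of_nat (free_paths (Suc n) c y))"
    by (simp add: sum_distrib_left funpow_swap1 add.assoc add.commute[of 1])
  finally show ?case .
qed

text \<open>The solutions are polynomials, and only the zero polynomial tends to 0. By this
  uniqueness the closed form of the resolvent rows is verified without summing a series.\<close>

lemma bdiff_zero_imp_zero:
  fixes E :: "int \<Rightarrow> complex"
  assumes "\<And>y. (bdiff ^^ k) E y = 0" and "(E \<longlongrightarrow> 0) at_top"
  shows "E y = 0"
  using assms
proof (induction k arbitrary: y)
  case (Suc k)
  have lim: "((bdiff ^^ j) E \<longlongrightarrow> 0) at_top" for j
  proof (induction j)
    case 0
    then show ?case using Suc.prems(2) by simp
  next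
    case (Suc j)
    have "filterlim (\<lambda>y::int. y - 1) at_top at_top"
      unfolding filterlim_at_top by (auto intro!: eventually_at_top_linorderI[of "_ + 1"])
    then have "((\<lambda>y. (bdiff ^^ j) E (y - 1) - (bdiff ^^ j) E y) \<longlongrightarrow> 0 - 0) at_top"
      by (intro tendsto_diff Suc filterlim_compose[OF Suc])
    then show ?case by (simp only: bdiff_funpow_Suc[abs_def] diff_0_right)
  qed
  let ?F = "(bdiff ^^ k) E"
  have st: "?F (y - 1) = ?F y" for y using Suc.prems(1)[of y] by (simp only: bdiff_funpow_Suc right_minus_eq)
  have const: "?F (y + int j) = ?F y" for y j
  proof (induction j)
    case (Suc j)
    then show ?case using st[of "y + int (Suc j)"] by simp
  qed simp
  have "?F y = 0" for y
  proof -
    have "eventually (\<lambda>t. ?F t = ?F y) at_top"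
    proof (rule eventually_at_top_linorderI)
      fix t assume "y \<le> t"
      then show "?F t = ?F y" using const[of y "nat (t - y)"] by simp
    qed
    then have "(?F \<longlongrightarrow> ?F y) at_top" by (rule tendsto_eventually)
    with lim[of k] show ?thesis using tendsto_unique[of "at_top :: int filter"] by fastforce
  qed
  then show ?case using Suc.IH Suc.prems(2) by blast
qed simp

lemma bdiff_funpow_shift: "(bdiff ^^ k) (\<lambda>y. h (y - s)) y = (bdiff ^^ k) h (y - s)"
proof (induction k arbitrary: y)
  case (Suc k)
  have "y - 1 - s = y - s - 1" by simp
  then show ?case by (simp only: bdiff_funpow_Suc Suc.IH)
qed simp

lemma bdiff_funpow_infsum:
  fixes D :: "'a \<Rightarrow> int \<Rightarrow> complex"
  assumes "\<And>y. (\<lambda>x. g x * D x y) summable_on X"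
  shows "(bdiff ^^ k) (\<lambda>y. \<Sum>\<^sub>\<infinity>x\<in>X. g x * D x y) y = (\<Sum>\<^sub>\<infinity>x\<in>X. g x * (bdiff ^^ k) (D x) y)"
proof -
  have "(\<lambda>x. g x * (bdiff ^^ k) (D x) y) summable_on X \<and>
    (bdiff ^^ k) (\<lambda>y. \<Sum>\<^sub>\<infinity>x\<in>X. g x * D x y) y = (\<Sum>\<^sub>\<infinity>x\<in>X. g x * (bdiff ^^ k) (D x) y)"
  proof (induction k arbitrary: y)
    case 0
    then show ?case using assms by simp
  next
    case (Suc k)
    have eq: "g x * (bdiff ^^ Suc k) (D x) y = g x * (bdiff ^^ k) (D x) (y - 1) - g x * (bdiff ^^ k) (D x) y" for x
      by (simp only: bdiff_funpow_Suc right_diff_distrib)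
    have s: "(\<lambda>x. g x * (bdiff ^^ k) (D x) (y - 1)) summable_on X"
      "(\<lambda>x. - (g x * (bdiff ^^ k) (D x) y)) summable_on X"
      using Suc.IH[of y] Suc.IH[of "y - 1"] by (simp_all add: summable_on_uminus)
    have "(\<lambda>x. g x * (bdiff ^^ k) (D x) (y - 1) + - (g x * (bdiff ^^ k) (D x) y)) summable_on X"
      "(\<Sum>\<^sub>\<infinity>x\<in>X. g x * (bdiff ^^ k) (D x) (y - 1) + - (g x * (bdiff ^^ k) (D x) y)) =
        (\<Sum>\<^sub>\<infinity>x\<in>X. g x * (bdiff ^^ k) (D x) (y - 1)) + (\<Sum>\<^sub>\<infinity>x\<in>X. - (g x * (bdiff ^^ k) (D x) y))"
      by (rule summable_on_add[OF s], rule infsum_add[OF s])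
    then show ?case
      unfolding eq bdiff_funpow_Suc[of k "\<lambda>y. \<Sum>\<^sub>\<infinity>x\<in>X. g x * D x y"]
      using Suc.IH[of y] Suc.IH[of "y - 1"] by (simp add: infsum_uminus)
  qed
  then show ?thesis by blast
qed

lemma norm_infsum_le_infsum_norm:
  fixes f :: "'a \<Rightarrow> complex"
  assumes "(\<lambda>x. norm (f x)) summable_on X"
  shows "norm (infsum f X) \<le> (\<Sum>\<^sub>\<infinity>x\<in>X. norm (f x))"
  by (rule norm_infsum_bound) (use assms in simp)

section \<open>Powers of the transition operator and the Neumann series\<close>

context bethe_walk
begin

definition walk_prob :: "nat \<Rightarrow> int \<Rightarrow> int \<Rightarrow> real" where
  "walk_prob n x y = (\<rho> / (1 - \<rho>)) ^ n * (1 - \<rho>) powi (x - y) * real (free_paths n x y)"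

lemma walk_prob_measure:
  "walk_prob n x y = measure (walk_measure \<rho>) {\<omega> \<in> space (walk_measure \<rho>). walk x n \<omega> = y}"
  unfolding walk_prob_def by (rule walk_measure_free_paths[OF \<rho>0 \<rho>1, symmetric])

lemma walk_prob_nonneg: "0 \<le> walk_prob n x y"
  unfolding walk_prob_measure by simp

lemma walk_prob_eq_0: "x < y + int n \<Longrightarrow> walk_prob n x y = 0"
  by (simp add: walk_prob_def paths_eq_0)

lemma walk_prob_0: "walk_prob 0 x y = (if x = y then 1 else 0)"
  by (simp add: walk_prob_def)

lemma walk_prob_shift: "walk_prob n (x + s) (y + s) = walk_prob n x y"
  by (simp add: walk_prob_def free_paths_shift)

lemma walk_prob_sum_le:
  assumes "finite F"
  shows "(\<Sum>y\<in>F. walk_prob n x y) \<le> 1"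
proof -
  interpret W: prob_space "walk_measure \<rho>" by (rule prob_space_walk_measure)
  let ?E = "\<lambda>y. {\<omega> \<in> space (walk_measure \<rho>). walk x n \<omega> = y}"
  have "(\<Sum>y\<in>F. walk_prob n x y) = measure (walk_measure \<rho>) (\<Union>y\<in>F. ?E y)"
    unfolding walk_prob_measure
    by (rule W.finite_measure_finite_Union[symmetric])
       (use assms in \<open>auto simp: disjoint_family_on_def\<close>)
  then show ?thesis by simp
qed

lemma walk_prob_le_1: "walk_prob n x y \<le> 1"
  using walk_prob_sum_le[of "{y}"] by simp

lemma walk_prob_summable: "(\<lambda>y. walk_prob n x (y - s)) summable_on UNIV"
  and walk_prob_infsum_le: "(\<Sum>\<^sub>\<infinity>y. walk_prob n x (y - s)) \<le> 1"
proof -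
  have b: "sum (\<lambda>y. walk_prob n x (y - s)) F \<le> 1" if "finite F" for F
  proof -
    have "sum (\<lambda>y. walk_prob n x (y - s)) F = sum (walk_prob n x) ((\<lambda>y. y - s) ` F)"
      by (subst sum.reindex) (auto simp: inj_on_def)
    then show ?thesis using walk_prob_sum_le[of "(\<lambda>y. y - s) ` F"] that by simp
  qed
  show s: "(\<lambda>y. walk_prob n x (y - s)) summable_on UNIV"
    by (rule nonneg_bdd_above_summable_on) (auto simp: walk_prob_nonneg intro!: bdd_aboveI[of _ 1] b)
  show "(\<Sum>\<^sub>\<infinity>y. walk_prob n x (y - s)) \<le> 1"
    by (rule infsum_le_finite_sums[OF s]) (use b in auto)
qed

lemma walk_prob_add:
  "walk_prob (m + n) x y = (\<Sum>t\<in>{y..x}. walk_prob m x t * walk_prob n t y)"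
proof -
  have "walk_prob (m + n) x y = (\<Sum>t\<in>{y..x}. (\<rho> / (1 - \<rho>)) ^ (m + n) * (1 - \<rho>) powi (x - y) * (real (free_paths m x t) * real (free_paths n t y)))"
    unfolding walk_prob_def free_paths_add by (simp add: sum_distrib_left)
  also have "\<dots> = (\<Sum>t\<in>{y..x}. walk_prob m x t * walk_prob n t y)"
  proof (intro sum.cong refl)
    fix t
    have "(1 - \<rho>) powi (x - y) = (1 - \<rho>) powi (x - t) * (1 - \<rho>) powi (t - y)"
      using \<rho>1 by (simp add: power_int_add[symmetric])
    then show "(\<rho> / (1 - \<rho>)) ^ (m + n) * (1 - \<rho>) powi (x - y) * (real (free_paths m x t) * real (free_paths n t y))
      = walk_prob m x t * walk_prob n t y"
      by (simp only: walk_prob_def power_add mult_ac)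
  qed
  finally show ?thesis .
qed

lemma walk_prob_add_infsum:
  "(\<Sum>\<^sub>\<infinity>t. complex_of_real (walk_prob m x (t - s)) * of_real (walk_prob n (t - s) y)) = of_real (walk_prob (m + n) x y)"
proof -
  have "(\<Sum>\<^sub>\<infinity>t. complex_of_real (walk_prob m x (t - s)) * of_real (walk_prob n (t - s) y))
    = (\<Sum>\<^sub>\<infinity>t\<in>{y + s..x + s}. complex_of_real (walk_prob m x (t - s)) * of_real (walk_prob n (t - s) y))"
    by (rule infsum_cong_neutral) (auto simp: walk_prob_eq_0)
  also have "\<dots> = (\<Sum>t\<in>{y..x}. complex_of_real (walk_prob m x t) * of_real (walk_prob n t y))"
    by (simp, rule sum.reindex_bij_witness[where i = "\<lambda>t. t + s" and j = "\<lambda>t. t - s"]) auto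
  finally show ?thesis by (simp add: walk_prob_add)
qed

text \<open>The k-th power of the shifted N-step transition operator, that is of \<open>B\<close>
  without its factor \<zeta>, applied to the column \<open>\<phi>\<close>.\<close>

definition evolve :: "nat \<Rightarrow> (int \<Rightarrow> complex) \<Rightarrow> int \<Rightarrow> complex" where
  "evolve k \<phi> x = (\<Sum>\<^sub>\<infinity>t. of_real (walk_prob (k * N) x (t - int k * int L)) * \<phi> t)"

lemma walk_prob_mult_summable:
  assumes "\<And>t. cmod (\<phi> t) \<le> 1"
  shows "(\<lambda>t. norm (of_real (walk_prob n x (t - s)) * \<phi> t)) summable_on UNIV"
    and "(\<Sum>\<^sub>\<infinity>t. norm (of_real (walk_prob n x (t - s)) * \<phi> t)) \<le> 1"
proof -
  have le: "norm (of_real (walk_prob n x (t - s)) * \<phi> t) \<le> walk_prob n x (t - s)" for t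
    using mult_left_mono[OF assms[of t] walk_prob_nonneg[of n x "t - s"]]
    by (simp add: norm_mult walk_prob_nonneg)
  show s: "(\<lambda>t. norm (of_real (walk_prob n x (t - s)) * \<phi> t)) summable_on UNIV"
    by (rule summable_on_comparison_test[OF walk_prob_summable]) (use le in auto)
  have "(\<Sum>\<^sub>\<infinity>t. norm (of_real (walk_prob n x (t - s)) * \<phi> t)) \<le> (\<Sum>\<^sub>\<infinity>t. walk_prob n x (t - s))"
    by (rule infsum_mono[OF s walk_prob_summable]) (rule le)
  also have "\<dots> \<le> 1" by (rule walk_prob_infsum_le)
  finally show "(\<Sum>\<^sub>\<infinity>t. norm (of_real (walk_prob n x (t - s)) * \<phi> t)) \<le> 1" .
qed

lemma evolve_le_1:
  assumes "\<And>t. cmod (\<phi> t) \<le> 1"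
  shows "cmod (evolve k \<phi> x) \<le> 1"
  unfolding evolve_def
  using norm_infsum_le_infsum_norm[OF walk_prob_mult_summable(1)[OF assms]]
    walk_prob_mult_summable(2)[OF assms] by (rule order_trans)

lemma evolve_0: "evolve 0 \<phi> x = \<phi> x"
proof -
  have "evolve 0 \<phi> x = (\<Sum>\<^sub>\<infinity>t\<in>{x}. of_real (walk_prob 0 x t) * \<phi> t)"
    unfolding evolve_def by (rule infsum_cong_neutral) (auto simp: walk_prob_0)
  then show ?thesis by (simp add: walk_prob_0)
qed

lemma evolve_Suc:
  assumes \<phi>: "\<And>t. cmod (\<phi> t) \<le> 1"
  shows "evolve (Suc k) \<phi> x = (\<Sum>\<^sub>\<infinity>t. of_real (walk_prob N x (t - int L)) * evolve k \<phi> t)"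
proof -
  define A where "A = (\<lambda>t s. complex_of_real (walk_prob N x (t - int L)) * (of_real (walk_prob (k * N) t (s - int k * int L)) * \<phi> s))"
  have nA: "norm (A t s) = walk_prob N x (t - int L) * norm (of_real (walk_prob (k * N) t (s - int k * int L)) * \<phi> s)" for t s
    unfolding A_def by (simp add: norm_mult walk_prob_nonneg)
  have "(\<Sum>\<^sub>\<infinity>t. of_real (walk_prob N x (t - int L)) * evolve k \<phi> t) = (\<Sum>\<^sub>\<infinity>t. \<Sum>\<^sub>\<infinity>s. A t s)"
    unfolding evolve_def A_def by (simp add: infsum_cmult_right')
  also have "\<dots> = (\<Sum>\<^sub>\<infinity>s. \<Sum>\<^sub>\<infinity>t. A t s)"
  proof (rule infsum_swap_dominated(1)[OF _ _ walk_prob_summable])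
    show "(\<lambda>s. norm (A t s)) summable_on UNIV" for t
      unfolding nA by (intro summable_on_cmult_right walk_prob_mult_summable \<phi>)
    show "(\<Sum>\<^sub>\<infinity>s. norm (A t s)) \<le> walk_prob N x (t - int L)" for t
      unfolding nA infsum_cmult_right'
      using mult_left_mono[OF walk_prob_mult_summable(2)[OF \<phi>] walk_prob_nonneg] by simp
  qed
  also have "\<dots> = (\<Sum>\<^sub>\<infinity>s. of_real (walk_prob (Suc k * N) x (s - int (Suc k) * int L)) * \<phi> s)"
  proof (rule infsum_cong)
    fix s
    have sh: "walk_prob (k * N) t (s - int k * int L) = walk_prob (k * N) (t - int L) (s - int (Suc k) * int L)" for t
      using walk_prob_shift[of "k * N" "t - int L" "int L" "s - int (Suc k) * int L"] by (simp add: algebra_simps)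
    have "(\<Sum>\<^sub>\<infinity>t. A t s) = (\<Sum>\<^sub>\<infinity>t. complex_of_real (walk_prob N x (t - int L)) * of_real (walk_prob (k * N) (t - int L) (s - int (Suc k) * int L))) * \<phi> s"
      unfolding A_def sh by (simp add: infsum_cmult_left'[symmetric] mult.assoc)
    then show "(\<Sum>\<^sub>\<infinity>t. A t s) = of_real (walk_prob (Suc k * N) x (s - int (Suc k) * int L)) * \<phi> s"
      unfolding walk_prob_add_infsum by simp
  qed
  finally show ?thesis unfolding evolve_def ..
qed

lemma \<zeta>_power_summable: "(\<lambda>k. cmod \<zeta> ^ k) summable_on A"
proof -
  have "(\<lambda>k. cmod \<zeta> ^ k) summable_on UNIV"
    by (rule summable_nonneg_imp_summable_on) (use cmod_\<zeta> in \<open>auto intro: summable_geometric\<close>)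
  then show ?thesis by (rule summable_on_subset_banach) simp
qed

lemma infsum_telescope:
  fixes f :: "nat \<Rightarrow> complex"
  assumes f: "f summable_on UNIV"
  shows "(\<Sum>\<^sub>\<infinity>k. f k - f (Suc k)) = f 0"
proof -
  have b: "bij_betw Suc UNIV {1..}" by (rule bij_betwI[of _ _ _ "\<lambda>k. k - 1"]) auto
  have s1: "f summable_on {1..}" using f by (rule summable_on_subset_banach) simp
  have s2: "(\<lambda>k. f (Suc k)) summable_on UNIV"
    using s1 unfolding summable_on_reindex_bij_betw[OF b, of f, symmetric] .
  have "infsum f UNIV = infsum f ({0} \<union> {1..})" by (rule arg_cong[where f = "infsum f"]) auto
  also have "\<dots> = f 0 + infsum f {1..}" by (subst infsum_Un_disjoint) (use s1 in auto)
  also have "infsum f {1..} = (\<Sum>\<^sub>\<infinity>k. f (Suc k))" by (rule infsum_reindex_bij_betw[OF b, symmetric])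
  finally have "f 0 = infsum f UNIV + (\<Sum>\<^sub>\<infinity>k. - f (Suc k))" by (simp add: infsum_uminus)
  also have "\<dots> = (\<Sum>\<^sub>\<infinity>k. f k + - f (Suc k))"
    by (rule infsum_add[symmetric]) (use f s2 in \<open>auto simp: summable_on_uminus\<close>)
  finally show ?thesis by simp
qed

definition resolvent :: "(int \<Rightarrow> complex) \<Rightarrow> int \<Rightarrow> complex" where
  "resolvent \<phi> x = (\<Sum>\<^sub>\<infinity>k. \<zeta> ^ k * evolve k \<phi> x)"

text \<open>If \<open>b = g (I - B)\<close> for the row vectors \<open>b\<close>, \<open>g\<close>, then \<open>b (I - B)\<^sup>-\<^sup>1 \<phi> = g \<phi>\<close>, by telescoping the
  Neumann series.\<close>

lemma resolvent_pairing:
  assumes \<phi>: "\<And>t. cmod (\<phi> t) \<le> 1"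
    and g: "(\<lambda>x. norm (g x)) summable_on UNIV" and b: "(\<lambda>x. norm (b x)) summable_on UNIV"
    and eq: "\<And>x. b x = g x - \<zeta> * (\<Sum>\<^sub>\<infinity>t. g t * of_real (walk_prob N t (x - int L)))"
  shows "(\<Sum>\<^sub>\<infinity>x. b x * resolvent \<phi> x) = (\<Sum>\<^sub>\<infinity>x. g x * \<phi> x)"
proof -
  define A where "A = (\<lambda>k. \<Sum>\<^sub>\<infinity>x. g x * evolve k \<phi> x)"
  have ev: "cmod (evolve k \<phi> x) \<le> 1" for k x by (rule evolve_le_1[OF \<phi>])
  have dom: "norm (g x * evolve k \<phi> x) \<le> norm (g x)" for k x
    using mult_left_mono[OF ev, of "norm (g x)" k x] by (simp add: norm_mult)
  have gs: "(\<lambda>x. norm (g x * evolve k \<phi> x)) summable_on UNIV" for k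
    by (rule summable_on_comparison_test[OF g]) (use dom in auto)
  have A_le: "norm (A k) \<le> infsum (\<lambda>x. norm (g x)) UNIV" for k
    unfolding A_def
    by (rule order_trans[OF norm_infsum_le_infsum_norm[OF gs]]) (rule infsum_mono[OF gs g dom])
  have step: "(\<Sum>\<^sub>\<infinity>x. b x * evolve k \<phi> x) = A k - \<zeta> * A (Suc k)" for k
  proof -
    define M where "M = (\<lambda>t x. g t * (of_real (walk_prob N t (x - int L)) * evolve k \<phi> x))"
    have nM: "norm (M t x) = norm (g t) * norm (of_real (walk_prob N t (x - int L)) * evolve k \<phi> x)" for t x
      unfolding M_def by (rule norm_mult)
    have M1: "(\<lambda>x. norm (M t x)) summable_on UNIV" for t
      unfolding nM by (intro summable_on_cmult_right walk_prob_mult_summable ev)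
    have M2: "(\<Sum>\<^sub>\<infinity>x. norm (M t x)) \<le> norm (g t)" for t
      unfolding nM infsum_cmult_right'
      using mult_left_mono[OF walk_prob_mult_summable(2)[OF ev]] by fastforce
    have inner: "(\<Sum>\<^sub>\<infinity>t. M t x) = (\<Sum>\<^sub>\<infinity>t. g t * of_real (walk_prob N t (x - int L))) * evolve k \<phi> x" for x
      unfolding M_def by (simp add: infsum_cmult_left'[symmetric] mult.assoc)
    have "(\<Sum>\<^sub>\<infinity>x. \<Sum>\<^sub>\<infinity>t. M t x) = (\<Sum>\<^sub>\<infinity>t. \<Sum>\<^sub>\<infinity>x. M t x)"
      by (rule infsum_swap_dominated(1)[OF M1 M2 g, symmetric])
    also have "\<dots> = (\<Sum>\<^sub>\<infinity>t. g t * evolve (Suc k) \<phi> t)"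
      unfolding M_def evolve_Suc[OF \<phi>] by (simp add: infsum_cmult_right')
    finally have m: "(\<Sum>\<^sub>\<infinity>x. \<Sum>\<^sub>\<infinity>t. M t x) = A (Suc k)" unfolding A_def .
    have ms: "(\<lambda>x. - \<zeta> * (\<Sum>\<^sub>\<infinity>t. M t x)) summable_on UNIV"
      by (intro summable_on_cmult_right infsum_swap_dominated(3)[OF M1 M2 g])
    have "(\<Sum>\<^sub>\<infinity>x. b x * evolve k \<phi> x) = (\<Sum>\<^sub>\<infinity>x. g x * evolve k \<phi> x + - \<zeta> * (\<Sum>\<^sub>\<infinity>t. M t x))"
      unfolding inner eq by (simp add: algebra_simps)
    also have "\<dots> = A k + (\<Sum>\<^sub>\<infinity>x. - \<zeta> * (\<Sum>\<^sub>\<infinity>t. M t x))"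
      unfolding A_def by (rule infsum_add[OF Infinite_Sum.abs_summable_summable[OF gs] ms])
    also have "(\<Sum>\<^sub>\<infinity>x. - \<zeta> * (\<Sum>\<^sub>\<infinity>t. M t x)) = - \<zeta> * A (Suc k)"
      by (simp only: infsum_cmult_right' m)
    finally show ?thesis by simp
  qed
  define Q where "Q = (\<lambda>x k. b x * (\<zeta> ^ k * evolve k \<phi> x))"
  have Q_le: "norm (Q x k) \<le> norm (b x) * cmod \<zeta> ^ k" for x k
  proof -
    have "norm (Q x k) = (norm (b x) * cmod \<zeta> ^ k) * cmod (evolve k \<phi> x)"
      unfolding Q_def by (simp add: norm_mult norm_power)
    also have "\<dots> \<le> (norm (b x) * cmod \<zeta> ^ k) * 1"
      by (intro mult_left_mono ev) auto
    finally show ?thesis by simp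
  qed
  have Q1: "(\<lambda>k. norm (Q x k)) summable_on UNIV" for x
    by (rule summable_on_comparison_test[OF summable_on_cmult_right[OF \<zeta>_power_summable]]) (use Q_le in auto)
  have Q2: "(\<Sum>\<^sub>\<infinity>k. norm (Q x k)) \<le> norm (b x) * (\<Sum>\<^sub>\<infinity>k. cmod \<zeta> ^ k)" for x
    unfolding infsum_cmult_right'[symmetric]
    by (rule infsum_mono[OF Q1 summable_on_cmult_right[OF \<zeta>_power_summable] Q_le])
  have "(\<Sum>\<^sub>\<infinity>x. b x * resolvent \<phi> x) = (\<Sum>\<^sub>\<infinity>x. \<Sum>\<^sub>\<infinity>k. Q x k)"
    unfolding resolvent_def Q_def by (simp add: infsum_cmult_right')
  also have "\<dots> = (\<Sum>\<^sub>\<infinity>k. \<Sum>\<^sub>\<infinity>x. Q x k)"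
    by (rule infsum_swap_dominated(1)[OF Q1 Q2 summable_on_cmult_left[OF b]])
  also have "\<dots> = (\<Sum>\<^sub>\<infinity>k. \<zeta> ^ k * A k - \<zeta> ^ Suc k * A (Suc k))"
  proof (rule infsum_cong)
    fix k
    have "(\<Sum>\<^sub>\<infinity>x. Q x k) = \<zeta> ^ k * (\<Sum>\<^sub>\<infinity>x. b x * evolve k \<phi> x)"
      unfolding Q_def infsum_cmult_right'[symmetric] by (simp add: mult_ac)
    then show "(\<Sum>\<^sub>\<infinity>x. Q x k) = \<zeta> ^ k * A k - \<zeta> ^ Suc k * A (Suc k)"
      unfolding step by (simp add: algebra_simps)
  qed
  also have "\<dots> = \<zeta> ^ 0 * A 0"
  proof (rule infsum_telescope)
    have "(\<lambda>k. norm (\<zeta> ^ k * A k)) summable_on UNIV"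
      by (rule summable_on_comparison_test[OF summable_on_cmult_left[OF \<zeta>_power_summable, where c = "infsum (\<lambda>x. norm (g x)) UNIV"]])
         (auto simp: norm_mult norm_power intro!: mult_left_mono A_le)
    then show "(\<lambda>k. \<zeta> ^ k * A k) summable_on UNIV" by (rule Infinite_Sum.abs_summable_summable)
  qed
  finally show ?thesis by (simp add: A_def evolve_0)
qed

end

section \<open>Closed form of the resolvent rows\<close>

lemma tendsto_powi_zero:
  fixes a :: real
  assumes "0 < a" "a < 1"
  shows "((\<lambda>y::int. a powi y) \<longlongrightarrow> 0) at_top"
proof -
  have "filterlim nat sequentially at_top"
    unfolding filterlim_at_top
  proof
    fix Z
    show "eventually (\<lambda>x. Z \<le> nat x) at_top" by (rule eventually_at_top_linorderI[of "int Z"]) auto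
  qed
  moreover have "(\<lambda>n. a ^ n) \<longlonglongrightarrow> 0" using assms by (intro LIMSEQ_realpow_zero) auto
  ultimately have "((\<lambda>y. a ^ nat y) \<longlongrightarrow> 0) at_top" by (rule filterlim_compose[rotated])
  then show ?thesis
    by (rule Lim_transform_eventually)
       (auto intro!: eventually_at_top_linorderI[of 0] simp: power_int_def)
qed

context bethe_walk
begin

text \<open>By \<open>green_row_equation\<close> below this is \<open>basis_row c\<close> times
  \<open>(I - B)\<^sup>-\<^sup>1\<close>, and by \<open>basis_row_eq\<close> the row
  \<open>basis_row c\<close> is a multiple of row c of \<open>Q\<^sup>N\<close>.\<close>

definition green_row :: "int \<Rightarrow> int \<Rightarrow> complex" where
  "green_row c x = of_real (1 - \<rho>) powi (- x) * green (c - x)"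

definition basis_row :: "int \<Rightarrow> int \<Rightarrow> complex" where
  "basis_row c x = of_real (1 - \<rho>) powi (- x) * of_nat (free_paths N c x)"

lemma a_nonzero: "complex_of_real (1 - \<rho>) \<noteq> 0" "1 - \<rho> \<noteq> 0" "0 < 1 - \<rho>" "1 - \<rho> < 1"
  using \<rho>0 \<rho>1 by auto

lemma cmod_divide_a: "cmod (w / of_real (1 - \<rho>)) = cmod w / (1 - \<rho>)"
  using a_nonzero by (simp only: norm_divide norm_of_real)

lemma root_fun_scaled:
  assumes "A \<subseteq> bethe_roots"
  shows "of_real (1 - \<rho>) powi (- x) * root_fun A (c - x) =
    (\<Sum>w\<in>A. ((- 1) ^ N * (1 / dq w) * (w + 1) powi (int L - 1 - c)) * ((w + 1) / of_real (1 - \<rho>)) powi x)"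
  unfolding root_fun_def sum_distrib_left
proof (intro sum.cong refl)
  fix w assume "w \<in> A"
  then have "w + 1 \<noteq> 0" using assms bethe_rootsD(3) by blast
  then have "(w + 1) powi (int L - 1 - (c - x)) = (w + 1) powi (int L - 1 - c) * (w + 1) powi x"
    by (simp add: power_int_add[symmetric] algebra_simps)
  then show "of_real (1 - \<rho>) powi (- x) * ((- 1) ^ N * (1 / dq w * (w + 1) powi (int L - 1 - (c - x)))) =
    (- 1) ^ N * (1 / dq w) * (w + 1) powi (int L - 1 - c) * ((w + 1) / of_real (1 - \<rho>)) powi x"
    by (simp add: power_int_minus power_int_divide_distrib field_simps)
qed

lemma root_fun_scaled_summable:
  assumes A: "A \<subseteq> bethe_roots"
    and s: "\<And>w. w \<in> A \<Longrightarrow> (\<lambda>x. cmod (((w + 1) / of_real (1 - \<rho>)) powi x)) summable_on X"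
  shows "(\<lambda>x. cmod (of_real (1 - \<rho>) powi (- x) * root_fun A (c - x))) summable_on X"
proof (rule summable_on_comparison_test)
  show "(\<lambda>x. \<Sum>w\<in>A. cmod ((- 1) ^ N * (1 / dq w) * (w + 1) powi (int L - 1 - c)) * cmod (((w + 1) / of_real (1 - \<rho>)) powi x)) summable_on X"
    by (intro summable_on_finite_sum summable_on_cmult_right s)
  show "cmod (of_real (1 - \<rho>) powi (- x) * root_fun A (c - x)) \<le>
    (\<Sum>w\<in>A. cmod ((- 1) ^ N * (1 / dq w) * (w + 1) powi (int L - 1 - c)) * cmod (((w + 1) / of_real (1 - \<rho>)) powi x))" for x
    unfolding root_fun_scaled[OF A] norm_mult[symmetric] by (rule norm_sum)
qed simp

text \<open>For x < c the row is a combination of powers of (v + 1) / (1 - \<rho>) over right roots,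
  of modulus greater than 1; for x \<ge> c the same over left roots, of modulus less than 1. So it
  decays geometrically in both directions.\<close>

lemma green_row_summable: "(\<lambda>x. norm (green_row c x)) summable_on UNIV"
proof -
  have sub: "lefts \<subseteq> bethe_roots" "rights \<subseteq> bethe_roots" using roots_partition by auto
  have "(\<lambda>x. norm (green_row c x)) summable_on {..c - 1}"
  proof -
    have "(\<lambda>x. cmod (of_real (1 - \<rho>) powi (- x) * root_fun rights (c - x))) summable_on {..c - 1}"
    proof (rule root_fun_scaled_summable[OF sub(2)])
      fix w assume "w \<in> rights"
      then have "1 < cmod ((w + 1) / of_real (1 - \<rho>))"
        using right_root_greater[of w] \<rho>1 unfolding cmod_divide_a by simp
      then show "(\<lambda>x. cmod (((w + 1) / of_real (1 - \<rho>)) powi x)) summable_on {..c - 1}"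
        by (rule summable_on_powi_atMost)
    qed
    also have "?this \<longleftrightarrow> ?thesis"
      by (rule summable_on_cong) (simp add: green_row_def green_right norm_mult)
    finally show ?thesis .
  qed
  moreover have "(\<lambda>x. norm (green_row c x)) summable_on {c..}"
  proof -
    have "(\<lambda>x. cmod (of_real (1 - \<rho>) powi (- x) * root_fun lefts (c - x))) summable_on {c..}"
    proof (rule root_fun_scaled_summable[OF sub(1)])
      fix w assume w: "w \<in> lefts"
      then have "cmod ((w + 1) / of_real (1 - \<rho>)) < 1" "(w + 1) / of_real (1 - \<rho>) \<noteq> 0"
        using left_root_less[of w] a_nonzero bethe_rootsD(3)[of w] sub(1) unfolding cmod_divide_a by auto
      then show "(\<lambda>x. cmod (((w + 1) / of_real (1 - \<rho>)) powi x)) summable_on {c..}"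
        by (intro summable_on_powi_atLeast)
    qed
    also have "?this \<longleftrightarrow> ?thesis"
      by (rule summable_on_cong) (use NL in \<open>simp add: green_row_def green_left norm_mult\<close>)
    finally show ?thesis .
  qed
  ultimately have "(\<lambda>x. norm (green_row c x)) summable_on {..c - 1} \<union> {c..}"
    by (rule summable_on_union)
  moreover have "{..c - 1} \<union> {c..} = UNIV" by auto
  ultimately show ?thesis by simp
qed

lemma basis_row_eq: "basis_row c x = of_real (inverse ((\<rho> / (1 - \<rho>)) ^ N) * (1 - \<rho>) powi (- c) * walk_prob N c x)"
proof -
  have "(1 - \<rho>) powi (- x) = (1 - \<rho>) powi (- c) * (1 - \<rho>) powi (c - x)"
    using a_nonzero by (simp add: power_int_add[symmetric])
  then have "(1 - \<rho>) powi (- x) * real (free_paths N c x) = inverse ((\<rho> / (1 - \<rho>)) ^ N) * (1 - \<rho>) powi (- c) * walk_prob N c x"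
    unfolding walk_prob_def using \<rho>0 \<rho>1 by (simp add: field_simps)
  then have "complex_of_real ((1 - \<rho>) powi (- x) * real (free_paths N c x)) =
    of_real (inverse ((\<rho> / (1 - \<rho>)) ^ N) * (1 - \<rho>) powi (- c) * walk_prob N c x)"
    by (rule arg_cong)
  then show ?thesis unfolding basis_row_def by (simp only: of_real_mult of_real_of_nat_eq of_real_power_int)
qed

lemma basis_row_summable: "(\<lambda>x. norm (basis_row c x)) summable_on UNIV"
proof -
  have "(\<lambda>x. norm (inverse ((\<rho> / (1 - \<rho>)) ^ N) * (1 - \<rho>) powi (- c)) * walk_prob N c x) summable_on UNIV"
    using walk_prob_summable[of N c 0] by (intro summable_on_cmult_right) simp
  then show ?thesis
    unfolding basis_row_eq norm_of_real abs_mult real_norm_def by (simp add: walk_prob_nonneg)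
qed

lemma basis_row_eq_0: "c < x + int N \<Longrightarrow> basis_row c x = 0"
  by (simp add: basis_row_def paths_eq_0)

lemma \<zeta>_epsz: "\<zeta> * of_real ((\<rho> / (1 - \<rho>)) ^ N * (1 - \<rho>) ^ L) = epsz"
proof -
  define X where "X = \<rho> ^ N * (1 - \<rho>) ^ (L - N)"
  have X: "complex_of_real X \<noteq> 0" using \<rho>0 \<rho>1 by (simp add: X_def)
  have "(\<rho> / (1 - \<rho>)) ^ N * (1 - \<rho>) ^ L = X"
    using \<rho>1 NL by (simp add: X_def power_divide power_diff)
  moreover have "(- \<rho>) ^ N * (1 - \<rho>) ^ (L - N) = (- 1) ^ N * X"
    unfolding X_def power_minus[of \<rho>] by (rule mult.assoc)
  then have "\<zeta> = z ^ L / ((- 1) ^ N * of_real X)"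
    unfolding \<zeta>_eq by simp
  ultimately show ?thesis
    using X by (cases "even N") (simp_all add: epsz_def)
qed

lemma green_mult_paths:
  "green (c - x) * of_nat (free_paths n x y) =
    of_real (inverse ((\<rho> / (1 - \<rho>)) ^ n) * (1 - \<rho>) powi y) * (green_row c x * of_real (walk_prob n x y))"
proof -
  have "inverse ((\<rho> / (1 - \<rho>)) ^ n) * (1 - \<rho>) powi y * (1 - \<rho>) powi (- x) * ((\<rho> / (1 - \<rho>)) ^ n * (1 - \<rho>) powi (x - y)) = 1"
    using \<rho>0 \<rho>1 by (simp add: power_int_diff power_int_minus field_simps)
  then have "complex_of_real (inverse ((\<rho> / (1 - \<rho>)) ^ n) * (1 - \<rho>) powi y * (1 - \<rho>) powi (- x) * ((\<rho> / (1 - \<rho>)) ^ n * (1 - \<rho>) powi (x - y))) = 1"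
    by (simp only: of_real_1)
  then have "green (c - x) * of_nat (free_paths n x y) =
    complex_of_real (inverse ((\<rho> / (1 - \<rho>)) ^ n) * (1 - \<rho>) powi y * (1 - \<rho>) powi (- x) * ((\<rho> / (1 - \<rho>)) ^ n * (1 - \<rho>) powi (x - y)))
     * (green (c - x) * of_nat (free_paths n x y))"
    by (simp only: mult_1)
  also have "\<dots> = of_real (inverse ((\<rho> / (1 - \<rho>)) ^ n) * (1 - \<rho>) powi y) * (green_row c x * of_real (walk_prob n x y))"
    unfolding green_row_def walk_prob_def of_real_mult of_real_power_int of_real_of_nat_eq by (simp only: mult_ac)
  finally show ?thesis .
qed

lemma green_row_prob_summable: "(\<lambda>x. norm (green_row c x * of_real (walk_prob n x y))) summable_on UNIV"
  by (rule summable_on_comparison_test[OF green_row_summable])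
     (auto simp: norm_mult walk_prob_nonneg intro: mult_left_le[OF walk_prob_le_1])

lemma green_paths_summable: "(\<lambda>x. green (c - x) * of_nat (free_paths n x y)) summable_on UNIV"
  unfolding green_mult_paths
  by (intro summable_on_cmult_right Infinite_Sum.abs_summable_summable[OF green_row_prob_summable])

text \<open>By \<open>green_recurrence\<close> the N-th differences of the two sides in
  \<open>y\<close> agree. Both sides decay like (1 - \<rho>)^y as y grows, so their difference
  \<open>E\<close> vanishes by \<open>bdiff_zero_imp_zero\<close>.\<close>

lemma green_paths_equation:
  "epsz * (\<Sum>\<^sub>\<infinity>x. green (c - x) * of_nat (free_paths N x (y - int L))) = green (c - y) - of_nat (free_paths N c y)"
proof -
  define R where "R = (\<lambda>y. \<Sum>\<^sub>\<infinity>x. green (c - x) * of_nat (free_paths N x y))"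
  define E where "E = (\<lambda>y. - epsz * R (y - int L) + ((- 1) * of_nat (free_paths N c y) + green (c - y)))"
  have RN: "(bdiff ^^ N) R y = green (c - y)" for y
  proof -
    have "(bdiff ^^ N) R y = (\<Sum>\<^sub>\<infinity>x. green (c - x) * (bdiff ^^ N) (\<lambda>y. of_nat (free_paths N x y)) y)"
      unfolding R_def by (rule bdiff_funpow_infsum) (rule green_paths_summable)
    also have "\<dots> = (\<Sum>\<^sub>\<infinity>x. green (c - x) * of_nat (free_paths 0 x y))"
      by (simp only: bdiff_free_paths[OF order_refl] diff_self_eq_0)
    also have "\<dots> = (\<Sum>\<^sub>\<infinity>x\<in>{y}. green (c - x) * of_nat (free_paths 0 x y))"
      by (rule infsum_cong_neutral) auto
    finally show ?thesis by simp
  qed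
  have E0: "(bdiff ^^ N) E y = 0" for y
  proof -
    have "(bdiff ^^ N) E y = - epsz * (bdiff ^^ N) (\<lambda>y. R (y - int L)) y +
      ((- 1) * (bdiff ^^ N) (\<lambda>y. of_nat (free_paths N c y)) y + (bdiff ^^ N) (\<lambda>y. green (c - y)) y)"
      unfolding E_def bdiff_funpow_lincomb ..
    also have "\<dots> = 0"
      unfolding bdiff_funpow_shift RN bdiff_free_paths[OF order_refl] green_recurrence by simp
    finally show ?thesis .
  qed
  define B where "B = (\<Sum>\<^sub>\<infinity>x. norm (green_row c x))"
  define q where "q = inverse ((\<rho> / (1 - \<rho>)) ^ N)"
  have q: "0 < q" using \<rho>0 \<rho>1 by (simp add: q_def)
  have gB: "norm (green_row c y) \<le> B" for y
  proof -
    have "(\<Sum>\<^sub>\<infinity>x\<in>{y}. norm (green_row c x)) \<le> B"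
      unfolding B_def by (rule infsum_mono2) (auto intro: green_row_summable)
    then show ?thesis by simp
  qed
  have R_le: "norm (R y) \<le> q * (1 - \<rho>) powi y * B" for y
  proof -
    have "R y = of_real (q * (1 - \<rho>) powi y) * (\<Sum>\<^sub>\<infinity>x. green_row c x * of_real (walk_prob N x y))"
      unfolding R_def green_mult_paths q_def by (rule infsum_cmult_right')
    moreover have "norm (\<Sum>\<^sub>\<infinity>x. green_row c x * of_real (walk_prob N x y)) \<le> B"
      unfolding B_def
      by (rule order_trans[OF norm_infsum_le_infsum_norm[OF green_row_prob_summable]], rule infsum_mono[OF green_row_prob_summable green_row_summable])
         (auto simp: norm_mult walk_prob_nonneg intro: mult_left_le[OF walk_prob_le_1])
    moreover have "0 \<le> q * (1 - \<rho>) powi y" using q a_nonzero by simp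
    ultimately show ?thesis by (simp only: norm_mult norm_of_real abs_of_nonneg mult_left_mono)
  qed
  have lim: "(E \<longlongrightarrow> 0) at_top"
  proof (rule Lim_null_comparison)
    show "((\<lambda>y. (cmod epsz * (q * (1 - \<rho>) powi (- int L) * B) + B) * (1 - \<rho>) powi y) \<longlongrightarrow> 0) at_top"
      by (rule tendsto_mult_right_zero[OF tendsto_powi_zero]) (use a_nonzero in auto)
    show "eventually (\<lambda>y. norm (E y) \<le> (cmod epsz * (q * (1 - \<rho>) powi (- int L) * B) + B) * (1 - \<rho>) powi y) at_top"
    proof (rule eventually_at_top_linorderI[of c])
      fix y assume "c \<le> y"
      then have "free_paths N c y = 0" using N0 by (intro paths_eq_0) auto
      then have "norm (E y) \<le> cmod epsz * norm (R (y - int L)) + norm (green (c - y))"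
        unfolding E_def using norm_triangle_ineq[of "- epsz * R (y - int L)" "green (c - y)"] by (simp add: norm_mult)
      also have "\<dots> \<le> cmod epsz * (q * (1 - \<rho>) powi (y - int L) * B) + B * (1 - \<rho>) powi y"
      proof (intro add_mono mult_left_mono R_le)
        have "green (c - y) = green_row c y * of_real ((1 - \<rho>) powi y)"
          unfolding green_row_def using a_nonzero by (simp add: power_int_minus)
        then have "norm (green (c - y)) = norm (green_row c y) * (1 - \<rho>) powi y"
          using a_nonzero by (simp only: norm_mult norm_of_real) simp
        then show "norm (green (c - y)) \<le> B * (1 - \<rho>) powi y"
          using gB[of y] a_nonzero by (simp add: mult_right_mono)
      qed simp
      also have "\<dots> = (cmod epsz * (q * (1 - \<rho>) powi (- int L) * B) + B) * (1 - \<rho>) powi y"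
        using a_nonzero by (simp add: power_int_diff power_int_minus field_simps)
      finally show "norm (E y) \<le> (cmod epsz * (q * (1 - \<rho>) powi (- int L) * B) + B) * (1 - \<rho>) powi y" .
    qed
  qed
  have "E y = 0" by (rule bdiff_zero_imp_zero[OF E0 lim])
  then show ?thesis unfolding E_def R_def by (simp add: algebra_simps)
qed

lemma green_row_equation:
  "basis_row c y = green_row c y - \<zeta> * (\<Sum>\<^sub>\<infinity>t. green_row c t * of_real (walk_prob N t (y - int L)))"
proof -
  let ?C = "(\<rho> / (1 - \<rho>)) ^ N"
  have "complex_of_real (inverse ?C * (1 - \<rho>) powi (y - int L)) *
      (\<Sum>\<^sub>\<infinity>t. green_row c t * of_real (walk_prob N t (y - int L))) =
    (\<Sum>\<^sub>\<infinity>x. green (c - x) * of_nat (free_paths N x (y - int L)))"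
    unfolding green_mult_paths by (rule infsum_cmult_right'[symmetric])
  then have 1: "epsz * (of_real (inverse ?C * (1 - \<rho>) powi (y - int L)) *
      (\<Sum>\<^sub>\<infinity>t. green_row c t * of_real (walk_prob N t (y - int L)))) = green (c - y) - of_nat (free_paths N c y)"
    using green_paths_equation[of c y] by simp
  have "?C * (1 - \<rho>) ^ L * (inverse ?C * (1 - \<rho>) powi (y - int L)) * (1 - \<rho>) powi (- y) = 1"
    using \<rho>0 \<rho>1 by (simp add: power_int_diff power_int_minus field_simps)
  then have "complex_of_real (?C * (1 - \<rho>) ^ L * (inverse ?C * (1 - \<rho>) powi (y - int L)) * (1 - \<rho>) powi (- y)) = 1"
    by (simp only: of_real_1)
  then have 2: "epsz * of_real (inverse ?C * (1 - \<rho>) powi (y - int L)) * of_real (1 - \<rho>) powi (- y) = \<zeta>"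
    unfolding \<zeta>_epsz[symmetric] of_real_mult[of _ "(1 - \<rho>) powi (- y)"] of_real_mult[of _ "inverse ?C * (1 - \<rho>) powi (y - int L)"] of_real_power_int
    by (simp only: mult.assoc mult_1_right)
  have "\<zeta> * (\<Sum>\<^sub>\<infinity>t. green_row c t * of_real (walk_prob N t (y - int L))) =
     of_real (1 - \<rho>) powi (- y) * (green (c - y) - of_nat (free_paths N c y))"
    unfolding 1[symmetric] 2[symmetric] by (simp only: mult_ac)
  then show ?thesis by (simp add: basis_row_def green_row_def right_diff_distrib)
qed

section \<open>The kernel in terms of the resolvent\<close>

definition hit_fun :: "(int \<Rightarrow> int) \<Rightarrow> int \<Rightarrow> int \<Rightarrow> complex" where
  "hit_fun Y y x = of_real (T_kernel \<rho> N L Y x y)"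

abbreviation bounded_paths :: "(int \<Rightarrow> int) \<Rightarrow> nat \<Rightarrow> int \<Rightarrow> int \<Rightarrow> nat" where
  "bounded_paths Y \<equiv> paths (\<lambda>m. {..Y (int m + 1)})"

lemma hit_fun_le_1: "cmod (hit_fun Y y x) \<le> 1"
proof -
  interpret W: prob_space "walk_measure \<rho>" by (rule prob_space_walk_measure)
  show ?thesis unfolding hit_fun_def T_kernel_def by simp
qed

lemma hit_fun_paths:
  "hit_fun Y y x = of_real ((\<rho> / (1 - \<rho>)) ^ N * (1 - \<rho>) powi (x - (y - 1 - int L))) *
    (of_nat (free_paths N x (y - 1 - int L)) - of_nat (bounded_paths Y N x (y - 1 - int L)))"
  unfolding hit_fun_def T_kernel_eq_paths[OF \<rho>0 \<rho>1] by simp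

lemma hit_fun_eq_0: "x < y - 1 - int L + int N \<Longrightarrow> hit_fun Y y x = 0"
  unfolding hit_fun_paths by (simp add: paths_eq_0)

lemma S_kernel_eq:
  "S_kernel \<rho> N L \<zeta> x y = (\<Sum>\<^sub>\<infinity>k\<in>{1..}. \<zeta> ^ k * of_real (walk_prob (k * N) x (y - int k * int L)))"
  unfolding S_kernel_def walk_prob_measure by (simp add: add.commute)

text \<open>The kernel S is the Neumann series without its term k = 0, summed over k first; that
  term is the identity. The geometric bound in |\<zeta>| permits the exchange of sums.\<close>

lemma
  assumes \<phi>: "\<And>t. cmod (\<phi> t) \<le> 1"
  shows S_kernel_summable: "(\<lambda>t. S_kernel \<rho> N L \<zeta> x t * \<phi> t) summable_on UNIV"
    and resolvent_eq: "resolvent \<phi> x = \<phi> x + (\<Sum>\<^sub>\<infinity>t. S_kernel \<rho> N L \<zeta> x t * \<phi> t)"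
proof -
  define A where "A = (\<lambda>k t. \<zeta> ^ k * (of_real (walk_prob (k * N) x (t - int k * int L)) * \<phi> t))"
  have nA: "norm (A k t) = cmod \<zeta> ^ k * norm (of_real (walk_prob (k * N) x (t - int k * int L)) * \<phi> t)" for k t
    unfolding A_def by (simp add: norm_mult norm_power)
  have A1: "(\<lambda>t. norm (A k t)) summable_on UNIV" for k
    unfolding nA by (intro summable_on_cmult_right walk_prob_mult_summable \<phi>)
  have A2: "(\<Sum>\<^sub>\<infinity>t. norm (A k t)) \<le> cmod \<zeta> ^ k" for k
    unfolding nA infsum_cmult_right'
    using mult_left_mono[OF walk_prob_mult_summable(2)[OF \<phi>], of "cmod \<zeta> ^ k"] by fastforce
  have S: "S_kernel \<rho> N L \<zeta> x t * \<phi> t = (\<Sum>\<^sub>\<infinity>k\<in>{1..}. A k t)" for t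
    unfolding S_kernel_eq A_def infsum_cmult_left'[symmetric] mult.assoc ..
  show "(\<lambda>t. S_kernel \<rho> N L \<zeta> x t * \<phi> t) summable_on UNIV"
    unfolding S by (rule infsum_swap_dominated(3)[OF A1 A2 \<zeta>_power_summable])
  have ev: "\<zeta> ^ k * evolve k \<phi> x = (\<Sum>\<^sub>\<infinity>t. A k t)" for k
    unfolding evolve_def A_def by (rule infsum_cmult_right'[symmetric])
  have "norm (\<zeta> ^ k * evolve k \<phi> x) \<le> cmod \<zeta> ^ k" for k
    using mult_left_mono[OF evolve_le_1[where k = k and x = x, OF \<phi>], of "cmod \<zeta> ^ k"] by (simp add: norm_mult norm_power)
  then have "(\<lambda>k. norm (\<zeta> ^ k * evolve k \<phi> x)) summable_on UNIV"
    by (intro summable_on_comparison_test[OF \<zeta>_power_summable]) auto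
  then have s: "(\<lambda>k. \<zeta> ^ k * evolve k \<phi> x) summable_on UNIV"
    by (rule Infinite_Sum.abs_summable_summable)
  have s1: "(\<lambda>k. \<zeta> ^ k * evolve k \<phi> x) summable_on {1..}"
    using s by (rule summable_on_subset_banach) simp
  have "UNIV = {0::nat} \<union> {1..}" by auto
  then have "resolvent \<phi> x = infsum (\<lambda>k. \<zeta> ^ k * evolve k \<phi> x) ({0} \<union> {1..})"
    unfolding resolvent_def by simp
  also have "\<dots> = \<phi> x + (\<Sum>\<^sub>\<infinity>k\<in>{1..}. \<zeta> ^ k * evolve k \<phi> x)"
    using s1 by (subst infsum_Un_disjoint) (auto simp: evolve_0)
  also have "(\<Sum>\<^sub>\<infinity>k\<in>{1..}. \<zeta> ^ k * evolve k \<phi> x) = (\<Sum>\<^sub>\<infinity>t. \<Sum>\<^sub>\<infinity>k\<in>{1..}. A k t)"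
    unfolding ev by (rule infsum_swap_dominated(1)[OF A1 A2 \<zeta>_power_summable])
  finally show "resolvent \<phi> x = \<phi> x + (\<Sum>\<^sub>\<infinity>t. S_kernel \<rho> N L \<zeta> x t * \<phi> t)"
    unfolding S .
qed

text \<open>The shift \<Sigma> becomes the argument \<open>x - 1\<close>. Since \<zeta> times
  \<open>T_kernel\<close> is \<open>B - B\<^sub>Y\<close> with its columns moved by one, K is minus
  \<open>(I - B)\<^sup>-\<^sup>1 (B - B\<^sub>Y)\<close>, which gives the factorization of I -
  K.\<close>

lemma K_en_resolvent: "K_en \<rho> N L Y \<zeta> x y = - \<zeta> * resolvent (hit_fun Y y) (x - 1)"
  unfolding K_en_def resolvent_eq[of "hit_fun Y y", OF hit_fun_le_1] by (simp add: hit_fun_def)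

text \<open>The image of the \<open>c\<close>-th basis row under \<open>I - K\<close>, up to the factor \<open>(1 - \<rho>) powi (- y)\<close>.\<close>

definition image_row :: "(int \<Rightarrow> int) \<Rightarrow> int \<Rightarrow> int \<Rightarrow> complex" where
  "image_row Y c y = green (c - y) -
    epsz * (\<Sum>x\<in>{y - int L<..Y 1}. green (c - x) * of_nat (bounded_paths Y N x (y - int L)))"

lemma bounded_paths_eq_0:
  assumes "x \<notin> {y<..Y 1}"
  shows "bounded_paths Y N x y = 0"
proof -
  obtain n where n: "N = Suc n" using N0 by (cases N) auto
  show ?thesis
  proof (cases "x \<le> y")
    case True
    then show ?thesis using n by (intro paths_eq_0) auto
  next
    case False
    then show ?thesis using assms unfolding n paths_first_step by auto
  qed
qed

text \<open>As c < N, \<open>basis_row c\<close> vanishes on the nonnegative integers, so the sum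
  over {..0} extends to the whole line and \<open>resolvent_pairing\<close> applies. By
  \<open>green_paths_equation\<close> the free paths in \<open>hit_fun\<close> then cancel
  \<open>basis_row\<close>, and only the bounded paths remain.\<close>

lemma basis_row_minus_K:
  assumes c: "c < int N"
  shows "basis_row c (y - 1) - (\<Sum>\<^sub>\<infinity>x\<in>{..0}. basis_row c (x - 1) * K_en \<rho> N L Y \<zeta> x y) =
    of_real (1 - \<rho>) powi (- (y - 1)) * image_row Y c (y - 1)"
proof -
  let ?w = "y - 1" and ?C = "(\<rho> / (1 - \<rho>)) ^ N"
  let ?F = "\<lambda>x. green (c - x) * of_nat (free_paths N x (?w - int L))"
  let ?G = "\<lambda>x. green (c - x) * of_nat (bounded_paths Y N x (?w - int L))"
  have bij: "bij_betw (\<lambda>x. x - 1) {..0::int} {..- 1}"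
    by (rule bij_betwI[of _ _ _ "\<lambda>x. x + 1"]) auto
  have "(\<Sum>\<^sub>\<infinity>x\<in>{..0}. basis_row c (x - 1) * K_en \<rho> N L Y \<zeta> x y)
    = (\<Sum>\<^sub>\<infinity>x\<in>{..0}. (\<lambda>x. basis_row c x * (- \<zeta> * resolvent (hit_fun Y y) x)) (x - 1))"
    unfolding K_en_resolvent ..
  also have "\<dots> = (\<Sum>\<^sub>\<infinity>x\<in>{..- 1}. basis_row c x * (- \<zeta> * resolvent (hit_fun Y y) x))"
    by (rule infsum_reindex_bij_betw[OF bij])
  also have "\<dots> = (\<Sum>\<^sub>\<infinity>x. basis_row c x * (- \<zeta> * resolvent (hit_fun Y y) x))"
    by (rule infsum_cong_neutral) (use c in \<open>auto simp: basis_row_eq_0\<close>)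
  also have "\<dots> = - \<zeta> * (\<Sum>\<^sub>\<infinity>x. basis_row c x * resolvent (hit_fun Y y) x)"
    unfolding infsum_cmult_right'[symmetric] by (simp only: mult_ac)
  also have "(\<Sum>\<^sub>\<infinity>x. basis_row c x * resolvent (hit_fun Y y) x) = (\<Sum>\<^sub>\<infinity>x. green_row c x * hit_fun Y y x)"
    by (rule resolvent_pairing[OF hit_fun_le_1 green_row_summable basis_row_summable green_row_equation])
  also have "(\<Sum>\<^sub>\<infinity>x. green_row c x * hit_fun Y y x) =
    (\<Sum>\<^sub>\<infinity>x. of_real (?C * (1 - \<rho>) powi (int L - ?w)) * (?F x + - ?G x))"
  proof (rule infsum_cong)
    fix x
    have e: "complex_of_real ((1 - \<rho>) powi (x - (?w - int L))) * of_real (1 - \<rho>) powi (- x) = of_real ((1 - \<rho>) powi (int L - ?w))"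
      unfolding of_real_power_int using a_nonzero(1) by (simp add: power_int_add[symmetric] algebra_simps)
    show "green_row c x * hit_fun Y y x = of_real (?C * (1 - \<rho>) powi (int L - ?w)) * (?F x + - ?G x)"
      unfolding hit_fun_paths green_row_def of_real_mult e[symmetric] by (simp add: algebra_simps)
  qed
  also have "\<dots> = of_real (?C * (1 - \<rho>) powi (int L - ?w)) * (\<Sum>\<^sub>\<infinity>x. ?F x + - ?G x)"
    by (rule infsum_cmult_right')
  also have "(\<Sum>\<^sub>\<infinity>x. ?F x + - ?G x) = (\<Sum>\<^sub>\<infinity>x. ?F x) + (\<Sum>\<^sub>\<infinity>x. - ?G x)"
  proof (rule infsum_add[OF green_paths_summable])
    have "(\<lambda>x. - ?G x) summable_on {?w - int L<..Y 1}" by simp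
    also have "?this \<longleftrightarrow> (\<lambda>x. - ?G x) summable_on UNIV"
      by (rule summable_on_cong_neutral) (simp_all add: bounded_paths_eq_0)
    finally show "(\<lambda>x. - ?G x) summable_on UNIV" .
  qed
  also have "(\<Sum>\<^sub>\<infinity>x. - ?G x) = (\<Sum>\<^sub>\<infinity>x\<in>{?w - int L<..Y 1}. - ?G x)"
    by (rule infsum_cong_neutral) (simp_all add: bounded_paths_eq_0)
  also have "\<dots> = - (\<Sum>x\<in>{?w - int L<..Y 1}. ?G x)" by (simp add: sum_negf)
  finally have K: "(\<Sum>\<^sub>\<infinity>x\<in>{..0}. basis_row c (x - 1) * K_en \<rho> N L Y \<zeta> x y) =
    - \<zeta> * (of_real (?C * (1 - \<rho>) powi (int L - ?w)) * ((\<Sum>\<^sub>\<infinity>x. ?F x) + - (\<Sum>x\<in>{?w - int L<..Y 1}. ?G x)))" .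
  have e: "\<zeta> * of_real (?C * (1 - \<rho>) powi (int L - ?w)) = epsz * of_real (1 - \<rho>) powi (- ?w)"
  proof -
    have "?C * (1 - \<rho>) powi (int L - ?w) = ?C * (1 - \<rho>) ^ L * (1 - \<rho>) powi (- ?w)"
    proof -
      have "(1 - \<rho>) powi (int L + - ?w) = (1 - \<rho>) powi int L * (1 - \<rho>) powi (- ?w)"
        by (rule power_int_add) (use a_nonzero in simp)
      then show ?thesis by (simp only: power_int_of_nat mult.assoc diff_conv_add_uminus)
    qed
    then show ?thesis unfolding \<zeta>_epsz[symmetric] by (simp only: of_real_mult of_real_power_int mult.assoc)
  qed
  have "(\<Sum>\<^sub>\<infinity>x\<in>{..0}. basis_row c (x - 1) * K_en \<rho> N L Y \<zeta> x y) =
    - (of_real (1 - \<rho>) powi (- ?w) * (epsz * (\<Sum>\<^sub>\<infinity>x. ?F x) - epsz * (\<Sum>x\<in>{?w - int L<..Y 1}. ?G x)))"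
    unfolding K
  proof -
    have "- \<zeta> * (A * (s + - t)) = - (B * (epsz * s - epsz * t))" if "\<zeta> * A = epsz * B" for A B s t
    proof -
      have "- \<zeta> * (A * (s + - t)) = - ((\<zeta> * A) * (s - t))" by (simp add: algebra_simps)
      then show ?thesis unfolding that by (simp add: algebra_simps)
    qed
    from this[OF e] show "- \<zeta> * (of_real (?C * (1 - \<rho>) powi (int L - ?w)) * ((\<Sum>\<^sub>\<infinity>x. ?F x) + - (\<Sum>x\<in>{?w - int L<..Y 1}. ?G x))) =
      - (of_real (1 - \<rho>) powi (- ?w) * (epsz * (\<Sum>\<^sub>\<infinity>x. ?F x) - epsz * (\<Sum>x\<in>{?w - int L<..Y 1}. ?G x)))" .
  qed
  then show ?thesis
    unfolding green_paths_equation image_row_def basis_row_def by (simp add: algebra_simps)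
qed

text \<open>In one round of N steps and a shift the position rises by at most L - N, so k rounds
  from \<open>x\<close> reach the support of \<open>\<phi>\<close> only if x + k (L - N) \<ge>
  \<open>x0\<close>. On the points that can be reached the factor \<kappa>^(x - x0 + k (L - N)) is
  at least 1, and inserting it leaves a geometric series in k.\<close>

lemma resolvent_decay:
  assumes \<phi>: "\<And>t. cmod (\<phi> t) \<le> 1" and supp: "\<And>t. t < x0 \<Longrightarrow> \<phi> t = 0"
    and \<kappa>: "1 \<le> \<kappa>" "cmod \<zeta> * \<kappa> ^ (L - N) < 1"
  shows "cmod (resolvent \<phi> x) \<le> \<kappa> powi (x - x0) * (1 / (1 - cmod \<zeta> * \<kappa> ^ (L - N)))"
proof -
  let ?q = "cmod \<zeta> * \<kappa> ^ (L - N)"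
  have q0: "0 \<le> ?q" using \<kappa> by simp
  have ev: "cmod (evolve k \<phi> x) \<le> \<kappa> powi (x - x0) * (\<kappa> ^ (L - N)) ^ k" for k
  proof -
    have "norm (of_real (walk_prob (k * N) x (t - int k * int L)) * \<phi> t) \<le>
      (\<kappa> powi (x - x0) * (\<kappa> ^ (L - N)) ^ k) * walk_prob (k * N) x (t - int k * int L)" for t
    proof (cases "t < x0 \<or> x < t - int k * int L + int (k * N)")
      case True
      then show ?thesis using supp[of t] walk_prob_eq_0[of x "t - int k * int L" "k * N"] \<kappa>
        by (auto simp: walk_prob_nonneg)
    next
      case False
      then have "t - x0 \<ge> 0" "t - x0 \<le> x - x0 + int (k * (L - N))"
        using NL by (auto simp: of_nat_diff algebra_simps)
      then have "1 \<le> \<kappa> powi (x - x0 + int (k * (L - N)))"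
        using \<kappa> by (intro one_le_power_int) auto
      also have "\<dots> = \<kappa> powi (x - x0) * (\<kappa> ^ (L - N)) ^ k"
      proof -
        have "\<kappa> powi (x - x0 + int (k * (L - N))) = \<kappa> powi (x - x0) * \<kappa> powi int (k * (L - N))"
          using \<kappa> by (intro power_int_add) auto
        then show ?thesis by (simp only: power_int_of_nat power_mult[symmetric] mult.commute[of k])
      qed
      finally have "cmod (\<phi> t) \<le> \<kappa> powi (x - x0) * (\<kappa> ^ (L - N)) ^ k"
        using \<phi>[of t] by linarith
      then have "walk_prob (k * N) x (t - int k * int L) * cmod (\<phi> t) \<le>
        walk_prob (k * N) x (t - int k * int L) * (\<kappa> powi (x - x0) * (\<kappa> ^ (L - N)) ^ k)"
        by (rule mult_left_mono[OF _ walk_prob_nonneg])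
      then show ?thesis
        by (simp only: norm_mult norm_of_real abs_of_nonneg[OF walk_prob_nonneg] mult.commute)
    qed
    note le = this
    have "cmod (evolve k \<phi> x) \<le> (\<Sum>\<^sub>\<infinity>t. norm (of_real (walk_prob (k * N) x (t - int k * int L)) * \<phi> t))"
      unfolding evolve_def by (rule norm_infsum_le_infsum_norm[OF walk_prob_mult_summable(1)[OF \<phi>]])
    also have "\<dots> \<le> (\<Sum>\<^sub>\<infinity>t. (\<kappa> powi (x - x0) * (\<kappa> ^ (L - N)) ^ k) * walk_prob (k * N) x (t - int k * int L))"
      by (rule infsum_mono[OF walk_prob_mult_summable(1)[OF \<phi>] summable_on_cmult_right[OF walk_prob_summable] le])
    also have "\<dots> \<le> (\<kappa> powi (x - x0) * (\<kappa> ^ (L - N)) ^ k) * 1"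
      unfolding infsum_cmult_right' using \<kappa> by (intro mult_left_mono walk_prob_infsum_le) simp
    finally show ?thesis by simp
  qed
  have le: "norm (\<zeta> ^ k * evolve k \<phi> x) \<le> \<kappa> powi (x - x0) * ?q ^ k" for k
    using mult_left_mono[OF ev[of k], of "cmod \<zeta> ^ k"]
    by (simp add: norm_mult norm_power power_mult_distrib mult_ac)
  have geo: "((\<lambda>k. ?q ^ k) has_sum (1 / (1 - ?q))) UNIV"
    by (rule sums_nonneg_imp_has_sum) (use q0 \<kappa> in \<open>auto intro!: geometric_sums\<close>)
  then have geo': "((\<lambda>k. \<kappa> powi (x - x0) * ?q ^ k) has_sum (\<kappa> powi (x - x0) * (1 / (1 - ?q)))) UNIV"
    by (rule has_sum_cmult_right)
  then have gs: "(\<lambda>k. \<kappa> powi (x - x0) * ?q ^ k) summable_on UNIV" by (rule has_sum_imp_summable)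
  have s: "(\<lambda>k. norm (\<zeta> ^ k * evolve k \<phi> x)) summable_on UNIV"
    by (rule summable_on_comparison_test[OF gs]) (use le in auto)
  have "cmod (resolvent \<phi> x) \<le> (\<Sum>\<^sub>\<infinity>k. norm (\<zeta> ^ k * evolve k \<phi> x))"
    unfolding resolvent_def by (rule norm_infsum_le_infsum_norm[OF s])
  also have "\<dots> \<le> (\<Sum>\<^sub>\<infinity>k. \<kappa> powi (x - x0) * ?q ^ k)" by (rule infsum_mono[OF s gs le])
  also have "\<dots> = \<kappa> powi (x - x0) * (1 / (1 - ?q))" by (rule infsumI[OF geo'])
  finally show ?thesis .
qed

text \<open>The base \<kappa> does not depend on the column, so finite combinations of columns decay
  at the same rate as x tends to minus infinity. This puts the column functions of the finite-rank
  form into \<open>ell2 {..0}\<close>.\<close>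

lemma K_en_decay: "\<exists>\<kappa>>1. \<forall>Y y. \<exists>C. \<forall>x. cmod (K_en \<rho> N L Y \<zeta> x y) \<le> C * \<kappa> powi x"
proof -
  have z: "0 < cmod \<zeta>" using \<rho>0 \<rho>1 z0 unfolding \<zeta>_eq by simp
  \<comment> \<open>A base above 1 with |\<zeta>| \<kappa>^(L - N) < 1 is wanted; this one makes the
    product the square root of |\<zeta>|.\<close>
  define \<kappa> where "\<kappa> = root (L - N) (1 / sqrt (cmod \<zeta>))"
  have pos: "0 < L - N" using NL by simp
  have "\<kappa> ^ (L - N) = 1 / sqrt (cmod \<zeta>)"
    unfolding \<kappa>_def using pos z by (intro real_root_pow_pos2) auto
  then have "cmod \<zeta> * \<kappa> ^ (L - N) = sqrt (cmod \<zeta>)"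
    using z by (simp add: real_div_sqrt)
  then have q: "cmod \<zeta> * \<kappa> ^ (L - N) < 1" using cmod_\<zeta> by simp
  have \<kappa>: "1 < \<kappa>" unfolding \<kappa>_def using pos z cmod_\<zeta> by simp
  show ?thesis
  proof (rule exI[of _ \<kappa>], intro conjI allI \<kappa>)
    fix Y y
    let ?x0 = "y - 1 - int L + int N" and ?B = "1 / (1 - cmod \<zeta> * \<kappa> ^ (L - N))"
    show "\<exists>C. \<forall>x. cmod (K_en \<rho> N L Y \<zeta> x y) \<le> C * \<kappa> powi x"
    proof (intro exI allI)
      fix x
      have "cmod (K_en \<rho> N L Y \<zeta> x y) = cmod \<zeta> * cmod (resolvent (hit_fun Y y) (x - 1))"
        unfolding K_en_resolvent by (simp add: norm_mult)
      also have "\<dots> \<le> cmod \<zeta> * (\<kappa> powi (x - 1 - ?x0) * ?B)"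
        using resolvent_decay[where \<phi> = "hit_fun Y y" and ?x0.0 = ?x0 and \<kappa> = \<kappa> and x = "x - 1", OF hit_fun_le_1 hit_fun_eq_0] \<kappa> q
        by (intro mult_left_mono) auto
      also have "\<dots> = (cmod \<zeta> * \<kappa> powi (- 1 - ?x0) * ?B) * \<kappa> powi x"
      proof -
        have "\<kappa> powi (x - 1 - ?x0) = \<kappa> powi (- 1 - ?x0) * \<kappa> powi x"
          using \<kappa> by (simp add: power_int_add[symmetric] algebra_simps)
        then show ?thesis by (simp only: mult_ac)
      qed
      finally show "cmod (K_en \<rho> N L Y \<zeta> x y) \<le> (cmod \<zeta> * \<kappa> powi (- 1 - ?x0) * ?B) * \<kappa> powi x" .
    qed
  qed
qed

end

section \<open>Finite rank of the kernel\<close>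

locale bethe_conf = bethe_walk +
  fixes Y :: "int \<Rightarrow> int"
  assumes Y: "Y \<in> Pconf N L" and Y1: "Y 1 < 0"
begin

abbreviation "y1 \<equiv> Y 1"

abbreviation "K \<equiv> K_en \<rho> N L Y \<zeta>"

lemma Y_less: "Y (i + int k + 1) < Y i"
proof (induction k)
  case 0
  then show ?case using Y by (simp add: Pconf_def)
next
  case (Suc k)
  have st: "Y (j + 1) < Y j" for j using Y by (simp add: Pconf_def)
  have "Y (i + int (Suc k) + 1) < Y (i + int (Suc k))" by (rule st)
  moreover have "i + int (Suc k) = i + int k + 1" by simp
  ultimately show ?case using Suc by (metis order.strict_trans)
qed

lemma Y_period: "Y (int N + 1) = y1 - int L"
  using Y by (simp add: Pconf_def add.commute)

lemma Y_period_less: "m < N \<Longrightarrow> y1 - int L < Y (int m + 1)"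
  using Y_less[of "int m + 1" "N - m - 1"] Y_period by (simp add: of_nat_diff algebra_simps)

text \<open>Every barrier met in N steps lies above \<open>y1 - int L\<close>, by
  \<open>Y_period_less\<close>. At endpoints up to there the constraint on the last point is void,
  and the restricted counts obey the free recursion.\<close>

lemma bdiff_bounded_paths:
  assumes "k \<le> N" "y \<le> y1 - int L"
  shows "(bdiff ^^ k) (\<lambda>y. of_nat (bounded_paths Y N x y) :: complex) y = of_nat (bounded_paths Y (N - k) x y)"
  using assms
proof (induction k arbitrary: y)
  case (Suc k)
  have k: "N - k = Suc (N - Suc k)" using Suc.prems by simp
  have "y \<in> {..Y (int (N - Suc k) + 1)}" using Y_period_less[of "N - Suc k"] Suc.prems by auto
  moreover have "(bdiff ^^ Suc k) (\<lambda>y. of_nat (bounded_paths Y N x y)) y =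
    (of_nat (bounded_paths Y (N - k) x (y - 1)) - of_nat (bounded_paths Y (N - k) x y) :: complex)"
    unfolding bdiff_funpow_Suc using Suc by simp
  ultimately show ?case unfolding k paths_diff by simp
qed simp

definition path_diff :: "int \<Rightarrow> int \<Rightarrow> complex" where
  "path_diff x t = of_nat (free_paths N x t) - of_nat (bounded_paths Y N x t)"

lemma bdiff_path_diff:
  assumes "t \<le> y1 - int L"
  shows "(bdiff ^^ N) (path_diff x) t = 0"
proof -
  have "(bdiff ^^ N) (path_diff x) t =
    (bdiff ^^ N) (\<lambda>t. (- 1) * of_nat (bounded_paths Y N x t) + of_nat (free_paths N x t)) t"
    by (rule bdiff_funpow_cong) (simp add: path_diff_def)
  also have "\<dots> = 0"
    unfolding bdiff_funpow_lincomb bdiff_bounded_paths[OF order_refl assms] bdiff_free_paths[OF order_refl] by simp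
  finally show ?thesis .
qed

text \<open>The row \<open>K x \<cdot>\<close> without its geometric weight, shifted to the negative integers. Away from
  finitely many points its \<open>N\<close>-th difference vanishes, whence \<open>K\<close> has finite rank.\<close>

definition K_row :: "int \<Rightarrow> int \<Rightarrow> complex" where
  "K_row x t = (if t < 0 then of_real (1 - \<rho>) powi t * K x (t + 1) else 0)"

lemma bdiff_K_row:
  assumes c: "c \<le> y1"
  shows "(bdiff ^^ N) (K_row x) c = 0"
proof -
  let ?C = "complex_of_real ((\<rho> / (1 - \<rho>)) ^ N)"
  \<comment> \<open>Multiplying the column at t by (1 - \<rho>)^t leaves a weight that depends on
    the starting point \<open>s\<close> alone, so differences in t act only on path counts.\<close>
  let ?g = "\<lambda>s. ?C * of_real (1 - \<rho>) powi (s + int L)"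
  have hit: "of_real (1 - \<rho>) powi t * hit_fun Y (t + 1) s = ?g s * path_diff s (t - int L)" for t s
  proof -
    have "complex_of_real (1 - \<rho>) powi t * of_real (1 - \<rho>) powi (s - (t - int L)) = of_real (1 - \<rho>) powi (s + int L)"
      using a_nonzero(1) by (simp add: power_int_add[symmetric] algebra_simps)
    then show ?thesis
      unfolding hit_fun_paths path_diff_def of_real_mult of_real_power_int by (simp add: mult_ac)
  qed
  let ?S = "S_kernel \<rho> N L \<zeta> (x - 1)"
  have hitS: "of_real (1 - \<rho>) powi t * (?S s * hit_fun Y (t + 1) s) = (?S s * ?g s) * path_diff s (t - int L)" for t s
  proof -
    have "of_real (1 - \<rho>) powi t * (?S s * hit_fun Y (t + 1) s) = ?S s * (of_real (1 - \<rho>) powi t * hit_fun Y (t + 1) s)"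
      by (rule mult.left_commute)
    then show ?thesis unfolding hit by (simp only: mult.assoc)
  qed
  have s: "(\<lambda>s. (?S s * ?g s) * path_diff s (t - int L)) summable_on UNIV" for t
  proof -
    have "(\<lambda>s. of_real (1 - \<rho>) powi t * (?S s * hit_fun Y (t + 1) s)) summable_on UNIV"
      by (intro summable_on_cmult_right S_kernel_summable hit_fun_le_1)
    then show ?thesis unfolding hitS .
  qed
  have Kt: "of_real (1 - \<rho>) powi t * K x (t + 1) =
    - \<zeta> * (?g (x - 1) * path_diff (x - 1) (t - int L) + (\<Sum>\<^sub>\<infinity>s. (?S s * ?g s) * path_diff s (t - int L))) + 0" for t
  proof -
    have "of_real (1 - \<rho>) powi t * (\<Sum>\<^sub>\<infinity>s. ?S s * hit_fun Y (t + 1) s) = (\<Sum>\<^sub>\<infinity>s. of_real (1 - \<rho>) powi t * (?S s * hit_fun Y (t + 1) s))"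
      by (rule infsum_cmult_right'[symmetric])
    also have "\<dots> = (\<Sum>\<^sub>\<infinity>s. (?S s * ?g s) * path_diff s (t - int L))"
      by (rule infsum_cong) (rule hitS)
    finally have "of_real (1 - \<rho>) powi t * resolvent (hit_fun Y (t + 1)) (x - 1) =
      ?g (x - 1) * path_diff (x - 1) (t - int L) + (\<Sum>\<^sub>\<infinity>s. (?S s * ?g s) * path_diff s (t - int L))"
      unfolding resolvent_eq[of "hit_fun Y (t + 1)", OF hit_fun_le_1] distrib_left hit by simp
    then show ?thesis unfolding K_en_resolvent by (simp add: algebra_simps)
  qed
  have sh: "(bdiff ^^ N) (\<lambda>t. path_diff s (t - int L)) c = 0" for s
    unfolding bdiff_funpow_shift by (rule bdiff_path_diff) (use c in simp)
  have "(bdiff ^^ N) (K_row x) c = (bdiff ^^ N) (\<lambda>t. - \<zeta> * (?g (x - 1) * path_diff (x - 1) (t - int L) +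
      (\<Sum>\<^sub>\<infinity>s. (?S s * ?g s) * path_diff s (t - int L))) + 0) c"
    by (rule bdiff_funpow_cong) (use c Y1 in \<open>simp only: K_row_def Kt[symmetric], simp\<close>)
  also have "\<dots> = - \<zeta> * (?g (x - 1) * (bdiff ^^ N) (\<lambda>t. path_diff (x - 1) (t - int L)) c +
      (\<Sum>\<^sub>\<infinity>s. (?S s * ?g s) * (bdiff ^^ N) (\<lambda>t. path_diff s (t - int L)) c)) + 0"
    unfolding bdiff_funpow_lincomb bdiff_funpow_infsum[where g = "\<lambda>s. ?S s * ?g s" and D = "\<lambda>s t. path_diff s (t - int L)", OF s]
    by simp
  also have "\<dots> = 0" unfolding sh by simp
  finally show ?thesis .
qed

text \<open>The number of indices c with \<open>y1\<close> < c < N. The N-th difference of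
  \<open>K_row x\<close> vanishes for c \<le> \<open>y1\<close> by \<open>bdiff_K_row\<close>, and
  for c \<ge> N because then its whole window lies where \<open>K_row x\<close> is 0.\<close>

definition rk :: nat where "rk = nat (int N - 1 - y1)"

definition ix :: "nat \<Rightarrow> int" where "ix i = y1 + 1 + int i"

lemma rk: "int rk = int N - 1 - y1" "N \<le> rk"
  using Y1 N0 by (auto simp: rk_def)

definition coef :: "nat \<Rightarrow> int \<Rightarrow> complex" where
  "coef i x = (bdiff ^^ N) (K_row x) (ix i)"

lemma K_finite_rank:
  assumes y: "y \<le> 0"
  shows "K x y = (\<Sum>i<rk. coef i x * basis_row (ix i) (y - 1))"
proof -
  let ?h = "K_row x" and ?t = "y - 1"
  let ?f = "\<lambda>c. (bdiff ^^ N) ?h c * of_nat (free_paths N c ?t)"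
  have "?h ?t = sum ?f {?t..<0 + int N}"
    by (rule sum_bdiff_free_paths) (simp add: K_row_def)
  also have "\<dots> = sum ?f {min ?t (y1 + 1)..<int N}"
    by (intro sum.mono_neutral_left) (auto intro!: paths_eq_0)
  also have "\<dots> = sum ?f {y1 + 1..<int N}"
  proof (intro sum.mono_neutral_right ballI)
    fix c assume "c \<in> {min ?t (y1 + 1)..<int N} - {y1 + 1..<int N}"
    then show "?f c = 0" using bdiff_K_row[of c x] by auto
  qed auto
  also have "\<dots> = (\<Sum>i<rk. ?f (ix i))"
    by (rule sum.reindex_bij_witness[where i = ix and j = "\<lambda>c. nat (c - y1 - 1)"]) (use rk in \<open>auto simp: ix_def\<close>)
  finally have "?h ?t = (\<Sum>i<rk. ?f (ix i))" .
  moreover have "K x y = of_real (1 - \<rho>) powi (- ?t) * ?h ?t"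
  proof -
    have "?h ?t = of_real (1 - \<rho>) powi ?t * K x y" using y by (simp add: K_row_def)
    moreover have "complex_of_real (1 - \<rho>) powi (- ?t) * of_real (1 - \<rho>) powi ?t = 1"
      using a_nonzero(1) by (simp add: power_int_add[symmetric])
    ultimately show ?thesis by (simp only: mult.assoc[symmetric] mult_1)
  qed
  ultimately show ?thesis
    unfolding coef_def basis_row_def by (simp add: sum_distrib_left mult_ac)
qed

section \<open>Trace class property and reduction to a finite matrix\<close>

definition col_fun :: "nat \<Rightarrow> int \<Rightarrow> complex" where
  "col_fun i x = (if x \<le> 0 then coef i x else 0)"

definition row_fun :: "nat \<Rightarrow> int \<Rightarrow> complex" where
  "row_fun i x = (if x \<le> 0 then basis_row (ix i) (x - 1) else 0)"

text \<open>A coefficient is a finite combination of entries of K in row x, and each entry decays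
  exponentially in x by \<open>K_en_decay\<close>.\<close>

lemma col_fun_ell2: "col_fun i \<in> ell2 {..0}"
proof -
  obtain \<kappa> where \<kappa>: "1 < \<kappa>" and K: "\<And>y. \<exists>C. \<forall>x. cmod (K x y) \<le> C * \<kappa> powi x"
    using K_en_decay by blast
  have row: "\<exists>C. \<forall>x. cmod (K_row x t) \<le> C * \<kappa> powi x" for t
  proof -
    obtain C where C: "\<And>x. cmod (K x (t + 1)) \<le> C * \<kappa> powi x" using K by blast
    have C0: "0 \<le> C" using C[of 0] norm_ge_zero[of "K 0 (t + 1)"] by (simp del: norm_ge_zero)
    have "cmod (K_row x t) \<le> (cmod (of_real (1 - \<rho>) powi t) * C) * \<kappa> powi x" for x
      using mult_left_mono[OF C, of "cmod (of_real (1 - \<rho>) powi t)" x] C0 \<kappa>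
      by (simp add: K_row_def norm_mult mult.assoc)
    then show ?thesis by blast
  qed
  have "\<exists>C. \<forall>x. cmod ((bdiff ^^ k) (K_row x) t) \<le> C * \<kappa> powi x" for k t
  proof (induction k arbitrary: t)
    case 0
    then show ?case using row by simp
  next
    case (Suc k)
    obtain C1 C2 where C: "\<And>x. cmod ((bdiff ^^ k) (K_row x) (t - 1)) \<le> C1 * \<kappa> powi x"
      "\<And>x. cmod ((bdiff ^^ k) (K_row x) t) \<le> C2 * \<kappa> powi x"
      using Suc[of "t - 1"] Suc[of t] by blast
    have "cmod ((bdiff ^^ Suc k) (K_row x) t) \<le> (C1 + C2) * \<kappa> powi x" for x
      unfolding bdiff_funpow_Suc distrib_right
      by (rule order_trans[OF norm_triangle_ineq4 add_mono[OF C]])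
    then show ?case by blast
  qed
  then obtain C where C: "\<And>x. cmod (coef i x) \<le> C * \<kappa> powi x" unfolding coef_def by blast
  have "(\<lambda>x. cmod (of_real (\<kappa>\<^sup>2) powi x)) summable_on {..0}"
  proof (rule summable_on_powi_atMost)
    have "1 < \<kappa>\<^sup>2" using \<kappa> by (simp add: one_less_power)
    then show "1 < cmod (of_real (\<kappa>\<^sup>2))" unfolding norm_of_real by linarith
  qed
  then have "(\<lambda>x. C\<^sup>2 * cmod (of_real (\<kappa>\<^sup>2) powi x)) summable_on {..0}"
    by (rule summable_on_cmult_right)
  then have "(\<lambda>x. (cmod (col_fun i x))\<^sup>2) summable_on {..0}"
  proof (rule summable_on_comparison_test)
    fix x :: int assume "x \<in> {..0}"
    then have "(cmod (col_fun i x))\<^sup>2 \<le> (C * \<kappa> powi x)\<^sup>2"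
      using C[of x] by (intro power_mono) (auto simp: col_fun_def)
    also have "\<dots> = C\<^sup>2 * cmod (of_real (\<kappa>\<^sup>2) powi x)"
    proof -
      have "cmod (complex_of_real (\<kappa>\<^sup>2) powi x) = (\<kappa> powi x)\<^sup>2"
      proof -
        have e: "(\<kappa>\<^sup>2) powi x = (\<kappa> powi x)\<^sup>2"
          by (simp only: power2_eq_square power_int_mult_distrib)
        show ?thesis by (simp only: of_real_power_int[symmetric] e norm_of_real) simp
      qed
      then show ?thesis by (simp add: power_mult_distrib)
    qed
    finally show "(cmod (col_fun i x))\<^sup>2 \<le> C\<^sup>2 * cmod (of_real (\<kappa>\<^sup>2) powi x)" .
  qed simp
  then show ?thesis by (simp add: ell2_def col_fun_def)
qed

lemma row_fun_ell2: "row_fun i \<in> ell2 {..0}"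
proof -
  define B where "B = (\<Sum>\<^sub>\<infinity>x. norm (basis_row (ix i) x))"
  have le: "norm (basis_row (ix i) x) \<le> B" for x
  proof -
    have "(\<Sum>\<^sub>\<infinity>t\<in>{x}. norm (basis_row (ix i) t)) \<le> B"
      unfolding B_def by (rule infsum_mono2) (auto intro: basis_row_summable)
    then show ?thesis by simp
  qed
  have bij: "bij_betw (\<lambda>x. x - 1) {..0::int} {..- 1}"
    by (rule bij_betwI[of _ _ _ "\<lambda>x. x + 1"]) auto
  have "(\<lambda>x. norm (basis_row (ix i) x)) summable_on {..- 1}"
    using basis_row_summable by (rule summable_on_subset_banach) simp
  then have "(\<lambda>x. norm (basis_row (ix i) (x - 1))) summable_on {..0}"
    using summable_on_reindex_bij_betw[OF bij, of "\<lambda>x. norm (basis_row (ix i) x)"] by simp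
  then have "(\<lambda>x. B * norm (basis_row (ix i) (x - 1))) summable_on {..0}"
    by (rule summable_on_cmult_right)
  then have "(\<lambda>x. (cmod (row_fun i x))\<^sup>2) summable_on {..0}"
    by (rule summable_on_comparison_test)
       (auto simp: row_fun_def power2_eq_square intro!: mult_right_mono le)
  then show ?thesis by (simp add: ell2_def row_fun_def)
qed

lemma row_col_summable: "(\<lambda>x. norm (basis_row (ix i) (x - 1) * coef j x)) summable_on {..0}"
proof -
  have "(\<lambda>x. norm (row_fun i x * col_fun j x)) summable_on {..0}"
    by (rule ell2_mult_summable[OF row_fun_ell2 col_fun_ell2])
  also have "?this \<longleftrightarrow> ?thesis"
    by (rule summable_on_cong) (simp add: row_fun_def col_fun_def)
  finally show ?thesis .
qed

text \<open>The matrix of I - K acting from the right on the span of the rows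
  \<open>basis_row (ix i)\<close>.\<close>

definition D :: "nat \<Rightarrow> nat \<Rightarrow> complex" where
  "D i j = (if i = j then 1 else 0) - (\<Sum>\<^sub>\<infinity>x\<in>{..0}. basis_row (ix i) (x - 1) * coef j x)"

lemma fredholm_det_K:
  "fredholm_det {..0} (kernel_operator {..0} K) = Determinant.det (Matrix.mat rk rk (\<lambda>(i, j). D i j))"
  unfolding D_def
  by (rule fredholm_det_finite_rank[where f = coef and g = "\<lambda>i x. basis_row (ix i) (x - 1)"])
     (simp_all add: K_finite_rank row_col_summable)

lemma trace_class_K: "trace_class {..0} (kernel_operator {..0} K)"
proof (rule trace_class_cong)
  \<comment> \<open>\<open>ell2_inner\<close> conjugates its first argument, hence the conjugate
    rows.\<close>
  let ?G = "\<lambda>i x. cnj (row_fun i x)"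
  have G: "?G i \<in> ell2 {..0}" for i using row_fun_ell2[of i] by (simp add: ell2_def)
  show "trace_class {..0} (finite_rank_op {..0} {..<rk} col_fun ?G)"
    by (rule trace_class_finite_rank) (use col_fun_ell2 G in auto)
  fix f :: "int \<Rightarrow> complex" assume f: "f \<in> ell2 {..0}"
  show "kernel_operator {..0} K f = finite_rank_op {..0} {..<rk} col_fun ?G f"
  proof
    fix x :: int
    show "kernel_operator {..0} K f x = finite_rank_op {..0} {..<rk} col_fun ?G f x"
    proof (cases "x \<le> 0")
      case True
      have "(\<Sum>\<^sub>\<infinity>y\<in>{..0}. K x y * f y) = (\<Sum>\<^sub>\<infinity>y\<in>{..0}. \<Sum>i<rk. coef i x * (cnj (?G i y) * f y))"
      proof (rule infsum_cong)
        fix y :: int assume "y \<in> {..0}"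
        then show "K x y * f y = (\<Sum>i<rk. coef i x * (cnj (?G i y) * f y))"
          by (simp add: K_finite_rank row_fun_def sum_distrib_right mult.assoc)
      qed
      also have "\<dots> = (\<Sum>i<rk. \<Sum>\<^sub>\<infinity>y\<in>{..0}. coef i x * (cnj (?G i y) * f y))"
        by (intro infsum_finite_sum summable_on_cmult_right ell2_inner_summable[OF G f])
      also have "\<dots> = (\<Sum>i<rk. ell2_inner {..0} (?G i) f * coef i x)"
        unfolding ell2_inner_def by (simp add: infsum_cmult_right' mult.commute)
      finally show ?thesis using True by (simp add: kernel_operator_def finite_rank_op_def col_fun_def)
    qed (simp add: kernel_operator_def finite_rank_op_def col_fun_def)
  qed
qed

text \<open>Two expressions for the image of a basis row under I - K: the closed form obtained from
  the resolvent, and the coefficients \<open>D\<close> of the finite-rank form. Through this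
  identity det D becomes computable although the \<open>coef j\<close> are not explicit.\<close>

lemma image_row_expansion:
  assumes t: "t < 0" and i: "i < rk"
  shows "image_row Y (ix i) t = (\<Sum>j<rk. D i j * of_nat (free_paths N (ix j) t))"
proof -
  define y where "y = t + 1"
  have y: "y \<le> 0" "t = y - 1" using t by (auto simp: y_def)
  have c: "ix i < int N" using i rk by (simp add: ix_def)
  let ?b = "\<lambda>i x. basis_row (ix i) (x - 1)"
  have "(\<Sum>\<^sub>\<infinity>x\<in>{..0}. ?b i x * K x y) = (\<Sum>\<^sub>\<infinity>x\<in>{..0}. \<Sum>j<rk. ?b j y * (?b i x * coef j x))"
    by (simp add: K_finite_rank[OF y(1)] sum_distrib_left mult_ac)
  also have "\<dots> = (\<Sum>j<rk. \<Sum>\<^sub>\<infinity>x\<in>{..0}. ?b j y * (?b i x * coef j x))"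
    by (intro infsum_finite_sum summable_on_cmult_right Infinite_Sum.abs_summable_summable[OF row_col_summable])
  also have "\<dots> = (\<Sum>j<rk. ?b j y * (\<Sum>\<^sub>\<infinity>x\<in>{..0}. ?b i x * coef j x))"
    by (simp add: infsum_cmult_right')
  finally have K: "(\<Sum>\<^sub>\<infinity>x\<in>{..0}. ?b i x * K x y) = (\<Sum>j<rk. ?b j y * (\<Sum>\<^sub>\<infinity>x\<in>{..0}. ?b i x * coef j x))" .
  have "(\<Sum>j<rk. D i j * ?b j y) = (\<Sum>j<rk. if j = i then ?b j y else 0) - (\<Sum>j<rk. ?b j y * (\<Sum>\<^sub>\<infinity>x\<in>{..0}. ?b i x * coef j x))"
    unfolding sum_subtractf[symmetric] D_def by (rule sum.cong) (auto simp: algebra_simps)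
  also have "(\<Sum>j<rk. if j = i then ?b j y else 0) = ?b i y" using i by simp
  finally have "(\<Sum>j<rk. D i j * ?b j y) = of_real (1 - \<rho>) powi (- t) * image_row Y (ix i) t"
    using basis_row_minus_K[OF c, of y Y] unfolding K y(2) by simp
  then have "of_real (1 - \<rho>) powi (- t) * image_row Y (ix i) t =
    of_real (1 - \<rho>) powi (- t) * (\<Sum>j<rk. D i j * of_nat (free_paths N (ix j) t))"
    unfolding basis_row_def y(2)[symmetric] by (simp add: sum_distrib_left mult_ac)
  moreover have "complex_of_real (1 - \<rho>) powi (- t) \<noteq> 0" using a_nonzero(1) by simp
  ultimately show ?thesis by (simp only: mult_cancel_left) simp
qed

end

section \<open>Evaluation of the determinant\<close>

lemma det_four_block_lower_right_zero:
  fixes A :: "'a::idom mat"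
  assumes A: "A \<in> carrier_mat d n" and B: "B \<in> carrier_mat d d" and C: "C \<in> carrier_mat n n"
  shows "Determinant.det (four_block_mat A B C (0\<^sub>m n d)) = (- 1) ^ (d * n) * (Determinant.det B * Determinant.det C)"
proof -
  let ?M = "four_block_mat A B C (0\<^sub>m n d)"
  have M: "?M \<in> carrier_mat (d + n) (d + n)" using four_block_carrier_mat[OF A, of "0\<^sub>m n d" n d B C] by (simp only: add.commute zero_carrier_mat)
  have "Matrix.mat (d + n) (d + n) (\<lambda>(i, j). ?M $$ (i, if j < d then j + n else j - d)) =
    four_block_mat B A (0\<^sub>m n d) C"
    by (rule eq_matI) (use A B C in \<open>simp_all add: four_block_mat_def Let_def, intro impI, linarith\<close>)
  then have "Determinant.det ?M = (- 1) ^ (d * n) * Determinant.det (four_block_mat B A (0\<^sub>m n d) C)"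
    using det_swap_cols[OF M] by simp
  also have "Determinant.det (four_block_mat B A (0\<^sub>m n d) C) = Determinant.det B * Determinant.det C"
    by (rule det_four_block_mat_lower_left_zero[OF B A refl C])
  finally show ?thesis .
qed

lemma det_mat_lower_triangular:
  fixes f :: "nat \<Rightarrow> nat \<Rightarrow> 'a::comm_ring_1"
  assumes "\<And>i j. i < j \<Longrightarrow> j < n \<Longrightarrow> f i j = 0"
  shows "Determinant.det (Matrix.mat n n (\<lambda>(i, j). f i j)) = (\<Prod>i<n. f i i)"
proof -
  have "Determinant.det (Matrix.mat n n (\<lambda>(i, j). f i j)) = prod_list (diag_mat (Matrix.mat n n (\<lambda>(i, j). f i j)))"
    by (rule det_lower_triangular[of n]) (use assms in auto)
  also have "\<dots> = (\<Prod>i<n. f i i)"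
    by (simp add: diag_mat_def prod.list_conv_set_nth atLeast0LessThan)
  finally show ?thesis .
qed

lemma det_mat_upper_triangular:
  fixes f :: "nat \<Rightarrow> nat \<Rightarrow> 'a::comm_ring_1"
  assumes "\<And>i j. j < i \<Longrightarrow> i < n \<Longrightarrow> f i j = 0"
  shows "Determinant.det (Matrix.mat n n (\<lambda>(i, j). f i j)) = (\<Prod>i<n. f i i)"
proof -
  have "Matrix.mat n n (\<lambda>(i, j). f i j) = (Matrix.mat n n (\<lambda>(i, j). f j i))\<^sup>T"
    by (rule eq_matI) auto
  then have "Determinant.det (Matrix.mat n n (\<lambda>(i, j). f i j)) = Determinant.det (Matrix.mat n n (\<lambda>(i, j). f j i))"
    by (simp add: det_transpose[of _ n])
  also have "\<dots> = (\<Prod>i<n. f i i)"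
    by (rule det_mat_lower_triangular) (use assms in auto)
  finally show ?thesis .
qed

lemma det_mat_mult:
  fixes f g :: "nat \<Rightarrow> nat \<Rightarrow> 'a::comm_ring_1"
  assumes "\<And>i j. i < n \<Longrightarrow> j < n \<Longrightarrow> h i j = (\<Sum>k<n. f i k * g k j)"
  shows "Determinant.det (Matrix.mat n n (\<lambda>(i, j). h i j)) =
    Determinant.det (Matrix.mat n n (\<lambda>(i, j). f i j)) * Determinant.det (Matrix.mat n n (\<lambda>(i, j). g i j))"
proof -
  have "Matrix.mat n n (\<lambda>(i, j). h i j) = Matrix.mat n n (\<lambda>(i, j). f i j) * Matrix.mat n n (\<lambda>(i, j). g i j)"
    by (rule eq_matI) (simp_all add: assms scalar_prod_def atLeast0LessThan)
  then show ?thesis by (simp add: det_mult[of _ n])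
qed

text \<open>Column operations pass from the powers to the Newton polynomials \<open>\<Prod>i<j. x - v i\<close>, whose
  matrix of values is triangular.\<close>

lemma det_vandermonde:
  fixes v :: "nat \<Rightarrow> 'a::idom"
  shows "Determinant.det (Matrix.mat n n (\<lambda>(i, j). v i ^ j)) = (\<Prod>j<n. \<Prod>i<j. v j - v i)"
proof -
  define P where "P = (\<lambda>j. \<Prod>i<j. [:- v i, 1:])"
  have val: "Polynomial.poly (P j) x = (\<Prod>i<j. x - v i)" for j x by (simp add: P_def poly_prod)
  have deg: "Polynomial.degree (P j) = j" for j
    unfolding P_def by (subst degree_prod_eq_sum_degree) auto
  have lead: "Polynomial.coeff (P j) j = 1" for j
  proof -
    have "lead_coeff (P j) = 1" unfolding P_def lead_coeff_prod by simp
    then show ?thesis by (simp add: deg)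
  qed
  have "Determinant.det (Matrix.mat n n (\<lambda>(i, j). \<Prod>k<j. v i - v k)) =
    Determinant.det (Matrix.mat n n (\<lambda>(i, j). v i ^ j)) * Determinant.det (Matrix.mat n n (\<lambda>(k, j). Polynomial.coeff (P j) k))"
  proof (rule det_mat_mult)
    fix i j assume "i < n" "j < n"
    have "(\<Prod>k<j. v i - v k) = (\<Sum>k\<le>j. Polynomial.coeff (P j) k * v i ^ k)"
      unfolding val[symmetric] poly_altdef deg ..
    also have "\<dots> = (\<Sum>k<n. Polynomial.coeff (P j) k * v i ^ k)"
      by (rule sum.mono_neutral_left) (use \<open>j < n\<close> in \<open>auto simp: coeff_eq_0 deg\<close>)
    finally show "(\<Prod>k<j. v i - v k) = (\<Sum>k<n. v i ^ k * Polynomial.coeff (P j) k)" by (simp add: mult.commute)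
  qed
  also have "Determinant.det (Matrix.mat n n (\<lambda>(k, j). Polynomial.coeff (P j) k)) = 1"
    by (subst det_mat_upper_triangular) (simp_all add: coeff_eq_0 deg lead)
  finally have "Determinant.det (Matrix.mat n n (\<lambda>(i, j). v i ^ j)) = Determinant.det (Matrix.mat n n (\<lambda>(i, j). \<Prod>k<j. v i - v k))"
    by simp
  also have "\<dots> = (\<Prod>j<n. \<Prod>i<j. v j - v i)"
    by (rule det_mat_lower_triangular) auto
  finally show ?thesis .
qed

lemma det_mat_scale_rows:
  fixes f :: "nat \<Rightarrow> nat \<Rightarrow> 'a::comm_ring_1"
  shows "Determinant.det (Matrix.mat n n (\<lambda>(i, j). c i * f i j)) = (\<Prod>i<n. c i) * Determinant.det (Matrix.mat n n (\<lambda>(i, j). f i j))"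
proof -
  have "Determinant.det (Matrix.mat n n (\<lambda>(i, j). c i * f i j)) =
    Determinant.det (Matrix.mat n n (\<lambda>(i, j). if i = j then c i else 0)) * Determinant.det (Matrix.mat n n (\<lambda>(i, j). f i j))"
  proof (rule det_mat_mult)
    fix i j assume "i < n" "j < n"
    have "(\<Sum>k<n. (if i = k then c i else 0) * f k j) = (\<Sum>k<n. if i = k then c i * f i j else 0)"
      by (rule sum.cong) auto
    then show "c i * f i j = (\<Sum>k<n. (if i = k then c i else 0) * f k j)" using \<open>i < n\<close> by simp
  qed
  also have "Determinant.det (Matrix.mat n n (\<lambda>(i, j). if i = j then c i else 0)) = (\<Prod>i<n. c i)"
    by (subst det_mat_lower_triangular) auto
  finally show ?thesis .
qed

lemma det_mat_transpose:
  fixes f :: "nat \<Rightarrow> nat \<Rightarrow> 'a::comm_ring_1"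
  shows "Determinant.det (Matrix.mat n n (\<lambda>(i, j). f j i)) = Determinant.det (Matrix.mat n n (\<lambda>(i, j). f i j))"
proof -
  have "Matrix.mat n n (\<lambda>(i, j). f j i) = (Matrix.mat n n (\<lambda>(i, j). f i j))\<^sup>T"
    by (rule eq_matI) auto
  then show ?thesis by (simp add: det_transpose[of _ n])
qed

text \<open>Each index belongs to n - 1 pairs.\<close>

lemma prod_pairs_mult:
  fixes g :: "nat \<Rightarrow> 'a::comm_monoid_mult"
  shows "(\<Prod>j<n. \<Prod>i<j. g i * g j) = (\<Prod>i<n. g i ^ (n - 1))"
proof (induction n)
  case (Suc n)
  have "(\<Prod>i<n. g i ^ n) = (\<Prod>i<n. g i ^ (n - 1)) * (\<Prod>i<n. g i)"
    unfolding prod.distrib[symmetric] by (cases n) (auto intro!: prod.cong simp: mult.commute)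
  moreover have "(\<Prod>i<n. g i * g n) = (\<Prod>i<n. g i) * g n ^ n" by (simp add: prod.distrib)
  ultimately show ?case using Suc.IH by (simp add: mult.assoc)
qed simp

lemma prod_pairs_offdiag:
  fixes h :: "nat \<Rightarrow> nat \<Rightarrow> 'a::comm_monoid_mult"
  shows "(\<Prod>i<n. \<Prod>k\<in>{..<n} - {i}. h i k) = (\<Prod>j<n. \<Prod>i<j. h i j * h j i)"
proof (induction n)
  case (Suc n)
  have 1: "{..<Suc n} - {i} = insert n ({..<n} - {i})" if "i < n" for i using that by auto
  have "(\<Prod>i<n. \<Prod>k\<in>{..<Suc n} - {i}. h i k) = (\<Prod>i<n. h i n * (\<Prod>k\<in>{..<n} - {i}. h i k))"
    by (rule prod.cong) (simp_all add: 1)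
  moreover have "{..<Suc n} - {n} = {..<n}" by auto
  moreover have "(\<Prod>i<n. h i n * (\<Prod>k\<in>{..<n} - {i}. h i k)) * (\<Prod>i<n. h n i) =
      (\<Prod>i<n. \<Prod>k\<in>{..<n} - {i}. h i k) * (\<Prod>i<n. h i n * h n i)"
    by (simp only: prod.distrib mult_ac)
  ultimately show ?case using Suc.IH by (simp only: prod.lessThan_Suc)
qed simp

lemma free_paths_top: "free_paths n (y + int n) y = 1"
proof (induction n arbitrary: y)
  case (Suc n)
  have "free_paths (Suc n) (y + int (Suc n)) y = (\<Sum>t\<in>{y<..y + int (Suc n)}. free_paths n (y + 1 + int n) t)"
    by (simp add: add.assoc add.commute[of 1])
  also have "\<dots> = (\<Sum>t\<in>{y + 1}. free_paths n (y + 1 + int n) t)"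
    by (rule sum.mono_neutral_right) (auto intro!: paths_eq_0)
  finally show ?case using Suc.IH[of "y + 1"] by simp
qed simp

section \<open>The restricted walk acting on exponentials of right roots\<close>

context bethe_conf
begin

definition v :: "nat \<Rightarrow> complex" where "v = right_root_enum N L z"

lemma v_bij: "bij_betw v {..<N} rights"
proof -
  have "\<exists>f. bij_betw f {..<N} rights"
    using ex_bij_betw_nat_finite[OF finite_rights] unfolding card_rights atLeast0LessThan .
  then show ?thesis unfolding v_def right_root_enum_def by (rule someI_ex)
qed

lemma v_root:
  assumes "i < N"
  shows "v i \<in> rights" "v i \<in> bethe_roots" "v i \<noteq> 0" "v i + 1 \<noteq> 0"
    "v i ^ N * (v i + 1) ^ (L - N) = z ^ L"
proof -
  show r: "v i \<in> rights" using v_bij assms by (auto simp: bij_betw_def)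
  then show b: "v i \<in> bethe_roots" using roots_partition by auto
  show "v i \<noteq> 0" "v i + 1 \<noteq> 0" "v i ^ N * (v i + 1) ^ (L - N) = z ^ L" using bethe_rootsD[OF b] by auto
qed

text \<open>The coefficient of the exponential of \<open>v i\<close> in
  \<open>green (c - y)\<close>, valid for y < c; see \<open>green_eq_sum\<close>.\<close>

definition Cm :: "int \<Rightarrow> nat \<Rightarrow> complex" where
  "Cm c i = - ((- 1) ^ N) / dq (v i) * (v i + 1) powi (int L - 1 - c)"

lemma root_fun_rights: "- root_fun rights (c - y) = (\<Sum>i<N. Cm c i * (v i + 1) powi y)"
proof -
  have "- root_fun rights (c - y) = (\<Sum>w\<in>rights. - ((- 1) ^ N) / dq w * (w + 1) powi (int L - 1 - (c - y)))"
    by (simp add: root_fun_def sum_distrib_left sum_negf)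
  also have "\<dots> = (\<Sum>i<N. - ((- 1) ^ N) / dq (v i) * (v i + 1) powi (int L - 1 - (c - y)))"
    by (rule sum.reindex_bij_betw[OF v_bij, symmetric])
  also have "\<dots> = (\<Sum>i<N. Cm c i * (v i + 1) powi y)"
  proof (rule sum.cong[OF refl])
    fix i assume "i \<in> {..<N}"
    then have "(v i + 1) powi (int L - 1 - c + y) = (v i + 1) powi (int L - 1 - c) * (v i + 1) powi y"
      using v_root(4)[of i] by (intro power_int_add) auto
    moreover have "int L - 1 - (c - y) = int L - 1 - c + y" by simp
    ultimately show "- ((- 1) ^ N) / dq (v i) * (v i + 1) powi (int L - 1 - (c - y)) = Cm c i * (v i + 1) powi y"
      unfolding Cm_def by (simp only: mult.assoc)
  qed
  finally show ?thesis .
qed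

lemma green_eq_sum: "y < c \<Longrightarrow> green (c - y) = (\<Sum>i<N. Cm c i * (v i + 1) powi y)"
  using green_right[of "c - y"] root_fun_rights by simp

text \<open>The error of the exponential formula for \<open>green\<close> when it is used beyond its
  range s < c.\<close>

definition mu :: "int \<Rightarrow> int \<Rightarrow> complex" where
  "mu c s = green (c - s) - (\<Sum>i<N. Cm c i * (v i + 1) powi s)"

lemma mu_eq_0: "s < c \<Longrightarrow> mu c s = 0"
  by (simp add: mu_def green_eq_sum)

lemma mu_diag: "mu c c = (- 1) ^ N"
  using root_fun_diff(2) root_fun_rights[of c c, symmetric] NL by (simp add: mu_def green_left)

text \<open>The exponential of \<open>v i\<close>, as a row vector, carried through n steps below
  the barriers.\<close>

definition rsum :: "nat \<Rightarrow> nat \<Rightarrow> int \<Rightarrow> complex" where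
  "rsum i n w = (\<Sum>x\<in>{w..y1}. (v i + 1) powi x * of_nat (bounded_paths Y n x w))"

lemma rsum_extend: "w0 \<le> w \<Longrightarrow> rsum i n w = (\<Sum>x\<in>{w0..y1}. (v i + 1) powi x * of_nat (bounded_paths Y n x w))"
  unfolding rsum_def by (rule sum.mono_neutral_left) (auto intro!: paths_eq_0)

lemma rsum_Suc: "rsum i (Suc n) w = (\<Sum>t\<in>{w<..Y (int n + 1)}. rsum i n t)"
proof -
  have "rsum i (Suc n) w = (\<Sum>x\<in>{w..y1}. \<Sum>t\<in>{w<..x} \<inter> {..Y (int n + 1)}. (v i + 1) powi x * of_nat (bounded_paths Y n x t))"
    unfolding rsum_def paths.simps(2) of_nat_sum sum_distrib_left ..
  also have "\<dots> = (\<Sum>x\<in>{w..y1}. \<Sum>t\<in>{w<..Y (int n + 1)}. (v i + 1) powi x * of_nat (bounded_paths Y n x t))"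
    by (intro sum.cong refl sum.mono_neutral_left) (auto intro!: paths_eq_0)
  also have "\<dots> = (\<Sum>t\<in>{w<..Y (int n + 1)}. \<Sum>x\<in>{w..y1}. (v i + 1) powi x * of_nat (bounded_paths Y n x t))"
    by (rule sum.swap)
  also have "\<dots> = (\<Sum>t\<in>{w<..Y (int n + 1)}. rsum i n t)"
    by (rule sum.cong[OF refl], rule rsum_extend[symmetric]) simp
  finally show ?thesis .
qed

definition Am :: "nat \<Rightarrow> nat \<Rightarrow> complex" where
  "Am i j = v i powi (- (int j + 1)) * (v i + 1) powi (Y (int j + 1) + (int j + 1))"

text \<open>Every step below a barrier leaves a constant boundary term. \<open>qpoly m n\<close> is
  a unit constant left by step m, counted from 0, and carried through the later steps up to
  n.\<close>

primrec qpoly :: "nat \<Rightarrow> nat \<Rightarrow> int \<Rightarrow> complex" where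
  "qpoly m 0 w = 0"
| "qpoly m (Suc n) w = (if n = m then 1 else \<Sum>t\<in>{w<..Y (int n + 1)}. qpoly m n t)"

lemma qpoly_eq_0: "n \<le> m \<Longrightarrow> qpoly m n w = 0"
  by (induction n arbitrary: w) auto

lemma qpoly_diag: "qpoly m (Suc m) w = 1"
  by simp

text \<open>The factor that one step puts on the exponential of \<open>v i\<close>, apart from the
  boundary term. It is the reciprocal of the eigenvalue \<open>inverse (v i + 1) - 1\<close> of
  \<open>bdiff\<close>.\<close>

definition lam :: "nat \<Rightarrow> complex" where "lam i = - (v i + 1) / v i"

lemma sum_powi:
  fixes b :: complex
  assumes b: "b \<noteq> 0" "b \<noteq> 1" and "w \<le> y"
  shows "(\<Sum>t\<in>{w<..y}. b powi t) = (b powi (y + 1) - b powi (w + 1)) / (b - 1)"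
proof -
  have "(\<Sum>t\<in>{w<..w + int k}. b powi t) * (b - 1) = b powi (w + int k + 1) - b powi (w + 1)" for k
  proof (induction k)
    case (Suc k)
    have "{w<..w + int (Suc k)} = insert (w + int (Suc k)) {w<..w + int k}" by auto
    moreover have "b powi (w + int (Suc k)) * (b - 1) = b powi (w + int (Suc k) + 1) - b powi (w + int k + 1)"
    proof -
      have "b powi (w + int (Suc k) + 1) = b powi (w + int (Suc k)) * b powi 1"
        by (rule power_int_add) (use b in simp)
      then have "b powi (w + int (Suc k) + 1) = b powi (w + int (Suc k)) * b" by (simp only: power_int_1_right)
      moreover have "w + int k + 1 = w + int (Suc k)" by simp
      ultimately show ?thesis by (simp only: right_diff_distrib mult_1_right)
    qed
    ultimately show ?case using Suc by (simp add: distrib_right)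
  qed simp
  from this[of "nat (y - w)"] show ?thesis using assms by (simp add: field_simps)
qed

text \<open>One more step sums over w < t \<le> Y (n + 1). On the exponential this is a geometric
  sum: its lower end gives the factor \<open>lam i\<close>, its upper end the constant
  \<open>(- 1) ^ n * Am i n\<close>, an entry of the energy determinant. Earlier constants are
  carried along by \<open>qpoly\<close>. The bound on \<open>w\<close> makes the interval of t
  nonempty at each step.\<close>

lemma rsum_formula:
  assumes i: "i < N" and w: "w \<le> Y (int n + 1)"
  shows "rsum i n w = lam i ^ n * (v i + 1) powi w + (\<Sum>m<n. (- 1) ^ m * Am i m * qpoly m n w)"
  using w
proof (induction n arbitrary: w)
  case 0
  have "rsum i 0 w = (\<Sum>x\<in>{w..y1}. if x = w then (v i + 1) powi x else 0)"
    unfolding rsum_def by (rule sum.cong) auto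
  also have "\<dots> = (v i + 1) powi w" using 0 by (subst sum.delta) auto
  finally show ?case by simp
next
  case (Suc n)
  let ?y = "Y (int n + 1)"
  note r = v_root[OF i]
  have w: "w < ?y" using Suc.prems Y_less[of "int n + 1" 0] by (simp add: algebra_simps)
  have "rsum i (Suc n) w = (\<Sum>t\<in>{w<..?y}. lam i ^ n * (v i + 1) powi t + (\<Sum>m<n. (- 1) ^ m * Am i m * qpoly m n t))"
    unfolding rsum_Suc by (rule sum.cong[OF refl]) (use Suc.IH in auto)
  also have "\<dots> = lam i ^ n * (\<Sum>t\<in>{w<..?y}. (v i + 1) powi t) + (\<Sum>m<n. (- 1) ^ m * Am i m * (\<Sum>t\<in>{w<..?y}. qpoly m n t))"
    by (simp add: sum.distrib sum_distrib_left, rule sum.swap)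
  also have "(\<Sum>t\<in>{w<..?y}. (v i + 1) powi t) = ((v i + 1) powi (?y + 1) - (v i + 1) powi (w + 1)) / v i"
    using sum_powi[of "v i + 1" w ?y] r w by simp
  also have "lam i ^ n * (((v i + 1) powi (?y + 1) - (v i + 1) powi (w + 1)) / v i) =
    lam i ^ Suc n * (v i + 1) powi w + (- 1) ^ n * Am i n"
  proof -
    have 1: "lam i ^ n * (v i + 1) powi (w + 1) / v i = - (lam i ^ Suc n * (v i + 1) powi w)"
      using r by (simp add: lam_def power_int_add field_simps)
    have "lam i ^ n = (- 1) ^ n * ((v i + 1) ^ n * inverse (v i ^ n))"
      unfolding lam_def minus_divide_left[symmetric] power_minus[of "(v i + 1) / v i"]
      by (simp only: power_divide) (simp only: divide_inverse)
    moreover have "Am i n = (v i + 1) ^ n * inverse (v i ^ n) * (v i + 1) powi (?y + 1) / v i"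
    proof -
      have "(v i + 1) powi (?y + (int n + 1)) = (v i + 1) powi (int n + (?y + 1))" by (simp add: algebra_simps)
      also have "\<dots> = (v i + 1) ^ n * (v i + 1) powi (?y + 1)" using r by (subst power_int_add) auto
      moreover have "v i powi (- (int n + 1)) = inverse (v i ^ n) / v i"
      proof -
        have "- (int n + 1) = - int (Suc n)" by simp
        then show ?thesis
          by (simp only: power_int_minus power_int_of_nat power_Suc inverse_mult_distrib divide_inverse mult.commute)
      qed
      ultimately show ?thesis unfolding Am_def by (simp add: field_simps)
    qed
    ultimately have 2: "lam i ^ n * (v i + 1) powi (?y + 1) / v i = (- 1) ^ n * Am i n" by simp
    show ?thesis using 1 2 by (simp add: diff_divide_distrib right_diff_distrib)
  qed
  also have "lam i ^ Suc n * (v i + 1) powi w + (- 1) ^ n * Am i n +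
     (\<Sum>m<n. (- 1) ^ m * Am i m * (\<Sum>t\<in>{w<..?y}. qpoly m n t)) =
     lam i ^ Suc n * (v i + 1) powi w + (\<Sum>m<Suc n. (- 1) ^ m * Am i m * qpoly m (Suc n) w)"
    by (simp add: add.assoc add.commute)
  finally show ?case .
qed

text \<open>Bounded paths start at some x \<le> \<open>y1\<close> < c, where
  \<open>green (c - x)\<close> consists of exponentials of right roots alone.\<close>

lemma image_row_rsum:
  assumes c: "y1 < c"
  shows "image_row Y c t = green (c - t) - epsz * (\<Sum>i<N. Cm c i * rsum i N (t - int L))"
proof -
  let ?w = "t - int L"
  have "(\<Sum>x\<in>{?w<..y1}. green (c - x) * of_nat (bounded_paths Y N x ?w))
    = (\<Sum>x\<in>{?w..y1}. green (c - x) * of_nat (bounded_paths Y N x ?w))"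
    by (rule sum.mono_neutral_left) (auto simp: bounded_paths_eq_0)
  also have "\<dots> = (\<Sum>x\<in>{?w..y1}. \<Sum>i<N. Cm c i * ((v i + 1) powi x * of_nat (bounded_paths Y N x ?w)))"
    by (rule sum.cong[OF refl]) (use c in \<open>simp add: green_eq_sum sum_distrib_right mult.assoc\<close>)
  also have "\<dots> = (\<Sum>i<N. Cm c i * rsum i N ?w)"
    unfolding rsum_def sum_distrib_left by (rule sum.swap)
  finally show ?thesis unfolding image_row_def by simp
qed

lemma bdiff_rsum:
  assumes k: "k \<le> N"
  shows "(bdiff ^^ k) (\<lambda>t. rsum i N (t - int L)) y1 = rsum i (N - k) (y1 - int L)"
proof -
  let ?w0 = "y1 - int L - int k"
  have "(bdiff ^^ k) (\<lambda>t. rsum i N (t - int L)) y1 = (bdiff ^^ k) (rsum i N) (y1 - int L)"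
    by (rule bdiff_funpow_shift)
  also have "\<dots> = (bdiff ^^ k) (\<lambda>w. \<Sum>x\<in>{?w0..y1}. (v i + 1) powi x * of_nat (bounded_paths Y N x w)) (y1 - int L)"
    by (rule bdiff_funpow_cong) (rule rsum_extend, simp)
  also have "\<dots> = (\<Sum>x\<in>{?w0..y1}. (v i + 1) powi x * (bdiff ^^ k) (\<lambda>w. of_nat (bounded_paths Y N x w)) (y1 - int L))"
    by (rule bdiff_funpow_sum)
  also have "\<dots> = (\<Sum>x\<in>{?w0..y1}. (v i + 1) powi x * of_nat (bounded_paths Y (N - k) x (y1 - int L)))"
    by (simp only: bdiff_bounded_paths[OF k order_refl])
  also have "\<dots> = rsum i (N - k) (y1 - int L)" by (rule rsum_extend[symmetric]) simp
  finally show ?thesis .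
qed

definition Wm :: "nat \<Rightarrow> nat \<Rightarrow> complex" where
  "Wm m j = - epsz * (- 1) ^ m * qpoly m (Suc j) (y1 - int L)"

definition Hm :: "nat \<Rightarrow> nat \<Rightarrow> complex" where
  "Hm i j = (\<Sum>m<N. Am i m * Wm m j)"

text \<open>The Bethe equation: N steps and the shift by L multiply the exponential of a root by 1.
  Hence the exponential part of \<open>rsum\<close> cancels against that of \<open>green\<close>,
  and the boundary terms are left.\<close>

lemma epsz_lam: "i < N \<Longrightarrow> epsz * lam i ^ N * (v i + 1) powi (- int L) = 1"
proof -
  assume i: "i < N"
  note r = v_root[OF i]
  have zL: "z ^ L \<noteq> 0" using z0 by simp
  have "lam i ^ N = (- 1) ^ N * ((v i + 1) ^ N / v i ^ N)"
    unfolding lam_def minus_divide_left[symmetric] power_minus[of "(v i + 1) / v i"] by (simp add: power_divide)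
  then have "epsz * lam i ^ N * (v i + 1) powi (- int L) = ((- 1) ^ N * (- 1) ^ N) * (z ^ L * (v i + 1) ^ N / (v i ^ N * (v i + 1) ^ L))"
    unfolding epsz_def by (simp add: power_int_minus divide_inverse)
  also have "(v i + 1) ^ L = (v i + 1) ^ N * (v i + 1) ^ (L - N)" using NL by (simp add: power_add[symmetric])
  also have "z ^ L * (v i + 1) ^ N / (v i ^ N * ((v i + 1) ^ N * (v i + 1) ^ (L - N))) = 1"
    unfolding r(5)[symmetric] using r(3,4) by simp
  finally show ?thesis by (simp add: power_mult_distrib[symmetric])
qed

text \<open>At \<open>y1\<close> each difference undoes one step of the restricted walk, so N - 1 -
  j of them leave walks of j + 1 steps. After the cancellation by \<open>epsz_lam\<close> only the
  boundary terms of the first j + 1 barriers are present, whence \<open>Wm\<close> is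
  triangular.\<close>

lemma bdiff_image_row:
  assumes c: "y1 < c" and j: "j < N"
  shows "(bdiff ^^ (N - 1 - j)) (image_row Y c) y1 = (\<Sum>i<N. Cm c i * Hm i j)"
proof -
  let ?k = "N - 1 - j"
  have k: "?k \<le> N" "N - ?k = Suc j" using j by auto
  have "(bdiff ^^ ?k) (image_row Y c) y1 = (bdiff ^^ ?k) (\<lambda>t. - epsz * (\<Sum>i<N. Cm c i * rsum i N (t - int L)) + (\<Sum>i<N. Cm c i * (v i + 1) powi t)) y1"
    by (rule bdiff_funpow_cong) (use c in \<open>simp add: image_row_rsum green_eq_sum\<close>)
  also have "\<dots> = - epsz * (\<Sum>i<N. Cm c i * rsum i (Suc j) (y1 - int L)) + (\<Sum>i<N. Cm c i * (bdiff ^^ ?k) (\<lambda>t. (v i + 1) powi t) y1)"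
    unfolding bdiff_funpow_lincomb bdiff_funpow_sum bdiff_rsum[OF k(1)] k(2) ..
  also have "\<dots> = (\<Sum>i<N. Cm c i * ((bdiff ^^ ?k) (\<lambda>t. (v i + 1) powi t) y1 - epsz * rsum i (Suc j) (y1 - int L)))"
    by (simp add: sum_distrib_left sum_negf[symmetric] sum.distrib[symmetric] algebra_simps)
  also have "\<dots> = (\<Sum>i<N. Cm c i * Hm i j)"
  proof (rule sum.cong[OF refl])
    fix i assume "i \<in> {..<N}"
    then have i: "i < N" by simp
    note r = v_root[OF i]
    have l0: "lam i \<noteq> 0" using r(3,4) by (simp only: lam_def divide_eq_0_iff neg_equal_0_iff_equal simp_thms)
    have "inverse (v i + 1) - 1 = - (v i / (v i + 1))" using r(4) by (simp add: field_simps)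
    also have "\<dots> = inverse (lam i)"
      unfolding lam_def minus_divide_left[symmetric] inverse_minus_eq inverse_divide ..
    finally have "inverse (v i + 1) - 1 = inverse (lam i)" .
    then have "(bdiff ^^ ?k) (\<lambda>t. (v i + 1) powi t) y1 = inverse (lam i) ^ ?k * (v i + 1) powi y1"
      using bdiff_funpow_powi[OF r(4)] by simp
    also have "\<dots> = (epsz * lam i ^ N * (v i + 1) powi (- int L)) * (inverse (lam i) ^ ?k * (v i + 1) powi y1)"
      unfolding epsz_lam[OF i] by simp
    also have "\<dots> = epsz * (lam i ^ Suc j * (v i + 1) powi (y1 - int L))"
    proof -
      have "N = Suc j + ?k" using j by simp
      then have "lam i ^ N = lam i ^ (Suc j + ?k)" by (rule arg_cong)
      then have 1: "lam i ^ N = lam i ^ Suc j * lam i ^ ?k" by (simp only: power_add)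
      have 2: "(v i + 1) powi (y1 - int L) = (v i + 1) powi (- int L) * (v i + 1) powi y1"
        using r by (simp add: power_int_diff power_int_minus field_simps)
      have 3: "lam i ^ ?k * inverse (lam i) ^ ?k = 1" using l0 by (simp add: power_mult_distrib[symmetric])
      have "(epsz * lam i ^ N * (v i + 1) powi (- int L)) * (inverse (lam i) ^ ?k * (v i + 1) powi y1) =
        epsz * (lam i ^ Suc j * ((lam i ^ ?k * inverse (lam i) ^ ?k) * ((v i + 1) powi (- int L) * (v i + 1) powi y1)))"
        unfolding 1 by (simp only: mult_ac)
      then show ?thesis by (simp only: 3 2 mult_1)
    qed
    finally have b: "(bdiff ^^ ?k) (\<lambda>t. (v i + 1) powi t) y1 = epsz * (lam i ^ Suc j * (v i + 1) powi (y1 - int L))" .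
    \<comment> \<open>For j = N - 1 this is an equality, by the periodicity of Y.\<close>
    have "y1 - int L \<le> Y (int (Suc j) + 1)"
    proof (cases "Suc j < N")
      case True
      then show ?thesis using Y_period_less[of "Suc j"] by simp
    next
      case False
      then show ?thesis using j Y_period by (metis Suc_lessI order_refl)
    qed
    then have "rsum i (Suc j) (y1 - int L) = lam i ^ Suc j * (v i + 1) powi (y1 - int L) + (\<Sum>m<Suc j. (- 1) ^ m * Am i m * qpoly m (Suc j) (y1 - int L))"
      by (rule rsum_formula[OF i])
    then have "(bdiff ^^ ?k) (\<lambda>t. (v i + 1) powi t) y1 - epsz * rsum i (Suc j) (y1 - int L) =
      - epsz * (\<Sum>m<Suc j. (- 1) ^ m * Am i m * qpoly m (Suc j) (y1 - int L))"
      unfolding b by (simp only: distrib_left) simp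
    also have "(\<Sum>m<Suc j. (- 1) ^ m * Am i m * qpoly m (Suc j) (y1 - int L)) = (\<Sum>m<N. (- 1) ^ m * Am i m * qpoly m (Suc j) (y1 - int L))"
    proof (rule sum.mono_neutral_left)
      show "\<forall>m\<in>{..<N} - {..<Suc j}. (- 1) ^ m * Am i m * qpoly m (Suc j) (y1 - int L) = 0"
        using qpoly_eq_0[of "Suc j"] by (auto simp del: qpoly.simps)
    qed (use j in auto)
    also have "- epsz * \<dots> = Hm i j"
      unfolding Hm_def Wm_def sum_distrib_left by (rule sum.cong[OF refl]) (simp only: mult_ac)
    finally show "Cm c i * ((bdiff ^^ ?k) (\<lambda>t. (v i + 1) powi t) y1 - epsz * rsum i (Suc j) (y1 - int L)) = Cm c i * Hm i j"
      by simp
  qed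
  finally show ?thesis .
qed

text \<open>On the span of the functions \<open>free_paths N (ix i)\<close> the functionals \<open>phi j\<close> are triangular, and they
  turn \<open>image_row\<close> into a product of block matrices.\<close>

definition phi :: "nat \<Rightarrow> (int \<Rightarrow> complex) \<Rightarrow> complex" where
  "phi j h = (if j < N then (bdiff ^^ (N - 1 - j)) h y1 else h (ix (j - N)))"

lemma ix_less_0: "N \<le> j \<Longrightarrow> j < rk \<Longrightarrow> ix (j - N) < 0"
  using rk by (simp add: ix_def of_nat_diff)

lemma phi_free_paths:
  "phi j (\<lambda>t. of_nat (free_paths N (ix i) t)) =
    (if j < N then of_nat (free_paths (Suc j) (ix i) y1) else of_nat (free_paths N (ix i) (ix (j - N))))"
proof (cases "j < N")
  case True
  then have "N - 1 - j \<le> N" "N - (N - 1 - j) = Suc j" by auto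
  then show ?thesis using True by (simp only: phi_def bdiff_free_paths if_True)
qed (simp add: phi_def)

lemma det_phi_free_paths:
  "Determinant.det (Matrix.mat rk rk (\<lambda>(i, j). phi j (\<lambda>t. of_nat (free_paths N (ix i) t)))) = 1"
proof -
  have "phi j (\<lambda>t. of_nat (free_paths N (ix i) t)) = 0" if "i < j" for i j
    unfolding phi_free_paths using that by (auto simp: ix_def of_nat_diff simp del: paths.simps intro!: paths_eq_0)
  moreover have "phi i (\<lambda>t. of_nat (free_paths N (ix i) t)) = 1" for i
  proof (cases "i < N")
    case True
    have "ix i = y1 + int (Suc i)" by (simp add: ix_def)
    then show ?thesis unfolding phi_free_paths using True free_paths_top[of "Suc i" y1] by (simp only: if_True of_nat_1)
  next
    case False
    then have "ix i = ix (i - N) + int N" by (simp add: ix_def of_nat_diff)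
    then show ?thesis unfolding phi_free_paths using False free_paths_top[of N "ix (i - N)"] by simp
  qed
  ultimately show ?thesis by (subst det_mat_lower_triangular) simp_all
qed

lemma phi_image_row_D:
  assumes i: "i < rk" and j: "j < rk"
  shows "phi j (image_row Y (ix i)) = (\<Sum>k<rk. D i k * phi j (\<lambda>t. of_nat (free_paths N (ix k) t)))"
proof (cases "j < N")
  case True
  have "(bdiff ^^ (N - 1 - j)) (image_row Y (ix i)) y1 =
    (bdiff ^^ (N - 1 - j)) (\<lambda>t. \<Sum>k<rk. D i k * of_nat (free_paths N (ix k) t)) y1"
    by (rule bdiff_funpow_cong) (use Y1 i in \<open>simp add: image_row_expansion\<close>)
  then show ?thesis unfolding phi_def bdiff_funpow_sum using True by simp
next
  case False
  then show ?thesis using image_row_expansion[OF ix_less_0 i, of j] j by (simp add: phi_def)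
qed

definition First :: "nat \<Rightarrow> nat \<Rightarrow> complex" where
  "First i k = (if k < N then Cm (ix i) k else mu (ix i) (ix (k - N)))"

definition Second :: "nat \<Rightarrow> nat \<Rightarrow> complex" where
  "Second k j = (if k < N
     then if j < N then Hm k j
       else (v k + 1) powi ix (j - N) - epsz * rsum k N (ix (j - N) - int L)
     else if k = j then 1 else 0)"

text \<open>Every \<open>image_row Y (ix i)\<close> is, on the negative integers, a combination of N
  fixed functions, one per right root, and of corrections by \<open>mu\<close> at the points between
  \<open>y1\<close> and 0. \<open>First\<close> holds the coefficients and \<open>Second\<close> the
  values of the functionals on these generators. The first N functionals look only at points up to
  \<open>y1\<close> and do not see the corrections.\<close>

lemma phi_image_row_factor:
  assumes i: "i < rk" and j: "j < rk"
  shows "phi j (image_row Y (ix i)) = (\<Sum>k<rk. First i k * Second k j)"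
proof -
  have c: "y1 < ix i" by (simp add: ix_def)
  have "{..<rk} = {..<N} \<union> {N..<rk}" using rk by auto
  then have "(\<Sum>k<rk. First i k * Second k j) = (\<Sum>k<N. First i k * Second k j) + (\<Sum>k\<in>{N..<rk}. First i k * Second k j)"
    by (simp add: sum.union_disjoint ivl_disj_int)
  also have "(\<Sum>k\<in>{N..<rk}. First i k * Second k j) = (\<Sum>k\<in>{N..<rk}. if k = j then mu (ix i) (ix (k - N)) else 0)"
    by (rule sum.cong) (auto simp: First_def Second_def)
  also have "\<dots> = (if N \<le> j then mu (ix i) (ix (j - N)) else 0)"
    using j by (subst sum.delta) auto
  finally have s: "(\<Sum>k<rk. First i k * Second k j) = (\<Sum>k<N. First i k * Second k j) + (if N \<le> j then mu (ix i) (ix (j - N)) else 0)" .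
  show ?thesis
  proof (cases "j < N")
    case True
    then show ?thesis unfolding s using bdiff_image_row[OF c True] by (simp add: phi_def First_def Second_def)
  next
    case False
    let ?s = "ix (j - N)"
    have "(\<Sum>k<N. First i k * Second k j) = (\<Sum>k<N. Cm (ix i) k * (v k + 1) powi ?s) - epsz * (\<Sum>k<N. Cm (ix i) k * rsum k N (?s - int L))"
      unfolding sum_distrib_left sum_subtractf[symmetric]
      by (rule sum.cong) (use False in \<open>auto simp: First_def Second_def algebra_simps\<close>)
    then show ?thesis unfolding s image_row_rsum[OF c] using False by (simp add: phi_def image_row_rsum[OF c] mu_def)
  qed
qed

section \<open>Determinants of the two block factors\<close>

definition dd :: nat where "dd = rk - N"

lemma dd: "rk = dd + N" "rk = N + dd" "int dd = - 1 - y1" "ix (dd + i) = int i"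
  using rk by (auto simp: dd_def ix_def of_nat_diff)

lemma det_Second: "Determinant.det (Matrix.mat rk rk (\<lambda>(i, j). Second i j)) = Determinant.det (Matrix.mat N N (\<lambda>(i, j). Hm i j))"
proof -
  let ?A = "Matrix.mat N N (\<lambda>(i, j). Hm i j)" and ?B = "Matrix.mat N dd (\<lambda>(i, j). Second i (N + j))"
  have "Matrix.mat rk rk (\<lambda>(i, j). Second i j) = four_block_mat ?A ?B (0\<^sub>m dd N) (1\<^sub>m dd)"
    unfolding dd(2) by (rule eq_matI) (auto simp: Second_def)
  then show ?thesis
    using det_four_block_mat_lower_left_zero[of ?A N ?B dd "0\<^sub>m dd N" "1\<^sub>m dd"] by simp
qed

text \<open>The correction points are negative and \<open>mu c\<close> vanishes below c, so rows
  with \<open>ix i\<close> \<ge> 0 have no correction entries; they form the block with c = 0, ...,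
  N - 1. The correction block of the other rows is triangular with diagonal
  \<open>(- 1) ^ N\<close>, and its determinant cancels the sign of exchanging the column
  blocks.\<close>

lemma det_First: "Determinant.det (Matrix.mat rk rk (\<lambda>(i, j). First i j)) = Determinant.det (Matrix.mat N N (\<lambda>(i, j). Cm (int i) j))"
proof -
  let ?A = "Matrix.mat dd N (\<lambda>(i, j). Cm (ix i) j)" and ?B = "Matrix.mat dd dd (\<lambda>(i, j). mu (ix i) (ix j))"
    and ?C = "Matrix.mat N N (\<lambda>(i, j). Cm (int i) j)"
  have "Matrix.mat rk rk (\<lambda>(i, j). First i j) = four_block_mat ?A ?B ?C (0\<^sub>m N dd)"
  proof (rule eq_matI)
    fix i j assume "i < dim_row (four_block_mat ?A ?B ?C (0\<^sub>m N dd))" "j < dim_col (four_block_mat ?A ?B ?C (0\<^sub>m N dd))"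
    then have ij: "i < dd + N" "j < N + dd" by auto
    have "ix i = int (i - dd)" if "dd \<le> i" using dd(4)[of "i - dd"] that by simp
    moreover have "ix (j - N) < ix i" if "dd \<le> i" "N \<le> j" using that ij by (simp add: ix_def)
    ultimately show "Matrix.mat rk rk (\<lambda>(i, j). First i j) $$ (i, j) = four_block_mat ?A ?B ?C (0\<^sub>m N dd) $$ (i, j)"
      using ij by (auto simp: First_def dd(1) not_less intro: mu_eq_0)
  qed (simp_all add: dd(1))
  then have "Determinant.det (Matrix.mat rk rk (\<lambda>(i, j). First i j)) = (- 1) ^ (dd * N) * (Determinant.det ?B * Determinant.det ?C)"
    using det_four_block_lower_right_zero[of ?A dd N ?B ?C] by simp
  also have "Determinant.det ?B = (\<Prod>i<dd. mu (ix i) (ix i))"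
    by (rule det_mat_upper_triangular) (simp add: mu_eq_0 ix_def)
  also have "\<dots> = (- 1) ^ (dd * N)" by (simp add: mu_diag power_mult[symmetric] mult.commute)
  finally show ?thesis by (simp add: mult.assoc[symmetric] power_mult_distrib[symmetric])
qed

lemma det_D: "Determinant.det (Matrix.mat rk rk (\<lambda>(i, j). D i j)) =
    Determinant.det (Matrix.mat N N (\<lambda>(i, j). Cm (int i) j)) * Determinant.det (Matrix.mat N N (\<lambda>(i, j). Hm i j))"
proof -
  have "Determinant.det (Matrix.mat rk rk (\<lambda>(i, j). phi j (image_row Y (ix i)))) =
    Determinant.det (Matrix.mat rk rk (\<lambda>(i, j). D i j)) * 1"
    unfolding det_phi_free_paths[symmetric] by (rule det_mat_mult) (rule phi_image_row_D)
  moreover have "Determinant.det (Matrix.mat rk rk (\<lambda>(i, j). phi j (image_row Y (ix i)))) =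
    Determinant.det (Matrix.mat N N (\<lambda>(i, j). Cm (int i) j)) * Determinant.det (Matrix.mat N N (\<lambda>(i, j). Hm i j))"
    unfolding det_First[symmetric] det_Second[symmetric] by (rule det_mat_mult) (rule phi_image_row_factor)
  ultimately show ?thesis by simp
qed

section \<open>Comparison with the normalized energy function\<close>

lemma det_Hm: "Determinant.det (Matrix.mat N N (\<lambda>(i, j). Hm i j)) =
    Determinant.det (Matrix.mat N N (\<lambda>(i, j). Am i j)) * ((- epsz) ^ N * (\<Prod>j<N. (- 1) ^ j))"
proof -
  have "Determinant.det (Matrix.mat N N (\<lambda>(i, j). Hm i j)) =
    Determinant.det (Matrix.mat N N (\<lambda>(i, j). Am i j)) * Determinant.det (Matrix.mat N N (\<lambda>(i, j). Wm i j))"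
    by (rule det_mat_mult) (simp add: Hm_def)
  also have "Determinant.det (Matrix.mat N N (\<lambda>(i, j). Wm i j)) = (\<Prod>j<N. Wm j j)"
    by (rule det_mat_upper_triangular) (simp add: Wm_def qpoly_eq_0 del: qpoly.simps)
  also have "\<dots> = (\<Prod>j<N. - epsz * (- 1) ^ j)"
    by (rule prod.cong) (simp_all only: Wm_def qpoly_diag mult_1_right)
  also have "\<dots> = (- epsz) ^ N * (\<Prod>j<N. (- 1) ^ j)"
    by (simp only: prod.distrib prod_constant card_lessThan)
  finally show ?thesis .
qed

text \<open>The order of subtraction suits Vandermonde determinants in inverses:
  \<open>inverse b - inverse a\<close> is \<open>(a - b)\<close> divided by
  \<open>a * b\<close>.\<close>

definition Vd :: complex where "Vd = (\<Prod>j<N. \<Prod>i<j. v i - v j)"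

lemma v_inj: "i < N \<Longrightarrow> j < N \<Longrightarrow> v i = v j \<longleftrightarrow> i = j"
  using v_bij by (auto simp: bij_betw_def inj_on_def)

lemma Vd_nonzero: "Vd \<noteq> 0"
  unfolding Vd_def by (auto simp: v_inj)

lemma prod_inverse_pairs:
  assumes "\<And>i. i < N \<Longrightarrow> v i + s \<noteq> 0"
  shows "(\<Prod>j<N. \<Prod>i<j. inverse (v j + s) - inverse (v i + s)) = Vd * (\<Prod>i<N. inverse (v i + s) ^ (N - 1))"
proof -
  have "(\<Prod>j<N. \<Prod>i<j. inverse (v j + s) - inverse (v i + s)) =
    (\<Prod>j<N. \<Prod>i<j. (v i - v j) * (inverse (v i + s) * inverse (v j + s)))"
  proof (intro prod.cong refl)
    fix j i assume "j \<in> {..<N}" "i \<in> {..<j}"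
    then have "v i + s \<noteq> 0" "v j + s \<noteq> 0" using assms[of i] assms[of j] by auto
    then show "inverse (v j + s) - inverse (v i + s) = (v i - v j) * (inverse (v i + s) * inverse (v j + s))"
      by (simp add: field_simps)
  qed
  then show ?thesis by (simp only: prod.distrib[of "\<lambda>i. v i - v _"] prod.distrib[of "\<lambda>j. \<Prod>i<j. v i - v j"] prod_pairs_mult Vd_def)
qed

text \<open>The derivative at \<open>v i\<close> is the product of its differences with the left
  roots and with the other right roots. In the product over i each pair of right roots occurs in
  both orders, which gives the square of \<open>Vd\<close> up to sign.\<close>

lemma prod_dq: "(\<Prod>i<N. dq (v i)) = (\<Prod>i<N. \<Prod>u\<in>lefts. v i - u) * ((\<Prod>j<N. (- 1) ^ j) * Vd\<^sup>2)"
proof -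
  have "dq (v i) = (\<Prod>u\<in>lefts. v i - u) * (\<Prod>k\<in>{..<N} - {i}. v i - v k)" if i: "i < N" for i
  proof -
    have "bethe_roots - {v i} = lefts \<union> (rights - {v i})"
      using roots_partition v_root(1)[OF i] by auto
    then have "dq (v i) = (\<Prod>u\<in>lefts. v i - u) * (\<Prod>w\<in>rights - {v i}. v i - w)"
      unfolding dq_def using roots_partition(2) by (simp only:) (rule prod.union_disjoint, auto)
    moreover have "bij_betw v ({..<N} - {i}) (rights - {v i})"
      using v_bij i by (intro bij_betw_DiffI) (auto simp: bij_betw_def)
    then have "(\<Prod>w\<in>rights - {v i}. v i - w) = (\<Prod>k\<in>{..<N} - {i}. v i - v k)"
      by (rule prod.reindex_bij_betw[symmetric])
    ultimately show ?thesis by simp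
  qed
  then have "(\<Prod>i<N. dq (v i)) = (\<Prod>i<N. \<Prod>u\<in>lefts. v i - u) * (\<Prod>i<N. \<Prod>k\<in>{..<N} - {i}. v i - v k)"
    by (simp add: prod.distrib)
  also have "(\<Prod>i<N. \<Prod>k\<in>{..<N} - {i}. v i - v k) = (\<Prod>j<N. \<Prod>i<j. (v i - v j) * (v j - v i))"
    by (rule prod_pairs_offdiag)
  also have "\<dots> = (\<Prod>j<N. \<Prod>i<j. (- 1) * ((v i - v j) * (v i - v j)))"
    by (intro prod.cong refl) (simp add: algebra_simps)
  also have "\<dots> = (\<Prod>j<N. (- 1) ^ j) * Vd\<^sup>2"
    by (simp only: prod.distrib prod_constant card_lessThan Vd_def power2_eq_square)
  finally show ?thesis .
qed

text \<open>After transposition row i is a multiple of the powers of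
  \<open>inverse (v i + 1)\<close>. The Vandermonde determinant in these inverses takes N - 1 of the
  L - 1 factors \<open>v i + 1\<close>, and L - N remain, as in the normalization.\<close>

lemma det_Cm: "Determinant.det (Matrix.mat N N (\<lambda>(i, j). Cm (int i) j)) =
    (- ((- 1) ^ N)) ^ N / (\<Prod>i<N. dq (v i)) * (\<Prod>i<N. (v i + 1) ^ (L - N)) * Vd"
proof -
  have "Determinant.det (Matrix.mat N N (\<lambda>(i, j). Cm (int i) j)) = Determinant.det (Matrix.mat N N (\<lambda>(i, j). Cm (int j) i))"
    by (rule det_mat_transpose[symmetric])
  also have "\<dots> = Determinant.det (Matrix.mat N N (\<lambda>(i, j). - ((- 1) ^ N) / dq (v i) * (v i + 1) ^ (L - 1) * inverse (v i + 1) ^ j))"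
  proof (rule arg_cong[where f = Determinant.det], rule cong_mat[OF refl refl], clarsimp)
    fix i j assume "i < N"
    then have r: "v i + 1 \<noteq> 0" by (rule v_root)
    have "(v i + 1) powi (int (L - 1) - int j) = (v i + 1) ^ (L - 1) * inverse (v i + 1) ^ j"
      using r by (simp add: power_int_diff power_inverse divide_inverse)
    moreover have "int (L - 1) = int L - 1" using NL by simp
    ultimately show "Cm (int j) i = - ((- 1) ^ N * (v i + 1) ^ (L - Suc 0) * inverse (v i + 1) ^ j / dq (v i))"
      unfolding Cm_def by simp
  qed
  also have "\<dots> = (\<Prod>i<N. - ((- 1) ^ N) / dq (v i) * (v i + 1) ^ (L - 1)) * (Vd * (\<Prod>i<N. inverse (v i + 1) ^ (N - 1)))"
    unfolding det_mat_scale_rows det_vandermonde using prod_inverse_pairs[of 1] v_root(4) by simp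
  also have "\<dots> = (\<Prod>i<N. - ((- 1) ^ N) / dq (v i)) * (\<Prod>i<N. (v i + 1) ^ (L - 1) * inverse (v i + 1) ^ (N - 1)) * Vd"
    by (simp only: prod.distrib mult_ac)
  also have "(\<Prod>i<N. (v i + 1) ^ (L - 1) * inverse (v i + 1) ^ (N - 1)) = (\<Prod>i<N. (v i + 1) ^ (L - N))"
  proof (rule prod.cong[OF refl])
    fix i assume "i \<in> {..<N}"
    then have r: "v i + 1 \<noteq> 0" by (simp add: v_root(4))
    have "L - 1 = (L - N) + (N - 1)" using NL N0 by simp
    then have "(v i + 1) ^ (L - 1) = (v i + 1) ^ (L - N) * (v i + 1) ^ (N - 1)" by (simp only: power_add)
    then show "(v i + 1) ^ (L - 1) * inverse (v i + 1) ^ (N - 1) = (v i + 1) ^ (L - N)"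
      using r by (simp add: power_inverse)
  qed
  also have "(\<Prod>i<N. - ((- 1) ^ N) / dq (v i)) = (- ((- 1) ^ N)) ^ N / (\<Prod>i<N. dq (v i))"
    by (simp only: prod_dividef prod_constant card_lessThan)
  finally show ?thesis .
qed

lemma det_energy_denominator:
  "Determinant.det (Matrix.mat N N (\<lambda>(i, j). v i powi (- (int j + 1)))) = Vd / (\<Prod>i<N. v i) ^ N"
proof -
  have e: "v i powi (- (int j + 1)) = inverse (v i) * inverse (v i) ^ j" for i j
  proof -
    have "- (int j + 1) = - int (Suc j)" by simp
    then show ?thesis
      by (simp only: power_int_minus power_int_of_nat power_Suc inverse_mult_distrib power_inverse)
  qed
  have "Determinant.det (Matrix.mat N N (\<lambda>(i, j). v i powi (- (int j + 1)))) =
    Determinant.det (Matrix.mat N N (\<lambda>(i, j). inverse (v i) * inverse (v i) ^ j))"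
    unfolding e ..
  also have "\<dots> = (\<Prod>i<N. inverse (v i)) * (Vd * (\<Prod>i<N. inverse (v i) ^ (N - 1)))"
    unfolding det_mat_scale_rows det_vandermonde using prod_inverse_pairs[of 0] v_root(3) by simp
  also have "\<dots> = Vd * (\<Prod>i<N. inverse (v i) ^ (N - 1) * inverse (v i))"
    by (simp only: prod.distrib mult_ac)
  also have "(\<Prod>i<N. inverse (v i) ^ (N - 1) * inverse (v i)) = inverse ((\<Prod>i<N. v i) ^ N)"
  proof -
    have "(\<Prod>i<N. inverse (v i) ^ (N - 1) * inverse (v i)) = (\<Prod>i<N. inverse (v i) ^ N)"
      by (intro prod.cong refl power_minus_mult N0)
    also have "\<dots> = (\<Prod>i<N. inverse (v i)) ^ N" by (rule prod_power_distrib[symmetric])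
    also have "(\<Prod>i<N. inverse (v i)) = inverse (\<Prod>i<N. v i)"
      using prod_inversef[of v "{..<N}"] by (simp add: o_def)
    finally show ?thesis by (simp only: power_inverse)
  qed
  finally show ?thesis by (simp add: divide_inverse)
qed

text \<open>The product of all roots is read off from \<open>bethe_q\<close> at 0. The two products
  multiply to \<open>z ^ L\<close> times a sign with exponent N + 1, and the N-th power removes the
  sign because N (N + 1) is even.\<close>

lemma prod_roots: "((\<Prod>u\<in>lefts. - u) * (\<Prod>i<N. v i)) ^ N = (z ^ L) ^ N"
proof -
  have "- (z ^ L) = (\<Prod>w\<in>bethe_roots. 0 - w)"
    unfolding bethe_q_factor[symmetric] bethe_q_def using N0 by simp
  also have "\<dots> = (\<Prod>u\<in>lefts. - u) * (\<Prod>w\<in>rights. - w)"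
    unfolding roots_partition(1) by (subst prod.union_disjoint) (simp_all add: roots_partition(2))
  also have "(\<Prod>w\<in>rights. - w) = (\<Prod>i<N. - v i)"
    by (rule prod.reindex_bij_betw[OF v_bij, symmetric])
  also have "\<dots> = (- 1) ^ N * (\<Prod>i<N. v i)" by (simp add: prod_uminus)
  finally have "- (z ^ L) = (- 1) ^ N * ((\<Prod>u\<in>lefts. - u) * (\<Prod>i<N. v i))" by (simp only: mult.left_commute)
  then have eq: "(- 1) ^ N * ((\<Prod>u\<in>lefts. - u) * (\<Prod>i<N. v i)) = - (z ^ L)" ..
  show ?thesis
  proof (cases "even N")
    case True
    then have "(\<Prod>u\<in>lefts. - u) * (\<Prod>i<N. v i) = - (z ^ L)" using eq by simp
    then show ?thesis by (simp only: power_minus_even[OF True])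
  next
    case False
    then have "(\<Prod>u\<in>lefts. - u) * (\<Prod>i<N. v i) = z ^ L" using eq by simp
    then show ?thesis by (simp only:)
  qed
qed

text \<open>\<open>Vd\<close> enters once through \<open>det_Cm\<close> and squared in the
  denominator through \<open>prod_dq\<close>, which leaves the Vandermonde denominator of the energy
  function. The N-th power of \<open>epsz\<close> from \<open>det_Hm\<close> supplies the product of
  roots from \<open>prod_roots\<close>.\<close>

lemma energy_norm_eq: "energy_norm N L Y z = fredholm_det {..0} (kernel_operator {..0} K)"
proof -
  let ?P = "\<Prod>i<N. \<Prod>u\<in>lefts. v i - u" and ?Q = "\<Prod>i<N. (v i + 1) ^ (L - N)"
    and ?A = "Determinant.det (Matrix.mat N N (\<lambda>(i, j). Am i j))" and ?s = "\<Prod>j<N. (- 1) ^ j :: complex"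
  have s: "?s \<noteq> 0" by simp
  have P: "(\<Prod>w\<in>rights. \<Prod>u\<in>lefts. w - u) = ?P" "(\<Prod>w\<in>rights. (w + 1) ^ (L - N)) = ?Q"
    by (rule prod.reindex_bij_betw[OF v_bij, symmetric])+
  have "energy N L Y z = ?A / (Vd / (\<Prod>i<N. v i) ^ N)"
    unfolding energy_def Let_def v_def[symmetric] det_energy_denominator Am_def ..
  moreover have "(\<Prod>u\<in>lefts. (- u) ^ N) = (\<Prod>u\<in>lefts. - u) ^ N" by (rule prod_power_distrib[symmetric])
  ultimately have "energy_norm N L Y z = ((\<Prod>u\<in>lefts. - u) * (\<Prod>i<N. v i)) ^ N * ?Q / ?P * ?A / Vd"
    unfolding energy_norm_def P by (simp add: power_mult_distrib)
  also have "\<dots> = (z ^ L) ^ N * ?Q / ?P * ?A / Vd" unfolding prod_roots ..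
  also have "\<dots> = ((- ((- 1) ^ N)) ^ N / (?P * (?s * Vd\<^sup>2)) * ?Q * Vd) * (?A * ((- epsz) ^ N * ?s))"
  proof -
    have "(- ((- 1) ^ N)) * (- epsz) = z ^ L"
      by (simp add: epsz_def mult.assoc[symmetric] power_mult_distrib[symmetric])
    then have e: "(- ((- 1) ^ N)) ^ N * (- epsz) ^ N = (z ^ L) ^ N" by (simp only: power_mult_distrib[symmetric])
    show ?thesis unfolding e[symmetric] using s Vd_nonzero by (simp add: power2_eq_square)
  qed
  also have "\<dots> = fredholm_det {..0} (kernel_operator {..0} K)"
    unfolding fredholm_det_K det_D det_Cm det_Hm prod_dq ..
  finally show ?thesis .
qed

end

theorem theorem5p8:
  fixes N L :: nat and z \<zeta> :: complex and \<rho> :: real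
  assumes "0 < N" and "N < L"
    and "0 < cmod z" and "cmod z < bethe_radius N L"
    and "0 < \<rho>" and "\<rho> < 1"
    and "right_root_radius N L z < \<rho>" and "\<rho> < 1 - left_root_radius N L z"
    and "\<rho> ^ N * (1 - \<rho>) ^ (L - N) > cmod z ^ L"
    and "\<zeta> = z ^ L / of_real ((- \<rho>) ^ N * (1 - \<rho>) ^ (L - N))"
  shows "cmod \<zeta> < 1 \<and>
    (\<forall>Y \<in> Pconf N L. Y 1 < 0 \<longrightarrow>
       trace_class {..0} (kernel_operator {..0} (K_en \<rho> N L Y \<zeta>)) \<and>
       energy_norm N L Y z = fredholm_det {..0} (kernel_operator {..0} (K_en \<rho> N L Y \<zeta>)))"
proof (intro conjI ballI impI)
  interpret bethe_walk N L z \<rho> \<zeta>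
    by unfold_locales (use assms in simp_all)
  show "cmod \<zeta> < 1" by (rule cmod_\<zeta>)
  fix Y assume Y: "Y \<in> Pconf N L" "Y 1 < 0"
  interpret bethe_conf N L z \<rho> \<zeta> Y
    by unfold_locales (rule Y)+
  show "trace_class {..0} (kernel_operator {..0} (K_en \<rho> N L Y \<zeta>))" by (rule trace_class_K)
  show "energy_norm N L Y z = fredholm_det {..0} (kernel_operator {..0} (K_en \<rho> N L Y \<zeta>))"
    by (rule energy_norm_eq)
qed

end
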